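(* Let $$I(q)=\sum_{n\geq 0}\frac{2}{(n+1)(2n+1)}\binom{3n}{n}q^n\qquad\text{and}\qquad \widetilde I(q)=\sum_{n\geq 1}\lvert\widetilde{\mathcal W}_2(n)\rvert q^n,$$ where $\widetilde{\mathcal W}_2(n)=\{w\in\widetilde S_n:\widetilde{\mathtt s}^{\,2}(w)=e\}$ is the set of $2$-stack-sortable affine permutations in $\widetilde S_n$. Then, as formal power series, $$\widetilde I(q)=\frac{q\,I'(q)}{I(q)\,(I(q)-1)}-1.$$
   Context: An affine permutation of size $n$ is a bijection $w:\mathbb Z\to\mathbb Z$ with $w(i+n)=w(i)+n$ for all $i\in\mathbb Z$ and $\sum_{i=1}^n w(i)=\binom{n+1}{2}$. They form the affine symmetric group $\widetilde S_n$ under composition (trivial if $n=1$), a Coxeter group with simple generators $\widetilde s_1,\ldots,\widetilde s_n$, where $\widetilde s_i$ swaps $i+mn$ and $i+mn+1$ for all $m\in\mathbb Z$ and fixes all other integers. The left weak order is $x\leq_L y\iff\ell(yx^{-1})=\ell(y)-\ell(x)$, $\ell$ being Coxeter length; $e$ is the identity. Affine sylvester congruence. For $w\in\widetilde S_n$ define a partial order $\preceq_w$ on $\mathbb Z$ (positions): for $i<j$, the positions $i,j$ are incomparable if and only if there is $k$ with $i<k<j$ and $w(k)>\max\{w(i),w(j)\}$; otherwise the position with the smaller value of $w$ is below the other. (This is the descendant order of the decreasing affine binary plane tree with in-order reading $w$.) The affine sylvester congruence is $v\equiv_{\widetilde{\mathrm{syl}}}w\iff{\preceq_v}={\preceq_w}$;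 it is a semilattice congruence on $(\widetilde S_n,\leq_L)$ in which $\{e\}$ is a class, and each class has a unique $\leq_L$-minimal element. Let $\pi_\downarrow(w)$ be the minimal element of the class of $w$. The affine stack-sorting map is $\widetilde{\mathtt s}:\widetilde S_n\to\widetilde S_n$, $\widetilde{\mathtt s}(w)=w\,(\pi_\downarrow(w))^{-1}$.
   Formalization: The constant term of I(q) is taken to be 1, whereas the printed formula gives 2 at n = 0; with constant term 2 the right-hand side would have constant term −1 while Ĩ(q) has constant term 0, so the printed identity fails. *)

theory Defs
  imports
    "HOL-Computational_Algebra.Formal_Power_Series"
begin

definition affine_perms :: "nat \<Rightarrow> (int \<Rightarrow> int) set" where
  "affine_perms n = {w. bij w \<and> (\<forall>i. w (i + int n) = w i + int n) \<and>
     (\<Sum>i = 1..int n. w i) = int ((n + 1) choose 2)}"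

definition simple_gen :: "nat \<Rightarrow> nat \<Rightarrow> int \<Rightarrow> int" where
  "simple_gen n i k =
     (if \<exists>m::int. k = int i + m * int n then k + 1
      else if \<exists>m::int. k = int i + m * int n + 1 then k - 1
      else k)"

text \<open>For \<open>n = 1\<close> the group is trivial and there are no generators (the formula for
  \<open>simple_gen\<close> would give a shift).\<close>

definition gen_indices :: "nat \<Rightarrow> nat set" where
  "gen_indices n = (if n = 1 then {} else {1..n})"

definition word_prod :: "nat \<Rightarrow> nat list \<Rightarrow> int \<Rightarrow> int" where
  "word_prod n is = foldr (\<lambda>i u. simple_gen n i \<circ> u) is id"

definition cox_length :: "nat \<Rightarrow> (int \<Rightarrow> int) \<Rightarrow> nat" where
  "cox_length n w =
     (LEAST k. \<exists>is. set is \<subseteq> gen_indices n \<and> length is = k \<and> word_prod n is = w)"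

text \<open>The subtraction is taken in \<open>int\<close>.\<close>

definition left_weak_le :: "nat \<Rightarrow> (int \<Rightarrow> int) \<Rightarrow> (int \<Rightarrow> int) \<Rightarrow> bool" where
  "left_weak_le n x y \<longleftrightarrow>
     int (cox_length n (y \<circ> inv x)) = int (cox_length n y) - int (cox_length n x)"

text \<open>The order on positions: \<open>i\<close> is below \<open>j\<close> when \<open>w i \<le> w j\<close> and no position strictly
  between them carries a larger value than both. For \<open>i = j\<close> there is no position in between,
  so the relation is reflexive; for \<open>i \<noteq> j\<close> the inequality is strict since \<open>w\<close> is injective.\<close>

definition desc_le :: "(int \<Rightarrow> int) \<Rightarrow> int \<Rightarrow> int \<Rightarrow> bool" where
  "desc_le w i j \<longleftrightarrow>
     w i \<le> w j \<and> \<not> (\<exists>k. min i j < k \<and> k < max i j \<and> w k > max (w i) (w j))"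

definition syl_class :: "nat \<Rightarrow> (int \<Rightarrow> int) \<Rightarrow> (int \<Rightarrow> int) set" where
  "syl_class n w = {v \<in> affine_perms n. desc_le v = desc_le w}"

definition pi_down :: "nat \<Rightarrow> (int \<Rightarrow> int) \<Rightarrow> int \<Rightarrow> int" where
  "pi_down n w =
     (THE u. u \<in> syl_class n w \<and> (\<forall>v \<in> syl_class n w. left_weak_le n v u \<longrightarrow> v = u))"

definition stack_sort :: "nat \<Rightarrow> (int \<Rightarrow> int) \<Rightarrow> int \<Rightarrow> int" where
  "stack_sort n w = w \<circ> inv (pi_down n w)"

definition two_stack_sortable :: "nat \<Rightarrow> (int \<Rightarrow> int) set" where
  "two_stack_sortable n = {w \<in> affine_perms n. (stack_sort n ^^ 2) w = id}"

text \<open>The constant term of \<open>I(q)\<close> is \<open>1\<close>, for the empty permutation: \<open>I(q)\<close> is the generating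
  function of the (ordinary) 2-stack-sortable permutations, counted for \<open>n \<ge> 1\<close> by
  \<open>2 / ((n + 1) * (2 * n + 1)) * (3 * n choose n)\<close>. This closed formula evaluates to \<open>2\<close> at
  \<open>n = 0\<close>; with constant term \<open>2\<close> the series \<open>q I'(q) / (I(q) (I(q) - 1)) - 1\<close>
  would have constant term \<open>-1\<close> instead of \<open>0\<close>.\<close>

definition fps_I :: "rat fps" where
  "fps_I = Abs_fps (\<lambda>n. if n = 0 then 1
     else 2 / ((of_nat n + 1) * (2 * of_nat n + 1)) * of_nat ((3 * n) choose n))"

definition fps_affine_I :: "rat fps" where
  "fps_affine_I = Abs_fps (\<lambda>n. if n = 0 then 0 else of_nat (card (two_stack_sortable n)))"

end

theory Submission
  imports Defs "HOL-Computational_Algebra.Polynomial"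
begin

text \<open>The stack-sorted permutation is the postorder reading of the decreasing tree, and \<open>w\<close> is
  2-stack-sortable iff this reading avoids 231. For a finite permutation \<open>L m R\<close> with maximum \<open>m\<close>
  this means that \<open>L\<close> and \<open>R\<close> are 2-stack-sortable, that at most the maximum of \<open>L\<close> exceeds an element
  of \<open>R\<close>, and that it does so at a rank where the sorted \<open>R\<close> is a direct sum. Marking the number of
  direct summands by \<open>t\<close> gives \<open>(t - 1)(F - 1) = q t ((t - 1) F + (F - 1)(t F - I))\<close> with \<open>I = F(1)\<close>.
  Its solution is \<open>F = (1 + x)(1 - q (1 + u)\<^sup>2 x)\<close>, where \<open>u = q (1 + u)\<^sup>3\<close> and
  \<open>x = q t (1 + u)(1 + x)\<^sup>2\<close>, and \<open>t = 1\<close> yields \<open>I = 1 + u - u\<^sup>2\<close>.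

  An affine permutation is cut at its left-to-right maxima into finite blocks. The same local
  conditions characterise 2-stack-sortability, but since everything extends infinitely far to the
  left, the blocks can be chosen independently. With \<open>G\<close> the generating function of a single block,
  counting \<open>n\<close>-periodic tilings gives \<open>q G' / (1 - G)\<close>, while the decomposition of finite
  permutations gives \<open>(I - 1)(1 - G) = q I\<close>; the theorem is the logarithmic derivative.\<close>

text \<open>\<open>pi_down\<close> is defined by minimality in weak order, so everything rests on
  recognising it as the permutation that numbers the positions in postorder. The relation
  \<open>after\<close> (lying in the right subtree) is the common language: it determines a
  sylvester class, and its pairs are inversions of every member of the class.

  The equation for F is quadratic and contains the unknown F(1). It is not solved but checked: it
  determines each coefficient from the earlier ones, so a solution is unique, and the check becomes
  a polynomial identity in u and x once q and t are eliminated.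

  Why the affine blocks are independent: in a finite tree an empty left subtree forces the label 0,
  but every left-to-right maximum of an affine permutation has an earlier one, and the last of these
  may be inserted among the values of the next block at any admissible rank. A block is thus a tree
  R with a label in \<open>cuts R\<close>, the same data as the right side of a node whose left
  subtree is not empty. This is why one series G governs both counts.\<close>

unbundle fps_syntax

section \<open>Labelled trees and their generating function\<close>

text \<open>A valid tree encodes a 2-stack-sortable permutation. At a node, \<open>k\<close> counts the values to the right
  of the maximum that are smaller than the largest value to its left; all other values on the left
  are smaller than all values on the right. The set \<open>cuts\<close> consists of the ranks at which the
  stack-sorted permutation splits as a direct sum, and these are the admissible values of \<open>k\<close>.\<close>

datatype tree = Leaf | Node tree nat tree

fun nodes :: "tree \<Rightarrow> nat" where
  "nodes Leaf = 0"
| "nodes (Node L k R) = nodes L + nodes R + 1"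

text \<open>The sorted word of a node reads left part, right part, maximum. Cuts of the left part
  survive below rank \<open>nodes L\<close>, and cuts of the right part survive from rank
  \<open>k\<close> on. At the ranks in between, the maximum of the left part precedes a smaller
  value of the right part.\<close>

fun cuts :: "tree \<Rightarrow> nat set" where
  "cuts Leaf = {0}"
| "cuts (Node L k R) = (cuts L - {nodes L}) \<union> (\<lambda>x. nodes L + x) ` {x \<in> cuts R. k \<le> x}
     \<union> {nodes L + nodes R + 1}"

fun valid :: "tree \<Rightarrow> bool" where
  "valid Leaf = True"
| "valid (Node L k R) = (valid L \<and> valid R \<and> k \<in> cuts R \<and> (L = Leaf \<longrightarrow> k = 0))"

lemma cuts_le: "x \<in> cuts T \<Longrightarrow> x \<le> nodes T"
proof (induction T arbitrary: x)
  case (Node L k R)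
  from Node.prems Node.IH(1)[of x] Node.IH(2)[of "x - nodes L"] show ?case by auto
qed auto

lemma finite_cuts [simp]: "finite (cuts T)"
  by (rule finite_subset[of _ "{..nodes T}"]) (auto dest: cuts_le)

lemma nodes_in_cuts [simp]: "nodes T \<in> cuts T"
  by (cases T) auto

text \<open>With an empty left subtree the rank 0 survives only because validity makes the label
  0.\<close>

lemma zero_in_cuts: "valid T \<Longrightarrow> 0 \<in> cuts T"
proof (induction T)
  case (Node L k R)
  then show ?case by (cases L) auto
qed auto

lemma nodes_eq_0_iff [simp]: "nodes T = 0 \<longleftrightarrow> T = Leaf"
  by (cases T) auto

lemma card_cuts_pos: "card (cuts T) > 0"
  using nodes_in_cuts[of T] by (auto simp: card_gt_0_iff simp del: nodes_in_cuts)

definition trees :: "nat \<Rightarrow> tree set" where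
  "trees n = {T. valid T \<and> nodes T = n}"

definition labels :: "tree \<Rightarrow> tree \<Rightarrow> nat set" where
  "labels L R = (if L = Leaf then {0} else cuts R)"

lemma finite_labels [simp]: "finite (labels L R)"
  by (simp add: labels_def)

lemma trees_0 [simp]: "trees 0 = {Leaf}"
  by (auto simp: trees_def)

lemma trees_Suc:
  "trees (Suc n) = (\<lambda>(l, L, R, k). Node L k R) `
     (SIGMA l:{..n}. SIGMA L:trees l. SIGMA R:trees (n - l). labels L R)" (is "_ = ?f ` ?S")
proof (intro equalityI subsetI)
  fix T assume T: "T \<in> trees (Suc n)"
  then obtain L k R where eq: "T = Node L k R" by (cases T) (auto simp: trees_def)
  with T have "(nodes L, L, R, k) \<in> ?S" by (auto simp: trees_def labels_def)
  then show "T \<in> ?f ` ?S" using eq by force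
next
  fix T assume "T \<in> ?f ` ?S"
  then show "T \<in> trees (Suc n)" by (auto simp: trees_def labels_def zero_in_cuts split: if_splits)
qed

lemma finite_trees [simp]: "finite (trees n)"
proof (induction n rule: less_induct)
  case (less n)
  show ?case
  proof (cases n)
    case (Suc m)
    have "finite (SIGMA l:{..m}. SIGMA L:trees l. SIGMA R:trees (m - l). labels L R)"
      using less Suc by (intro finite_SigmaI) auto
    then show ?thesis by (simp add: Suc trees_Suc)
  qed simp
qed

lemma sum_trees_Suc:
  "(\<Sum>T\<in>trees (Suc n). h T) =
     (\<Sum>l\<le>n. \<Sum>L\<in>trees l. \<Sum>R\<in>trees (n - l). \<Sum>k\<in>labels L R. (h (Node L k R) :: 'a :: comm_monoid_add))"
proof -
  have inj: "inj_on (\<lambda>(l, L, R, k). Node L k R)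
     (SIGMA l:{..n}. SIGMA L:trees l. SIGMA R:trees (n - l). labels L R)"
    by (auto simp: inj_on_def trees_def)
  show ?thesis
    unfolding trees_Suc
    by (subst sum.reindex[OF inj]) (simp add: sum.Sigma split_def)
qed

section \<open>Direct summands and the catalytic equation\<close>

definition comps :: "tree \<Rightarrow> nat" where
  "comps T = card (cuts T) - 1"

lemma comps_Leaf [simp]: "comps Leaf = 0"
  by (simp add: comps_def)

lemma card_cuts: "card (cuts T) = comps T + 1"
  using card_cuts_pos[of T] by (simp add: comps_def)

text \<open>The three parts of \<open>cuts\<close> are disjoint. The removed rank
  \<open>nodes L\<close> is made up for by the full rank, so only the cuts of \<open>R\<close> below
  \<open>k\<close> are lost.\<close>

lemma comps_Node: "comps (Node L k R) = comps L + card {x \<in> cuts R. k \<le> x}"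
proof -
  have "card (cuts (Node L k R)) = card (cuts L - {nodes L})
      + card ((\<lambda>x. nodes L + x) ` {x \<in> cuts R. k \<le> x}) + 1"
  proof -
    have 1: "(cuts L - {nodes L}) \<inter> (\<lambda>x. nodes L + x) ` {x \<in> cuts R. k \<le> x} = {}"
      using cuts_le[of _ L] by fastforce
    have 2: "((cuts L - {nodes L}) \<union> (\<lambda>x. nodes L + x) ` {x \<in> cuts R. k \<le> x})
       \<inter> {nodes L + nodes R + 1} = {}"
      using cuts_le[of _ L] cuts_le[of _ R] by fastforce
    show ?thesis unfolding cuts.simps
      by (subst card_Un_disjoint[OF _ _ 2], simp, simp, subst card_Un_disjoint[OF _ _ 1]) simp_all
  qed
  moreover have "card (cuts L - {nodes L}) = comps L" by (simp add: comps_def)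
  moreover have "card ((\<lambda>x. nodes L + x) ` {x \<in> cuts R. k \<le> x}) = card {x \<in> cuts R. k \<le> x}"
    by (rule card_image) (auto simp: inj_on_def)
  ultimately show ?thesis using card_cuts[of "Node L k R"] by linarith
qed

lemma comps_Node_Leaf: "valid R \<Longrightarrow> comps (Node Leaf 0 R) = comps R + 1"
  by (simp add: comps_Node card_cuts)

text \<open>As \<open>k\<close> runs through \<open>A\<close>, the number of elements from
  \<open>k\<close> on takes each value from 1 to \<open>card A\<close> exactly once. Summing over
  the labels of a node therefore gives a geometric sum in \<open>t\<close>.\<close>

lemma sum_card_above:
  fixes A :: "nat set" and g :: "nat \<Rightarrow> 'a :: comm_monoid_add"
  assumes "finite A"
  shows "(\<Sum>k\<in>A. g (card {x \<in> A. k \<le> x})) = (\<Sum>j\<in>{1..card A}. g j)"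
  using assms
proof (induction "card A" arbitrary: A)
  case (Suc n)
  define m where "m = Min A"
  have A: "A \<noteq> {}" using Suc by auto
  have m: "m \<in> A" "\<And>x. x \<in> A \<Longrightarrow> m \<le> x" using A Suc(3) by (auto simp: m_def)
  have fin: "finite (A - {m})" and card: "card (A - {m}) = n" using Suc m by auto
  have "(\<Sum>k\<in>A. g (card {x \<in> A. k \<le> x})) =
      g (card {x \<in> A. m \<le> x}) + (\<Sum>k\<in>A - {m}. g (card {x \<in> A. k \<le> x}))"
    using m Suc(3) by (simp add: sum.remove)
  also have "{x \<in> A. m \<le> x} = A" using m by auto
  also have "(\<Sum>k\<in>A - {m}. g (card {x \<in> A. k \<le> x})) =
     (\<Sum>k\<in>A - {m}. g (card {x \<in> A - {m}. k \<le> x}))"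
  proof (rule sum.cong[OF refl])
    fix k assume "k \<in> A - {m}"
    then have "{x \<in> A. k \<le> x} = {x \<in> A - {m}. k \<le> x}" using m by force
    then show "g (card {x \<in> A. k \<le> x}) = g (card {x \<in> A - {m}. k \<le> x})" by simp
  qed
  also have "\<dots> = (\<Sum>j\<in>{1..n}. g j)" using Suc(1)[of "A - {m}"] fin card by simp
  finally show ?case using Suc(2)[symmetric] by (simp add: add.commute)
qed simp

text \<open>The coefficient ring \<open>rat poly\<close> carries the catalytic variable \<open>t\<close>, which marks \<^const>\<open>comps\<close>.\<close>

definition tvar :: "rat poly" where "tvar = [:0, 1:]"

definition F_trees :: "rat poly fps" where
  "F_trees = Abs_fps (\<lambda>n. \<Sum>T\<in>trees n. tvar ^ comps T)"

text \<open>Substitution of 1 for \<open>t\<close>; the values stay constant polynomials so that F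
  and F(1) live in the same ring.\<close>

definition at_one :: "rat poly fps \<Rightarrow> rat poly fps" where
  "at_one f = Abs_fps (\<lambda>n. [:poly (fps_nth f n) 1:])"

lemma poly_const_sum: "[:sum f A:] = (\<Sum>x\<in>A. [:f x :: 'a :: comm_ring_1:])"
proof -
  have "[:a + b:] = [:a:] + [:b:]" for a b :: 'a by simp
  then show ?thesis by (induction A rule: infinite_finite_induct) (auto simp del: add_pCons)
qed

lemma at_one_add: "at_one (f + g) = at_one f + at_one g"
  by (rule fps_ext) (simp add: at_one_def)

lemma at_one_diff: "at_one (f - g) = at_one f - at_one g"
  by (rule fps_ext) (simp add: at_one_def)

lemma at_one_mult: "at_one (f * g) = at_one f * at_one g"
  by (rule fps_ext) (simp add: at_one_def fps_mult_nth poly_sum poly_const_sum mult.commute)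

lemma at_one_1: "at_one 1 = 1"
  by (rule fps_ext) (simp add: at_one_def one_pCons)

lemma at_one_X: "at_one fps_X = fps_X"
  by (rule fps_ext) (simp add: at_one_def one_pCons)

lemma at_one_power: "at_one (f ^ k) = at_one f ^ k"
  by (induction k) (simp_all add: at_one_1 at_one_mult)

lemma at_one_const_t: "at_one (fps_const tvar) = 1"
  by (rule fps_ext) (simp add: at_one_def tvar_def one_pCons)

lemma geometric_t: "(tvar - 1) * (\<Sum>j\<in>{1..c + 1}. tvar ^ j) = tvar * (tvar ^ (c + 1) - 1)"
  by (induction c) (simp_all add: algebra_simps)

lemma sum_labels_weight:
  assumes "L \<noteq> Leaf"
  shows "(\<Sum>k\<in>labels L R. tvar ^ comps (Node L k R)) = tvar ^ comps L * (\<Sum>j\<in>{1..comps R + 1}. tvar ^ j)"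
proof -
  have "(\<Sum>k\<in>labels L R. tvar ^ comps (Node L k R))
     = tvar ^ comps L * (\<Sum>k\<in>cuts R. tvar ^ card {x \<in> cuts R. k \<le> x})"
    using assms by (simp add: labels_def comps_Node power_add sum_distrib_left)
  then show ?thesis by (simp add: sum_card_above card_cuts)
qed

text \<open>The first term is the case of an empty left subtree, where the root adds one summand.
  Subtracting 1 from \<open>F_trees\<close> leaves the nonempty left subtrees.\<close>

lemma F_trees_recursion:
  "F_trees $ Suc n = tvar * (F_trees $ n)
     + (\<Sum>l\<le>n. (F_trees - 1) $ l * (\<Sum>R\<in>trees (n - l). \<Sum>j\<in>{1..comps R + 1}. tvar ^ j))"
proof -
  define S where "S R = (\<Sum>j\<in>{1..comps R + 1}. tvar ^ j)" for R
  have *: "(\<Sum>L\<in>trees l. \<Sum>R\<in>trees (n - l). \<Sum>k\<in>labels L R. tvar ^ comps (Node L k R)) =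
     (if l = 0 then tvar * (F_trees $ n) else 0) +
     (F_trees - 1) $ l * (\<Sum>R\<in>trees (n - l). S R)" for l
  proof (cases "l = 0")
    case True
    have "(\<Sum>R\<in>trees n. tvar ^ comps (Node Leaf 0 R)) = (\<Sum>R\<in>trees n. tvar * tvar ^ comps R)"
      by (rule sum.cong) (auto simp: trees_def comps_Node_Leaf)
    then show ?thesis using True
      by (simp add: F_trees_def sum_distrib_left labels_def)
  next
    case False
    then have "L \<noteq> Leaf" if "L \<in> trees l" for L using that by (auto simp: trees_def)
    then have "(\<Sum>L\<in>trees l. \<Sum>R\<in>trees (n - l). \<Sum>k\<in>labels L R. tvar ^ comps (Node L k R)) =
      (\<Sum>L\<in>trees l. \<Sum>R\<in>trees (n - l). tvar ^ comps L * S R)"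
      by (simp add: sum_labels_weight S_def)
    also have "\<dots> = (F_trees $ l) * (\<Sum>R\<in>trees (n - l). S R)"
      by (simp add: F_trees_def sum_product)
    finally show ?thesis using False by simp
  qed
  have "F_trees $ Suc n = (\<Sum>l\<le>n. (if l = 0 then tvar * (F_trees $ n) else 0) +
     (F_trees - 1) $ l * (\<Sum>R\<in>trees (n - l). S R))"
    unfolding *[symmetric] by (simp add: F_trees_def sum_trees_Suc)
  then show ?thesis by (simp add: sum.distrib S_def)
qed

lemma F_trees_0: "F_trees $ 0 = 1"
  by (simp add: F_trees_def)

lemma F_trees_equation:
  fixes t defines "t \<equiv> fps_const tvar"
  shows "(t - 1) * (F_trees - 1) =
    fps_X * t * ((t - 1) * F_trees + (F_trees - 1) * (t * F_trees - at_one F_trees))"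
proof -
  define S where "S R = (\<Sum>j\<in>{1..comps R + 1}. tvar ^ j)" for R
  define D where "D = Abs_fps (\<lambda>n. \<Sum>R\<in>trees n. S R)"
  \<comment> \<open>Multiplication by \<open>t - 1\<close> telescopes the geometric sums; the lower
    end of each sum is what brings in F(1).\<close>
  have D: "(t - 1) * D = t * (t * F_trees - at_one F_trees)"
  proof (rule fps_ext)
    fix n
    have "((t - 1) * D) $ n = (\<Sum>R\<in>trees n. (tvar - 1) * S R)"
      by (simp add: t_def D_def algebra_simps sum_distrib_left sum_subtractf)
    also have "\<dots> = (\<Sum>R\<in>trees n. tvar * (tvar ^ (comps R + 1) - 1))"
      unfolding S_def geometric_t ..
    also have "\<dots> = tvar * (tvar * F_trees $ n - at_one F_trees $ n)"
      by (simp add: F_trees_def at_one_def poly_sum poly_power tvar_def[symmetric] sum_distrib_left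
         sum_subtractf algebra_simps) (simp add: tvar_def poly_power of_nat_poly algebra_simps)
    finally show "((t - 1) * D) $ n = (t * (t * F_trees - at_one F_trees)) $ n"
      by (simp add: t_def algebra_simps)
  qed
  have "F_trees - 1 = fps_X * (t * F_trees + (F_trees - 1) * D)"
  proof (rule fps_ext)
    fix n
    show "(F_trees - 1) $ n = (fps_X * (t * F_trees + (F_trees - 1) * D)) $ n"
    proof (cases n)
      case 0
      then show ?thesis by (simp add: F_trees_0)
    next
      case (Suc m)
      then show ?thesis
        by (simp add: F_trees_recursion t_def D_def S_def fps_mult_nth[of "F_trees - 1"] atLeast0AtMost)
    qed
  qed
  then have "(t - 1) * (F_trees - 1) = fps_X * (t * (t - 1) * F_trees + (F_trees - 1) * ((t - 1) * D))"
    by (metis (no_types, opaque_lifting) distrib_left mult.assoc mult.commute)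
  then show ?thesis unfolding D by (simp add: algebra_simps)
qed

section \<open>Solution of the functional equation\<close>

text \<open>Congruence modulo the \<open>n\<close>-th power of \<open>fps_X\<close>. It respects all
  operations in use, \<open>at_one\<close> included, so contractivity follows by structural
  rules.\<close>

definition eq_below :: "nat \<Rightarrow> 'a fps \<Rightarrow> 'a fps \<Rightarrow> bool" where
  "eq_below n f g \<longleftrightarrow> (\<forall>i<n. f $ i = g $ i)"

lemma eq_below_refl: "eq_below n f f"
  by (simp add: eq_below_def)

lemma eq_below_add:
  "eq_below n f f' \<Longrightarrow> eq_below n g g' \<Longrightarrow> eq_below n (f + g) (f' + (g' :: 'a :: comm_ring_1 fps))"
  by (simp add: eq_below_def)

lemma eq_below_diff:
  "eq_below n f f' \<Longrightarrow> eq_below n g g' \<Longrightarrow> eq_below n (f - g) (f' - (g' :: 'a :: comm_ring_1 fps))"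
  by (simp add: eq_below_def)

lemma eq_below_mult:
  "eq_below n f f' \<Longrightarrow> eq_below n g g' \<Longrightarrow> eq_below n (f * g) (f' * (g' :: 'a :: comm_ring_1 fps))"
  by (auto simp: eq_below_def fps_mult_nth intro!: sum.cong)

lemma eq_below_power:
  "eq_below n f f' \<Longrightarrow> eq_below n (f ^ k) ((f' :: 'a :: comm_ring_1 fps) ^ k)"
  by (induction k) (simp_all add: eq_below_mult eq_below_refl)

lemma eq_below_at_one: "eq_below n f f' \<Longrightarrow> eq_below n (at_one f) (at_one f')"
  by (simp add: eq_below_def at_one_def)

lemmas eq_below_intros =
  eq_below_refl eq_below_add eq_below_diff eq_below_mult eq_below_power eq_below_at_one

lemma X_mult_nth_cong:
  "eq_below n f g \<Longrightarrow> (fps_X * f) $ n = (fps_X * (g :: 'a :: comm_ring_1 fps)) $ n"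
  by (cases n) (simp_all add: eq_below_def)

text \<open>The contraction property for the \<open>X\<close>-adic metric; fixed points exist and
  are unique as in Banach's theorem.\<close>

definition contractive :: "('a fps \<Rightarrow> 'a fps) \<Rightarrow> bool" where
  "contractive \<Psi> \<longleftrightarrow> (\<forall>n f g. eq_below n f g \<longrightarrow> \<Psi> f $ n = \<Psi> g $ n)"

lemma contractiveD: "contractive \<Psi> \<Longrightarrow> eq_below n f g \<Longrightarrow> \<Psi> f $ n = \<Psi> g $ n"
  by (simp add: contractive_def)

lemma contractive_fixpoint_unique:
  assumes "contractive \<Psi>" "\<Psi> f = f" "\<Psi> g = g"
  shows "f = g"
proof (rule fps_ext)
  fix n show "f $ n = g $ n"
  proof (induction n rule: less_induct)
    case (less n)
    then have "eq_below n f g" by (simp add: eq_below_def)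
    then have "\<Psi> f $ n = \<Psi> g $ n" using assms(1) unfolding contractive_def by blast
    then show ?case by (simp only: assms)
  qed
qed

lemma contractive_fixpoint_exists:
  fixes \<Psi> :: "'a :: zero fps \<Rightarrow> 'a fps"
  assumes "contractive \<Psi>"
  shows "\<exists>f. \<Psi> f = f"
proof -
  define y where "y k = (\<Psi> ^^ k) 0" for k
  have y_Suc: "y (Suc k) = \<Psi> (y k)" for k by (simp add: y_def)
  have step: "eq_below k (y k) (y (Suc k))" for k
  proof (induction k)
    case (Suc k)
    show ?case unfolding eq_below_def
    proof (intro allI impI)
      fix i assume "i < Suc k"
      then have "eq_below i (y k) (y (Suc k))" using Suc by (auto simp: eq_below_def)
      then show "y (Suc k) $ i = y (Suc (Suc k)) $ i"
        unfolding y_Suc[of "Suc k"] y_Suc[of k] by (metis contractiveD[OF assms] y_Suc)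
    qed
  qed (simp add: eq_below_def)
  \<comment> \<open>Coefficient \<open>i\<close> no longer changes from the iterate
    \<open>y (Suc i)\<close> on, so the limit can be read off diagonally.\<close>
  have stable: "y k $ i = y (Suc i) $ i" if "i < k" for i k
    using that
  proof (induction k)
    case (Suc k)
    show ?case
    proof (cases "i = k")
      case False
      then have "i < k" using Suc by simp
      then show ?thesis using step[of k] Suc by (simp add: eq_below_def)
    qed simp
  qed simp
  define x where "x = Abs_fps (\<lambda>n. y (Suc n) $ n)"
  have "\<Psi> x = x"
  proof (rule fps_ext)
    fix n
    have "eq_below n x (y n)" unfolding eq_below_def x_def using stable[of _ n] by simp
    then have "\<Psi> x $ n = y (Suc n) $ n" unfolding y_Suc by (rule contractiveD[OF assms])
    then show "\<Psi> x $ n = x $ n" by (simp add: x_def)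
  qed
  then show ?thesis ..
qed

text \<open>The factor \<open>fps_X\<close> makes coefficient \<open>n\<close> of the right-hand
  side depend on earlier coefficients only, and \<open>t - 1\<close> can be cancelled since
  polynomials form an integral domain.\<close>

lemma F_trees_unique:
  assumes "(fps_const tvar - 1) * (G - 1) =
    fps_X * fps_const tvar * ((fps_const tvar - 1) * G + (G - 1) * (fps_const tvar * G - at_one G))"
  shows "G = F_trees"
proof (rule fps_ext)
  fix n
  define t where "t = fps_const tvar"
  define \<Phi> where "\<Phi> H = t * ((t - 1) * H + (H - 1) * (t * H - at_one H))" for H
  have eqs: "(t - 1) * (G - 1) = fps_X * \<Phi> G" "(t - 1) * (F_trees - 1) = fps_X * \<Phi> F_trees"
    using assms F_trees_equation by (simp_all add: \<Phi>_def t_def mult.assoc)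
  have "tvar - 1 \<noteq> 0" by (simp add: tvar_def one_pCons)
  have nth: "((t - 1) * (H - 1)) $ n = (tvar - 1) * (H - 1) $ n" for H n
    by (simp add: t_def algebra_simps)
  show "G $ n = F_trees $ n"
  proof (induction n rule: less_induct)
    case (less n)
    then have "eq_below n G F_trees" by (simp add: eq_below_def)
    then have "eq_below n (\<Phi> G) (\<Phi> F_trees)" unfolding \<Phi>_def by (intro eq_below_intros)
    then have "((t - 1) * (G - 1)) $ n = ((t - 1) * (F_trees - 1)) $ n"
      unfolding eqs by (rule X_mult_nth_cong)
    then have "(tvar - 1) * (G - 1) $ n = (tvar - 1) * (F_trees - 1) $ n"
      unfolding nth .
    then show ?case using \<open>tvar - 1 \<noteq> 0\<close> by simp
  qed
qed

lemma at_one_F_trees_param: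
  obtains u where "u = fps_X * (1 + u) ^ 3" "at_one u = u" "at_one F_trees = 1 + u - u\<^sup>2"
proof -
  define t where "t = fps_const tvar"
  have c1: "contractive (\<lambda>u :: rat poly fps. fps_X * (1 + u) ^ 3)"
    unfolding contractive_def by (intro allI impI X_mult_nth_cong eq_below_intros)
  obtain u :: "rat poly fps" where u: "fps_X * (1 + u) ^ 3 = u"
    using contractive_fixpoint_exists[OF c1] by blast
  have c3: "contractive (\<lambda>x. fps_X * (t * (1 + u) * (1 + x)\<^sup>2))"
    unfolding contractive_def by (intro allI impI X_mult_nth_cong eq_below_intros)
  obtain x where x: "fps_X * (t * (1 + u) * (1 + x)\<^sup>2) = x"
    using contractive_fixpoint_exists[OF c3] by blast
  \<comment> \<open>\<open>at_one u\<close> solves the fixed-point equation of \<open>u\<close>, so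
    \<open>u\<close> is free of \<open>t\<close>.\<close>
  have "fps_X * (1 + at_one u) ^ 3 = at_one (fps_X * (1 + u) ^ 3)"
    by (simp add: at_one_mult at_one_X at_one_power at_one_add at_one_1)
  then have at_u: "at_one u = u"
    using contractive_fixpoint_unique[OF c1, of "at_one u" u] u by simp
  have c2: "contractive (\<lambda>x. fps_X * ((1 + u) * (1 + x)\<^sup>2))"
    unfolding contractive_def by (intro allI impI X_mult_nth_cong eq_below_intros)
  \<comment> \<open>At \<open>t = 1\<close> the equation for \<open>x\<close> is solved by
    \<open>u\<close>, because \<open>u = q (1 + u)^3\<close>.\<close>
  have "fps_X * ((1 + u) * (1 + at_one x)\<^sup>2) = at_one (fps_X * (t * (1 + u) * (1 + x)\<^sup>2))"
    by (simp add: at_one_mult at_one_X at_one_power at_one_add at_one_1 t_def at_one_const_t at_u)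
  moreover have "fps_X * ((1 + u) * (1 + u)\<^sup>2) = u"
    using u by (simp add: power2_eq_square power3_eq_cube mult.assoc)
  ultimately have at_x: "at_one x = u"
    using contractive_fixpoint_unique[OF c2, of "at_one x" u] x by simp
  define a b where "a = 1 + u" and "b = 1 + x"
  define G where "G = b * (1 - fps_X * a\<^sup>2 * x)"
  have "at_one G = a * (1 - fps_X * a\<^sup>2 * u)"
    unfolding G_def a_def b_def
    by (simp add: at_one_mult at_one_X at_one_power at_one_add at_one_diff at_one_1 at_u at_x)
  also have "\<dots> = a - (fps_X * a ^ 3) * u"
    by (simp add: algebra_simps power2_eq_square power3_eq_cube)
  finally have at_G: "at_one G = 1 + u - u\<^sup>2"
    using u by (simp add: a_def power2_eq_square)
  have ua: "fps_X * a ^ 3 = u" using u by (simp add: a_def)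
  have xb: "fps_X * t * (a * b\<^sup>2) = x" using x by (simp add: a_def b_def mult.assoc)
  \<comment> \<open>Together with \<open>xb\<close> and the next relation this eliminates
    \<open>q\<close>, \<open>t\<close> and \<open>G\<close> in favour of \<open>u\<close> and
    \<open>x\<close>.\<close>
  have tb: "u * b\<^sup>2 * t = x * a\<^sup>2"
    by (subst ua[symmetric], subst xb[symmetric]) (simp add: power2_eq_square power3_eq_cube mult_ac)
  have aG: "a * G = b * (a - u * x)"
    unfolding G_def by (subst ua[symmetric]) (simp add: algebra_simps power2_eq_square power3_eq_cube)
  have a0: "a \<noteq> 0"
  proof
    assume "a = 0"
    with ua have "u = 0" by simp
    with \<open>a = 0\<close> show False by (simp add: a_def)
  qed
  have u0: "u \<noteq> 0" using ua a0 by auto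
  have b0: "b \<noteq> 0"
  proof
    assume "b = 0"
    with xb have "x = 0" by simp
    with \<open>b = 0\<close> show False by (simp add: b_def)
  qed
  define J where "J = 1 + u - u\<^sup>2"
  \<comment> \<open>A common multiple of the denominators of \<open>t - 1\<close>, \<open>G\<close>
    and \<open>q t\<close>. It is nonzero and is cancelled once the polynomial identity is
    proved.\<close>
  define M where "M = u * b\<^sup>2 * a * (a\<^sup>2 * b\<^sup>2)"
  have M0: "M \<noteq> 0" using a0 b0 u0 by (simp add: M_def)
  have t1: "u * b\<^sup>2 * (t - 1) = x * a\<^sup>2 - u * b\<^sup>2" using tb by (simp add: algebra_simps)
  have G1: "a * (G - 1) = b * (a - u * x) - a" using aG by (simp add: algebra_simps)
  have "M * ((t - 1) * (G - 1)) = (u * b\<^sup>2 * (t - 1)) * (a * (G - 1)) * (a\<^sup>2 * b\<^sup>2)"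
    by (simp add: M_def mult_ac)
  also have "\<dots> = (x * a\<^sup>2 - u * b\<^sup>2) * (b * (a - u * x) - a) * (a\<^sup>2 * b\<^sup>2)"
    unfolding t1 G1 ..
  also have "\<dots> = x * ((x * a\<^sup>2 - u * b\<^sup>2) * a * (b * (a - u * x))
      + (b * (a - u * x) - a) * (x * a\<^sup>2 * (b * (a - u * x)) - J * a * u * b\<^sup>2))"
    unfolding J_def a_def b_def by algebra
  also have "\<dots> = (fps_X * t * (a * b\<^sup>2)) * ((u * b\<^sup>2 * (t - 1)) * a * (a * G)
      + (a * (G - 1)) * (u * b\<^sup>2 * t * (a * G) - J * a * u * b\<^sup>2))"
    unfolding t1 G1 aG xb tb ..
  also have "\<dots> = M * (fps_X * t * ((t - 1) * G + (G - 1) * (t * G - J)))"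
    unfolding M_def by algebra
  finally have "(t - 1) * (G - 1) = fps_X * t * ((t - 1) * G + (G - 1) * (t * G - at_one G))"
    unfolding at_G J_def[symmetric] mult_left_cancel[OF M0] .
  then have "G = F_trees" unfolding t_def by (rule F_trees_unique)
  then show ?thesis using that[of u] u at_u at_G by simp
qed

section \<open>Coefficients of the series at t = 1\<close>

definition eval_one :: "rat poly fps \<Rightarrow> rat fps" where
  "eval_one f = Abs_fps (\<lambda>n. poly (f $ n) 1)"

lemma eval_one_hom:
  "eval_one (f + g) = eval_one f + eval_one g" "eval_one (f - g) = eval_one f - eval_one g"
  "eval_one (f * g) = eval_one f * eval_one g" "eval_one 1 = 1" "eval_one fps_X = fps_X"
  by (rule fps_ext, simp add: eval_one_def fps_mult_nth poly_sum fps_X_def)+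

lemma eval_one_power: "eval_one (f ^ k) = eval_one f ^ k"
  by (induction k) (simp_all add: eval_one_hom)

text \<open>These are the Fuss-Catalan (Raney) numbers. In place of Lagrange inversion, neighbouring
  powers are compared: \<open>(1 + u)^(k + 1) = (1 + u)^k + q (1 + u)^(k + 3)\<close>. This
  determines all coefficients by induction on \<open>n\<close> and, inside it, on the
  exponent.\<close>

lemma power_tree_series_nth:
  fixes u :: "rat fps"
  assumes "u = fps_X * (1 + u) ^ 3"
  shows "((1 + u) ^ Suc k) $ n = of_nat (Suc k) * fact (3 * n + k) / (fact n * fact (2 * n + k + 1))"
proof -
  have u0: "u $ 0 = 0" by (subst assms) simp
  have rec: "((1 + u) ^ Suc k) $ Suc n = ((1 + u) ^ k) $ Suc n + ((1 + u) ^ (k + 3)) $ n" for k n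
  proof -
    have "(1 + u) ^ Suc k = (1 + u) ^ k + u * (1 + u) ^ k" by (simp add: algebra_simps)
    also have "u * (1 + u) ^ k = fps_X * (1 + u) ^ (k + 3)"
      by (subst (1) assms) (simp add: power_add mult_ac)
    finally show ?thesis by simp
  qed
  show ?thesis
  proof (induction n arbitrary: k)
    case 0
    have "((1 + u) ^ Suc k) $ 0 = 1" by (simp add: fps_nth_power_0 u0)
    moreover have "of_nat (Suc k) * fact k = (fact (Suc k) :: rat)" by simp
    ultimately show ?case by (simp del: of_nat_Suc fact_Suc power_Suc)
  next
    case (Suc n)
    note IH = Suc
    show ?case
    proof (induction k)
      case 0
      have "((1 + u) ^ Suc 0) $ Suc n = ((1 + u) ^ Suc 2) $ n"
        using rec[of 0 n] by (simp del: power_Suc add: eval_nat_numeral)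
      also have "\<dots> = of_nat (Suc 0) * fact (3 * Suc n + 0) / (fact (Suc n) * fact (2 * Suc n + 0 + 1))"
        unfolding IH by (simp add: numeral_eq_Suc divide_simps)
      finally show ?case .
    next
      case (Suc k)
      define P Q R :: rat where "P = fact (3 * n + k + 3)" and "Q = fact n" and "R = fact (2 * n + k + 3)"
      have "3 * n + k + 4 = Suc (3 * n + k + 3)" "2 * n + k + 4 = Suc (2 * n + k + 3)" by simp_all
      then have facts: "fact (3 * n + k + 4) = of_nat (3 * n + k + 4) * P"
        "fact (2 * n + k + 4) = of_nat (2 * n + k + 4) * R" "fact (Suc n) = of_nat (Suc n) * Q"
        by (simp_all only: fact_Suc P_def Q_def R_def)
      have idx: "3 * Suc n + k = 3 * n + k + 3" "2 * Suc n + k + 1 = 2 * n + k + 3"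
        "3 * n + (k + 3) = 3 * n + k + 3" "2 * n + (k + 3) + 1 = 2 * n + k + 4" "Suc (k + 3) = k + 4"
        "3 * Suc n + Suc k = 3 * n + k + 4" "2 * Suc n + Suc k + 1 = 2 * n + k + 4" by simp_all
      have "((1 + u) ^ Suc (Suc k)) $ Suc n = ((1 + u) ^ Suc k) $ Suc n + ((1 + u) ^ Suc (k + 3)) $ n"
        by (subst rec) simp
      also have "\<dots> = of_nat (Suc k) * P / (of_nat (Suc n) * Q * R)
         + of_nat (k + 4) * P / (Q * (of_nat (2 * n + k + 4) * R))"
        unfolding Suc IH unfolding idx facts P_def[symmetric] Q_def[symmetric] R_def[symmetric] ..
      also have "\<dots> = of_nat (Suc (Suc k)) * (of_nat (3 * n + k + 4) * P) /
          (of_nat (Suc n) * Q * (of_nat (2 * n + k + 4) * R))"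
      proof -
        have "Q \<noteq> 0" "R \<noteq> 0" by (simp_all add: Q_def R_def)
        moreover have "of_nat (Suc n) \<noteq> (0 :: rat)" "of_nat (2 * n + k + 4) \<noteq> (0 :: rat)"
          by simp_all
        ultimately show ?thesis by (simp add: divide_simps del: of_nat_Suc) (simp add: algebra_simps)
      qed
      also have "\<dots> = of_nat (Suc (Suc k)) * fact (3 * Suc n + Suc k) / (fact (Suc n) * fact (2 * Suc n + Suc k + 1))"
        unfolding idx facts ..
      finally show ?case .
    qed
  qed
qed

theorem card_trees: "of_nat (card (trees n)) = fps_I $ n"
proof (cases "n = 0")
  case False
  obtain u where u: "u = fps_X * (1 + u) ^ 3" "at_one u = u" "at_one F_trees = 1 + u - u\<^sup>2"
    by (rule at_one_F_trees_param)
  define v where "v = eval_one u"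
  have v: "v = fps_X * (1 + v) ^ 3"
    unfolding v_def by (subst u(1)) (simp only: eval_one_hom eval_one_power)
  have "eval_one (at_one F_trees) = 1 + v - v\<^sup>2"
    unfolding u(3) v_def by (simp only: eval_one_hom eval_one_power)
  then have "of_nat (card (trees n)) = (1 + v - v\<^sup>2) $ n"
    by (auto simp: fps_eq_iff eval_one_def at_one_def F_trees_def poly_sum poly_power tvar_def)
  \<comment> \<open>A combination of powers of \<open>1 + v\<close>, whose coefficients are known in
    closed form.\<close>
  also have "1 + v - v\<^sup>2 = 3 * (1 + v) ^ Suc 0 - (1 + v) ^ Suc 1 - 1"
    by (simp add: power2_eq_square algebra_simps)
  also have "\<dots> $ n = 3 * ((1 + v) ^ Suc 0) $ n - ((1 + v) ^ Suc 1) $ n - 1 $ n"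
    by (simp only: fps_sub_nth fps_numeral_fps_const fps_mult_left_const_nth)
  also have "\<dots> = 3 * (fact (3 * n) / (fact n * fact (2 * n + 1))) -
       2 * fact (3 * n + 1) / (fact n * fact (2 * n + 2))"
    unfolding power_tree_series_nth[OF v] using False by simp
  also have "\<dots> = 2 / ((of_nat n + 1) * (2 * of_nat n + 1)) * (fact (3 * n) / (fact n * fact (2 * n)))"
    by (simp add: divide_simps) (simp add: algebra_simps)
  also have "fact (3 * n) / (fact n * fact (2 * n)) = (of_nat ((3 * n) choose n) :: rat)"
    by (subst binomial_fact) (simp_all add: algebra_simps)
  finally show ?thesis using False by (simp add: fps_I_def)
qed (simp add: fps_I_def)

section \<open>Periodic tilings of the integers\<close>

type_synonym block = "tree \<times> nat"

text \<open>The extra position is the left-to-right maximum that opens the block.\<close>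

definition bsize :: "block \<Rightarrow> nat" where
  "bsize B = nodes (fst B) + 1"

definition is_block :: "block \<Rightarrow> bool" where
  "is_block B \<longleftrightarrow> valid (fst B) \<and> snd B \<in> cuts (fst B)"

definition blocks :: "nat \<Rightarrow> block set" where
  "blocks b = {B. is_block B \<and> bsize B = b}"

definition seqs :: "nat \<Rightarrow> block list set" where
  "seqs m = {Bs. (\<forall>B\<in>set Bs. is_block B) \<and> sum_list (map bsize Bs) = m}"

lemma bsize_pos [simp]: "bsize B > 0"
  by (simp add: bsize_def)

lemma blocks_0 [simp]: "blocks 0 = {}"
  by (simp add: blocks_def bsize_def)

lemma blocks_Suc: "blocks (Suc n) = (SIGMA T:trees n. cuts T)"
  by (auto simp: blocks_def bsize_def is_block_def trees_def)

lemma finite_blocks [simp]: "finite (blocks b)"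
  by (cases b) (simp_all add: blocks_Suc)

lemma seqs_0 [simp]: "seqs 0 = {[]}"
proof -
  have "Bs = []" if "sum_list (map bsize Bs) = 0" for Bs
    using that by (cases Bs) (simp_all add: bsize_def)
  then show ?thesis by (auto simp: seqs_def)
qed

lemma seqs_Suc:
  "seqs (Suc m) = (\<lambda>(b, B, Bs). B # Bs) ` (SIGMA b:{..Suc m}. blocks b \<times> seqs (Suc m - b))"
  (is "_ = ?f ` ?S")
proof (intro equalityI subsetI)
  fix Cs assume Cs: "Cs \<in> seqs (Suc m)"
  then obtain B Bs where eq: "Cs = B # Bs" by (cases Cs) (auto simp: seqs_def)
  with Cs have "(bsize B, B, Bs) \<in> ?S" by (auto simp: seqs_def blocks_def)
  then show "Cs \<in> ?f ` ?S" by (rule rev_image_eqI) (simp add: eq)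
qed (auto simp: seqs_def blocks_def)

lemma seqs_Suc_inj:
  "inj_on (\<lambda>(b, B, Bs). B # Bs) (SIGMA b:{..Suc m}. blocks b \<times> seqs (Suc m - b))"
  by (auto simp: inj_on_def blocks_def)

lemma finite_seqs [simp]: "finite (seqs m)"
proof (induction m rule: less_induct)
  case (less m)
  show ?case
  proof (cases m)
    case (Suc k)
    have "finite (blocks b \<times> seqs (Suc k - b))" if "b \<in> {..Suc k}" for b
      using less[of "Suc k - b"] Suc by (cases "b = 0") auto
    then show ?thesis unfolding Suc seqs_Suc by (rule finite_imageI[OF finite_SigmaI[OF finite_atMost]])
  qed simp
qed

lemma card_seqs_Suc:
  "card (seqs (Suc m)) = (\<Sum>b\<le>Suc m. card (blocks b) * card (seqs (Suc m - b)))"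
  unfolding seqs_Suc card_image[OF seqs_Suc_inj]
  by (subst card_SigmaI) (auto simp: card_cartesian_product)

text \<open>\<open>\<delta>\<close> marks the starts of the blocks. Requiring one mark excludes the
  empty map; with periodicity and the condition on successors it makes the blocks cover all
  integers.\<close>

definition tilings :: "nat \<Rightarrow> (int \<Rightarrow> block option) set" where
  "tilings n = {\<delta>. (\<forall>x. \<delta> (x + int n) = \<delta> x) \<and> (\<exists>x. \<delta> x \<noteq> None) \<and>
     (\<forall>x B. \<delta> x = Some B \<longrightarrow> is_block B \<and> \<delta> (x + int (bsize B)) \<noteq> None \<and>
       (\<forall>y. x < y \<and> y < x + int (bsize B) \<longrightarrow> \<delta> y = None))}"

lemma tilingsD:
  assumes "\<delta> \<in> tilings n"
  shows "\<delta> (x + int n) = \<delta> x"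
    and "\<delta> x = Some B \<Longrightarrow> is_block B"
    and "\<delta> x = Some B \<Longrightarrow> \<delta> (x + int (bsize B)) \<noteq> None"
    and "\<delta> x = Some B \<Longrightarrow> x < y \<Longrightarrow> y < x + int (bsize B) \<Longrightarrow> \<delta> y = None"
  using assms unfolding tilings_def by blast+

lemma periodic_mult:
  fixes f :: "int \<Rightarrow> 'a"
  assumes "\<And>x. f (x + p) = f x"
  shows "f (x + m * p) = f x"
proof (induction m rule: int_induct[where k = 0])
  case (step1 i)
  have "f (x + (i + 1) * p) = f (x + i * p + p)" by (simp add: algebra_simps)
  then show ?case using step1 assms by simp
next
  case (step2 i)
  have "f (x + i * p) = f (x + (i - 1) * p + p)" by (simp add: algebra_simps)
  then show ?case using step2 assms by simp
qed simp

lemma greatest_int: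
  fixes P :: "int \<Rightarrow> bool"
  assumes "P y" "y \<le> x"
  obtains s where "P s" "s \<le> x" "\<And>z. P z \<Longrightarrow> z \<le> x \<Longrightarrow> z \<le> s"
proof -
  define S where "S = {z \<in> {y..x}. P z}"
  have S: "finite S" "y \<in> S"
    using assms by (auto simp: S_def intro: finite_subset[of _ "{y..x}"])
  then have "Max S \<in> S" by (intro Max_in) auto
  moreover have "z \<le> Max S" if "P z" "z \<le> x" for z
  proof (cases "y \<le> z")
    case True
    then show ?thesis using that S by (intro Max_ge) (auto simp: S_def)
  next
    case False
    then show ?thesis using Max_ge[OF S] by linarith
  qed
  ultimately show ?thesis using that by (auto simp: S_def)
qed

text \<open>By periodicity some block starts at or before \<open>x\<close>. The last such block
  contains \<open>x\<close>, since otherwise its successor would also start at or before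
  \<open>x\<close>.\<close>

lemma tiling_cover:
  assumes "\<delta> \<in> tilings n" "n > 0"
  obtains s B where "\<delta> s = Some B" "s \<le> x" "x < s + int (bsize B)"
proof -
  obtain y where y: "\<delta> y \<noteq> None" using assms by (auto simp: tilings_def)
  define m where "m = - \<bar>y - x\<bar>"
  have "\<delta> (y + m * int n) = \<delta> y"
    by (rule periodic_mult) (rule tilingsD(1)[OF assms(1)])
  moreover have "y + m * int n \<le> x"
  proof -
    have "\<bar>y - x\<bar> * 1 \<le> \<bar>y - x\<bar> * int n" using assms(2) by (intro mult_left_mono) auto
    then show ?thesis by (simp add: m_def)
  qed
  ultimately obtain s where s: "\<delta> s \<noteq> None" "s \<le> x" "\<And>z. \<delta> z \<noteq> None \<Longrightarrow> z \<le> x \<Longrightarrow> z \<le> s"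
    using greatest_int[of "\<lambda>z. \<delta> z \<noteq> None" "y + m * int n" x] y by metis
  then obtain B where B: "\<delta> s = Some B" by blast
  have "x < s + int (bsize B)"
  proof (rule ccontr)
    assume "\<not> x < s + int (bsize B)"
    then have "s + int (bsize B) \<le> s" using s(3)[OF tilingsD(3)[OF assms(1) B]] by simp
    then show False using bsize_pos[of B] by linarith
  qed
  then show ?thesis using that B s(2) by blast
qed

lemma tiling_cover_unique:
  assumes "\<delta> \<in> tilings n" "\<delta> s = Some B" "s \<le> x" "x < s + int (bsize B)"
    and "\<delta> s' = Some B'" "s' \<le> x" "x < s' + int (bsize B')"
  shows "s = s'"
proof (rule ccontr)
  assume "s \<noteq> s'"
  then consider "s < s'" | "s' < s" by linarith
  then show False
    using tilingsD(4)[OF assms(1)] assms by cases (metis le_less_trans option.distinct(1))+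
qed

fun lookup :: "block list \<Rightarrow> nat \<Rightarrow> block option" where
  "lookup [] p = None"
| "lookup (B # Bs) p =
     (if p = 0 then Some B else if p < bsize B then None else lookup Bs (p - bsize B))"

lemma lookup_inj:
  assumes "sum_list (map bsize Bs) = m" "sum_list (map bsize Cs) = m"
    "\<And>p. p < m \<Longrightarrow> lookup Bs p = lookup Cs p"
  shows "Bs = Cs"
  using assms
proof (induction Bs arbitrary: Cs m)
  case Nil
  then show ?case by (cases Cs) (simp_all add: bsize_def)
next
  case (Cons B Bs)
  have "m > 0" using Cons.prems(1) bsize_pos[of B] by (simp del: bsize_pos)
  then obtain C Cs' where Cs: "Cs = C # Cs'" using Cons.prems(2) by (cases Cs) auto
  have "B = C" using Cons.prems(3)[OF \<open>m > 0\<close>] by (simp add: Cs)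
  moreover have "Bs = Cs'"
  proof (rule Cons.IH)
    show "sum_list (map bsize Bs) = m - bsize B" using Cons.prems(1) by simp
    show "sum_list (map bsize Cs') = m - bsize B" using Cons.prems(2) by (simp add: Cs \<open>B = C\<close>)
    fix p assume "p < m - bsize B"
    then have "p + bsize B < m" by linarith
    then show "lookup Bs p = lookup Cs' p"
      using Cons.prems(3)[of "p + bsize B"] bsize_pos[of B]
      by (simp add: Cs \<open>B = C\<close> del: bsize_pos)
  qed
  ultimately show ?case by (simp add: Cs)
qed

lemma lookup_SomeD:
  assumes "lookup Bs p = Some B"
  shows "B \<in> set Bs" "p + bsize B \<le> sum_list (map bsize Bs)"
    "\<lbrakk>p < q; q < p + bsize B\<rbrakk> \<Longrightarrow> lookup Bs q = None"
    "p + bsize B < sum_list (map bsize Bs) \<Longrightarrow> lookup Bs (p + bsize B) \<noteq> None"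
  using assms
proof (induction Bs arbitrary: p q)
  case (Cons C Bs)
  {
    case 1
    then show ?case using Cons(1)[of "p - bsize C"] by (auto split: if_splits)
  next
    case 2
    then show ?case using Cons(2)[of "p - bsize C"] by (auto split: if_splits)
  next
    case 3
    then show ?case using Cons(3)[of "p - bsize C" "q - bsize C"] by (auto split: if_splits)
  next
    case 4
    show ?case
    proof (cases "p = 0")
      case True
      then have "B = C" using 4 by simp
      then have "Bs \<noteq> []" using 4 True by auto
      then show ?thesis using True \<open>B = C\<close> by (cases Bs) auto
    next
      case False
      then have "\<not> p < bsize C" "lookup Bs (p - bsize C) = Some B" using 4 by (auto split: if_splits)
      moreover have "lookup Bs (p - bsize C + bsize B) \<noteq> None"
        using Cons(4)[of "p - bsize C"] calculation 4 by simp
      ultimately show ?thesis using False by simp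
    qed
  }
qed simp_all

lemma tiling_segment:
  assumes "\<delta> \<in> tilings n" "\<delta> s \<noteq> None" "\<delta> (s + int m) \<noteq> None"
  shows "\<exists>Bs\<in>seqs m. \<forall>p<m. lookup Bs p = \<delta> (s + int p)"
  using assms(2,3)
proof (induction m arbitrary: s rule: less_induct)
  case (less m)
  show ?case
  proof (cases "m = 0")
    case False
    obtain B where B: "\<delta> s = Some B" using less.prems by blast
    have le: "bsize B \<le> m"
      using tilingsD(4)[OF assms(1) B, of "s + int m"] less.prems(2) False by force
    obtain Bs where Bs: "Bs \<in> seqs (m - bsize B)"
      "\<forall>p<m - bsize B. lookup Bs p = \<delta> (s + int (bsize B) + int p)"
      using less.IH[of "m - bsize B" "s + int (bsize B)"] tilingsD(3)[OF assms(1) B] less.prems(2) le False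
      by auto
    have "lookup (B # Bs) p = \<delta> (s + int p)" if "p < m" for p
    proof -
      consider "p = 0" | "0 < p" "p < bsize B" | "p \<ge> bsize B" by linarith
      then show ?thesis
      proof cases
        case 2
        then show ?thesis using tilingsD(4)[OF assms(1) B, of "s + int p"] by simp
      next
        case 3
        then show ?thesis using Bs(2) that bsize_pos[of B]
          by (auto dest!: spec[of _ "p - bsize B"] simp: algebra_simps of_nat_diff simp del: bsize_pos)
      qed (simp add: B)
    qed
    moreover have "B # Bs \<in> seqs m"
      using Bs(1) tilingsD(2)[OF assms(1) B] le by (auto simp: seqs_def)
    ultimately show ?thesis by blast
  qed simp
qed

text \<open>A tiling is cut open at the block \<open>B\<close> that covers position 0: it has size
  \<open>b\<close> and starts at \<open>- a\<close>, and \<open>Bs\<close> fills the rest of the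
  period. The \<open>b\<close> possible offsets account for the derivative in
  \<open>q G' / (1 - G)\<close>.\<close>

definition rooted :: "nat \<Rightarrow> (nat \<times> nat \<times> block \<times> block list) set" where
  "rooted n = (SIGMA b:{..n}. {..<b} \<times> blocks b \<times> seqs (n - b))"

definition periodic_lookup :: "nat \<Rightarrow> nat \<times> nat \<times> block \<times> block list \<Rightarrow> int \<Rightarrow> block option" where
  "periodic_lookup n = (\<lambda>(b, a, B, Bs) x. lookup (B # Bs) (nat ((x + int a) mod int n)))"

lemma periodic_lookup_tiling:
  assumes "r \<in> rooted n" "n > 0"
  shows "periodic_lookup n r \<in> tilings n"
proof -
  obtain b a B Bs where r: "r = (b, a, B, Bs)" by (cases r)
  define \<delta> where "\<delta> x = lookup (B # Bs) (nat ((x + int a) mod int n))" for x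
  have total: "sum_list (map bsize (B # Bs)) = n" and blk: "\<forall>C\<in>set (B # Bs). is_block C"
    using assms by (auto simp: r rooted_def blocks_def seqs_def)
  have "\<delta> (x + int n) = \<delta> x" for x
    by (simp add: \<delta>_def add.assoc) (metis add.assoc add.commute mod_add_self2)
  moreover have "\<delta> (- int a) \<noteq> None" by (simp add: \<delta>_def)
  moreover have "is_block C \<and> \<delta> (x + int (bsize C)) \<noteq> None \<and>
       (\<forall>y. x < y \<and> y < x + int (bsize C) \<longrightarrow> \<delta> y = None)" if C: "\<delta> x = Some C" for x C
  proof -
    define p where "p = nat ((x + int a) mod int n)"
    have p: "int p = (x + int a) mod int n" using assms(2) by (simp add: p_def)
    have lp: "lookup (B # Bs) p = Some C" using C by (simp add: \<delta>_def p_def)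
    note D = lookup_SomeD[OF lp, unfolded total]
    have shift: "(x + j + int a) mod int n = (int p + j) mod int n" for j
      unfolding p by (simp add: mod_simps algebra_simps)
    have nth: "\<delta> (x + j) = lookup (B # Bs) (nat (int p + j))" if "0 \<le> j" "int p + j < int n" for j
      unfolding \<delta>_def shift using that by simp
    have "is_block C" using D(1) blk by blast
    moreover have "\<delta> (x + int (bsize C)) \<noteq> None"
    proof (cases "p + bsize C = n")
      \<comment> \<open>The period is used up, so the successor is the root block of the next
        period.\<close>
      case True
      then have "(x + int (bsize C) + int a) mod int n = 0"
        unfolding shift by (metis of_nat_add mod_self)
      then show ?thesis by (simp add: \<delta>_def)
    next
      case False
      then have "p + bsize C < n" using D(2) by simp
      then have "\<delta> (x + int (bsize C)) = lookup (B # Bs) (p + bsize C)"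
        using nth[of "int (bsize C)"] by (simp add: nat_add_distrib)
      then show ?thesis using D(4) \<open>p + bsize C < n\<close> by simp
    qed
    moreover have "\<delta> y = None" if "x < y" "y < x + int (bsize C)" for y
    proof -
      have "\<delta> (x + (y - x)) = lookup (B # Bs) (nat (int p + (y - x)))"
        using that D(2) by (intro nth) auto
      moreover have "lookup (B # Bs) (nat (int p + (y - x))) = None"
        using that by (intro D(3)) auto
      ultimately show ?thesis by simp
    qed
    ultimately show ?thesis by blast
  qed
  ultimately have "\<delta> \<in> tilings n" unfolding tilings_def by blast
  then show ?thesis by (simp add: r periodic_lookup_def \<delta>_def[abs_def])
qed

lemma periodic_lookup_inj:
  assumes "n > 0"
  shows "inj_on (periodic_lookup n) (rooted n)"
proof (rule inj_onI)
  fix r r' assume rr: "r \<in> rooted n" "r' \<in> rooted n" "periodic_lookup n r = periodic_lookup n r'"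
  obtain b a B Bs b' a' B' Bs' where r: "r = (b, a, B, Bs)" "r' = (b', a', B', Bs')"
    by (cases r, cases r')
  have tot: "sum_list (map bsize (B # Bs)) = n" "sum_list (map bsize (B' # Bs')) = n"
    "bsize B = b" "bsize B' = b'" "a < b" "a' < b'"
    using rr by (auto simp: r rooted_def blocks_def seqs_def)
  have *: "periodic_lookup n r (- int a) = Some B" "periodic_lookup n r' (- int a') = Some B'"
    by (simp_all add: r periodic_lookup_def)
  \<comment> \<open>Both are the start of the only block that covers position 0.\<close>
  have "- int a = - int a'"
    by (rule tiling_cover_unique[OF periodic_lookup_tiling[OF rr(1) assms], of _ B 0 _ B'])
       (use * rr(3) tot in auto)
  then have a: "a = a'" by simp
  have "lookup (B # Bs) p = lookup (B' # Bs') p" if "p < n" for p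
    using fun_cong[OF rr(3), of "int p - int a"] that
    by (simp only: periodic_lookup_def r a split) simp
  then have "B # Bs = B' # Bs'" using tot by (intro lookup_inj[of _ n]) auto
  then show "r = r'" using a tot r by simp
qed

lemma periodic_lookup_surj:
  assumes "\<delta> \<in> tilings n" "n > 0"
  shows "\<delta> \<in> periodic_lookup n ` rooted n"
proof -
  obtain s B where s: "\<delta> s = Some B" "s \<le> 0" "0 < s + int (bsize B)"
    using tiling_cover[OF assms, of 0] .
  have "\<delta> (s + int n) \<noteq> None" using tilingsD(1)[OF assms(1)] s by simp
  then obtain Cs where Cs: "Cs \<in> seqs n" "\<forall>p<n. lookup Cs p = \<delta> (s + int p)"
    using tiling_segment[OF assms(1), of s n] s by auto
  then have "Cs \<noteq> []" using assms(2) by (auto simp: seqs_def)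
  then obtain C Bs where CB: "Cs = C # Bs" by (cases Cs) auto
  have "C = B" using Cs(2) assms(2) s(1) by (auto simp: CB dest!: spec[of _ 0])
  define r where "r = (bsize B, nat (- s), B, Bs)"
  have "r \<in> rooted n"
    using Cs(1) s by (auto simp: r_def rooted_def blocks_def seqs_def CB \<open>C = B\<close>)
  moreover have "periodic_lookup n r x = \<delta> x" for x
  proof -
    define p where "p = nat ((x - s) mod int n)"
    have "p < n" using assms(2) by (simp add: p_def nat_less_iff)
    have "periodic_lookup n r x = lookup Cs p"
      using s(2) by (simp add: periodic_lookup_def r_def CB \<open>C = B\<close> p_def)
    also have "\<dots> = \<delta> (s + (x - s) mod int n)" using Cs(2) \<open>p < n\<close> assms(2) by (simp add: p_def)
    also have "\<dots> = \<delta> (s + (x - s) mod int n + ((x - s) div int n) * int n)"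
      by (rule periodic_mult[symmetric]) (rule tilingsD(1)[OF assms(1)])
    also have "s + (x - s) mod int n + ((x - s) div int n) * int n = x"
      using mod_div_mult_eq[of "x - s" "int n"] by linarith
    finally show ?thesis .
  qed
  ultimately show ?thesis by (metis ext image_eqI)
qed

lemma tilings_bij: "n > 0 \<Longrightarrow> bij_betw (periodic_lookup n) (rooted n) (tilings n)"
  unfolding bij_betw_def
  using periodic_lookup_inj periodic_lookup_surj periodic_lookup_tiling by blast

lemma card_rooted: "card (rooted n) = (\<Sum>b\<le>n. b * card (blocks b) * card (seqs (n - b)))"
  unfolding rooted_def
  by (subst card_SigmaI) (auto simp: card_cartesian_product mult.assoc)

lemma finite_rooted: "finite (rooted n)"
  unfolding rooted_def by (intro finite_SigmaI) auto

lemma finite_tilings: "n > 0 \<Longrightarrow> finite (tilings n)"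
  using bij_betw_finite[OF tilings_bij] finite_rooted by blast

lemma card_tilings:
  "n > 0 \<Longrightarrow> card (tilings n) = (\<Sum>b\<le>n. b * card (blocks b) * card (seqs (n - b)))"
  using bij_betw_same_card[OF tilings_bij] card_rooted by metis

section \<open>Series identities for blocks, trees and tilings\<close>

definition G_blocks :: "rat fps" where
  "G_blocks = Abs_fps (\<lambda>b. of_nat (card (blocks b)))"

definition H_seqs :: "rat fps" where
  "H_seqs = Abs_fps (\<lambda>m. of_nat (card (seqs m)))"

lemma H_seqs_equation: "H_seqs * (1 - G_blocks) = 1"
proof -
  have "H_seqs = 1 + G_blocks * H_seqs"
  proof (rule fps_ext)
    fix n
    show "H_seqs $ n = (1 + G_blocks * H_seqs) $ n"
      by (cases n) (simp_all add: H_seqs_def G_blocks_def fps_mult_nth card_seqs_Suc atLeast0AtMost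
         del: sum.atMost_Suc sum.cl_ivl_Suc)
  qed
  then show ?thesis by (simp add: algebra_simps)
qed

text \<open>Next to a nonempty left subtree, the right subtree together with its label is a block;
  an empty left subtree admits the label 0 only.\<close>

lemma card_trees_Suc:
  "card (trees (Suc n)) = card (trees n) +
     (\<Sum>l\<le>n. (if l = 0 then 0 else card (trees l)) * card (blocks (Suc n - l)))"
proof -
  have "card (trees (Suc n)) = (\<Sum>l\<le>n. \<Sum>L\<in>trees l. \<Sum>R\<in>trees (n - l). card (labels L R))"
    using sum_trees_Suc[of "\<lambda>_. 1 :: nat" n] by simp
  also have "\<dots> = (\<Sum>l\<le>n. (if l = 0 then card (trees n) else 0) +
     (if l = 0 then 0 else card (trees l)) * card (blocks (Suc n - l)))"
  proof (rule sum.cong[OF refl])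
    fix l assume "l \<in> {..n}"
    have "(\<Sum>L\<in>trees l. \<Sum>R\<in>trees (n - l). card (labels L R)) = card (trees l) * card (blocks (Suc n - l))"
      if "l \<noteq> 0"
    proof -
      have "(\<Sum>R\<in>trees (n - l). card (labels L R)) = card (blocks (Suc n - l))" if "L \<in> trees l" for L
      proof -
        have "L \<noteq> Leaf" using \<open>l \<noteq> 0\<close> that by (auto simp: trees_def)
        then show ?thesis using \<open>l \<in> {..n}\<close> by (simp add: Suc_diff_le blocks_Suc labels_def)
      qed
      then show ?thesis by simp
    qed
    then show "(\<Sum>L\<in>trees l. \<Sum>R\<in>trees (n - l). card (labels L R)) =
      (if l = 0 then card (trees n) else 0) +
      (if l = 0 then 0 else card (trees l)) * card (blocks (Suc n - l))"
      by (auto simp: labels_def)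
  qed
  finally show ?thesis by (simp add: sum.distrib)
qed

lemma fps_I_equation: "(fps_I - 1) * (1 - G_blocks) = fps_X * fps_I"
proof -
  have "fps_I - 1 = fps_X * fps_I + (fps_I - 1) * G_blocks"
  proof (rule fps_ext)
    fix n
    show "(fps_I - 1) $ n = (fps_X * fps_I + (fps_I - 1) * G_blocks) $ n"
    proof (cases n)
      case 0
      then show ?thesis by (simp add: card_trees[symmetric] G_blocks_def)
    next
      case (Suc m)
      have "(fps_I - 1) $ l = of_nat (if l = 0 then 0 else card (trees l))" for l
        by (simp add: card_trees[symmetric])
      then show ?thesis unfolding Suc
        by (simp add: fps_mult_nth[of "fps_I - 1"] atLeast0AtMost card_trees[symmetric]
          card_trees_Suc G_blocks_def del: fps_sub_nth)
    qed
  qed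
  then show ?thesis by (simp add: algebra_simps)
qed

lemma fps_affine_I_if_card_tilings:
  assumes "\<And>n. n > 0 \<Longrightarrow> card (two_stack_sortable n) = card (tilings n)"
  shows "fps_affine_I = fps_X * fps_deriv fps_I / (fps_I * (fps_I - 1)) - 1"
proof -
  define A where "A = fps_X * fps_deriv G_blocks * H_seqs"
  have "fps_affine_I = A"
  proof (rule fps_ext)
    fix n
    have X: "(fps_X * fps_deriv G_blocks) $ b = of_nat b * of_nat (card (blocks b))" for b
      by (cases b) (simp_all add: G_blocks_def)
    show "fps_affine_I $ n = A $ n"
    proof (cases "n = 0")
      case True
      then show ?thesis by (simp add: A_def fps_affine_I_def mult.assoc)
    next
      case False
      then show ?thesis
        unfolding A_def fps_mult_nth[of "fps_X * fps_deriv G_blocks"] X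
        by (simp add: fps_affine_I_def assms card_tilings H_seqs_def atLeast0AtMost)
    qed
  qed
  have XIH: "fps_X * fps_I * H_seqs = fps_I - 1"
    using H_seqs_equation unfolding fps_I_equation[symmetric] by (simp add: mult_ac)
  \<comment> \<open>The logarithmic derivative in a form without division: \<open>H_seqs\<close> is
    the inverse of \<open>1 - G_blocks\<close>.\<close>
  have "fps_deriv ((fps_I - 1) * (1 - G_blocks)) = fps_deriv (fps_X * fps_I)"
    by (simp only: fps_I_equation)
  then have d: "fps_deriv fps_I * (1 - G_blocks) - (fps_I - 1) * fps_deriv G_blocks
      = fps_I + fps_X * fps_deriv fps_I"
    by (simp add: algebra_simps)
  have "(A + 1) * (fps_I * (fps_I - 1)) = fps_X * fps_deriv fps_I"
    using d XIH H_seqs_equation unfolding A_def by algebra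
  \<comment> \<open>The denominator has constant term 0 and is not a unit; the quotient is obtained
    by cancelling a nonzero factor.\<close>
  moreover have "fps_I * (fps_I - 1) \<noteq> 0"
  proof -
    have "fps_I $ 0 \<noteq> 0" "(fps_I - 1) $ 1 \<noteq> 0" by (simp_all add: fps_I_def)
    then show ?thesis by (metis fps_zero_nth mult_eq_0_iff)
  qed
  ultimately have "fps_X * fps_deriv fps_I / (fps_I * (fps_I - 1)) = A + 1"
    by (metis nonzero_mult_div_cancel_right)
  then show ?thesis by (simp add: \<open>fps_affine_I = A\<close>)
qed

section \<open>Affine permutations and Coxeter length\<close>

definition periodic :: "nat \<Rightarrow> (int \<Rightarrow> int) \<Rightarrow> bool" where
  "periodic n w \<longleftrightarrow> (\<forall>i. w (i + int n) = w i + int n)"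

lemma affine_perms_iff:
  "w \<in> affine_perms n \<longleftrightarrow> bij w \<and> periodic n w \<and> (\<Sum>i = 1..int n. w i) = int ((n + 1) choose 2)"
  by (simp add: affine_perms_def periodic_def)

lemma affine_permsD:
  assumes "w \<in> affine_perms n"
  shows "bij w" "inj w" "periodic n w"
  using assms by (auto simp: affine_perms_iff bij_def)

lemma periodic_shift:
  assumes "periodic n w"
  shows "w (i + m * int n) = w i + m * int n"
  using periodic_mult[of "\<lambda>x. w x - x" "int n" i m] assms by (simp add: periodic_def)

text \<open>The representative modulo \<open>n\<close> in the window \<open>{1..int n}\<close> over
  which the normalising sum is taken.\<close>

definition residue :: "nat \<Rightarrow> int \<Rightarrow> int" where
  "residue n x = (x - 1) mod int n + 1"

lemma residue_bounds: "n > 0 \<Longrightarrow> residue n x \<in> {1..int n}"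
  by (simp add: residue_def add1_zle_eq)

lemma residue_eq: "\<exists>m. x = residue n x + m * int n"
  using mod_div_mult_eq[of "x - 1" "int n"] by (intro exI[of _ "(x - 1) div int n"]) (simp add: residue_def)

lemma residue_cong: "residue n x = residue n y \<Longrightarrow> \<exists>m. x = y + m * int n"
proof -
  assume eq: "residue n x = residue n y"
  obtain a b where "x = residue n x + a * int n" "y = residue n y + b * int n"
    using residue_eq by blast
  then have "x = y + (a - b) * int n" using eq by (simp add: algebra_simps)
  then show ?thesis by blast
qed

lemma residue_shift: "residue n (x + m * int n) = residue n x"
  by (simp add: residue_def) (metis add_diff_eq diff_add_eq mod_mult_self1)

lemma residue_id: "x \<in> {1..int n} \<Longrightarrow> residue n x = x"
  by (simp add: residue_def)

lemma periodic_residue: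
  assumes "\<And>x. f (x + int n) = f x"
  shows "f (residue n x) = f x"
  using residue_eq[of x n] periodic_mult[of f "int n", OF assms] by metis

lemma residue_perm:
  assumes "n > 0" "inj w" "periodic n w"
  shows "bij_betw (\<lambda>i. residue n (w i)) {1..int n} {1..int n}"
proof -
  have "inj_on (\<lambda>i. residue n (w i)) {1..int n}"
  proof (rule inj_onI)
    fix i j assume ij: "i \<in> {1..int n}" "j \<in> {1..int n}" "residue n (w i) = residue n (w j)"
    then obtain m where "w i = w j + m * int n" using residue_cong by blast
    then have "i = j + m * int n" using assms periodic_shift[of n w j m] by (metis injD)
    then have "residue n i = residue n j" by (simp add: residue_shift)
    then show "i = j" using ij by (simp add: residue_id)
  qed
  moreover have "(\<lambda>i. residue n (w i)) ` {1..int n} \<subseteq> {1..int n}"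
    using residue_bounds[OF assms(1)] by blast
  ultimately show ?thesis by (simp add: bij_betw_def endo_inj_surj)
qed

lemma sum_periodic_reindex:
  assumes "n > 0" "inj w" "periodic n w" "\<And>x. f (x + int n) = f x"
  shows "(\<Sum>i = 1..int n. f (w i)) = (\<Sum>i = 1..int n. f i :: 'a :: comm_monoid_add)"
  using sum.reindex_bij_betw[OF residue_perm[OF assms(1-3)], of f]
  by (simp add: periodic_residue[of f, OF assms(4)])

lemma inj_periodic_bij:
  assumes "n > 0" "inj w" "periodic n w"
  shows "bij w"
proof -
  have "\<exists>j. x = w j" for x
  proof -
    have "residue n x \<in> (\<lambda>i. residue n (w i)) ` {1..int n}"
      using residue_perm[OF assms] residue_bounds[OF assms(1)] by (simp add: bij_betw_def)
    then obtain i where "residue n x = residue n (w i)" by auto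
    then obtain m where "x = w i + m * int n" using residue_cong by blast
    then show ?thesis using periodic_shift[OF assms(3)] by metis
  qed
  then show ?thesis using assms(2) by (auto simp: bij_def)
qed

lemma sum_id_period: "(\<Sum>i = 1..int n. i) = int ((n + 1) choose 2)"
proof (induction n)
  case (Suc n)
  have "{1..int (Suc n)} = insert (int (Suc n)) {1..int n}" by auto
  then show ?case using Suc by (simp add: numeral_2_eq_2)
qed (simp add: binomial_eq_0)

lemma affine_permsI:
  assumes "n > 0" "inj w" "periodic n w" "(\<Sum>i = 1..int n. w i - i) = 0"
  shows "w \<in> affine_perms n"
  using assms inj_periodic_bij[OF assms(1-3)] sum_id_period[of n]
  by (simp add: affine_perms_iff sum_subtractf)

lemma affine_perms_sum:
  assumes "w \<in> affine_perms n"
  shows "(\<Sum>i = 1..int n. w i - i) = 0"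
  using assms sum_id_period[of n] by (simp add: affine_perms_iff sum_subtractf)

lemma id_affine_perm: "n > 0 \<Longrightarrow> id \<in> affine_perms n"
  by (rule affine_permsI) (simp_all add: periodic_def)

lemma affine_perms_comp:
  assumes "n > 0" "v \<in> affine_perms n" "w \<in> affine_perms n"
  shows "v \<circ> w \<in> affine_perms n"
proof (rule affine_permsI[OF assms(1)])
  show "inj (v \<circ> w)" using affine_permsD(2) assms by (metis inj_compose)
  show "periodic n (v \<circ> w)" using affine_permsD(3) assms by (simp add: periodic_def)
  have "(\<Sum>i = 1..int n. (v \<circ> w) i - i) = (\<Sum>i = 1..int n. v (w i) - w i) + (\<Sum>i = 1..int n. w i - i)"
    by (simp flip: sum.distrib)
  also have "(\<Sum>i = 1..int n. v (w i) - w i) = (\<Sum>i = 1..int n. v i - i)"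
    using affine_permsD(3)[OF assms(2)]
    by (intro sum_periodic_reindex[OF assms(1) affine_permsD(2,3)[OF assms(3)]]) (simp add: periodic_def)
  finally show "(\<Sum>i = 1..int n. (v \<circ> w) i - i) = 0" by (simp add: affine_perms_sum assms)
qed

lemma affine_perms_inv:
  assumes "n > 0" "w \<in> affine_perms n"
  shows "inv w \<in> affine_perms n"
proof (rule affine_permsI[OF assms(1)])
  note w = affine_permsD[OF assms(2)]
  show "inj (inv w)" using w(1) bij_imp_bij_inv bij_is_inj by blast
  show per: "periodic n (inv w)"
    unfolding periodic_def
  proof
    fix i
    have "w (inv w i + int n) = i + int n"
      using w(1,3) by (simp add: periodic_def bij_is_surj surj_f_inv_f)
    then show "inv w (i + int n) = inv w i + int n" using w(2) by (metis inv_f_f)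
  qed
  have "(\<Sum>i = 1..int n. inv w i - i) = (\<Sum>i = 1..int n. inv w (w i) - w i)"
    using per by (intro sum_periodic_reindex[symmetric] w assms) (simp add: periodic_def)
  also have "\<dots> = - (\<Sum>i = 1..int n. w i - i)"
    using w(2) by (simp flip: sum_negf)
  finally show "(\<Sum>i = 1..int n. inv w i - i) = 0" by (simp add: affine_perms_sum assms)
qed

text \<open>Since \<open>w\<close> permutes the residues, its total displacement over a period is a
  multiple of \<open>n\<close>; the quotient is the constant to subtract.\<close>

lemma affine_perms_normalise:
  assumes "n > 0" "inj w" "periodic n w"
  shows "\<exists>c. (\<lambda>x. w x - c) \<in> affine_perms n"
proof -
  have "int n dvd (\<Sum>i = 1..int n. w i - residue n (w i))"
  proof (rule dvd_sum)
    fix i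
    obtain m where "w i = residue n (w i) + m * int n" using residue_eq by blast
    then have "w i - residue n (w i) = m * int n" by linarith
    then show "int n dvd w i - residue n (w i)" by simp
  qed
  then obtain c where "(\<Sum>i = 1..int n. w i - residue n (w i)) = int n * c" by (auto elim: dvdE)
  then have "(\<Sum>i = 1..int n. w i) - (\<Sum>i = 1..int n. i) = int n * c"
    using sum.reindex_bij_betw[OF residue_perm[OF assms], of "\<lambda>x. x"] by (simp add: sum_subtractf)
  then have "(\<Sum>i = 1..int n. w i - c - i) = 0" by (simp add: sum_subtractf)
  then have "(\<lambda>x. w x - c) \<in> affine_perms n"
    using assms by (intro affine_permsI) (auto simp: periodic_def inj_def)
  then show ?thesis ..
qed

text \<open>The displacement \<open>f x - x\<close> is nondecreasing and periodic, hence constant,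
  and it sums to 0 over a period.\<close>

lemma mono_affine_perm_id:
  assumes "n > 0" "f \<in> affine_perms n" "\<And>x. f x < f (x + 1)"
  shows "f = id"
proof -
  note f = affine_permsD[OF assms(2)]
  define g where "g x = f x - x" for x
  have g_per: "g (x + m * int n) = g x" for x m
    by (simp add: g_def periodic_shift[OF f(3)])
  have g_Suc: "g x \<le> g (x + 1)" for x using assms(3)[of x] by (simp add: g_def)
  have g_mono: "g x \<le> g y" if "x \<le> y" for x y
    using that
  proof (induction y rule: int_ge_induct)
    case (step y)
    then show ?case using g_Suc[of y] by linarith
  qed simp
  have const: "g x = g 0" for x
  proof (rule antisym)
    have "\<bar>x\<bar> * 1 \<le> \<bar>x\<bar> * int n" using assms(1) by (intro mult_left_mono) auto
    then have "x \<le> 0 + \<bar>x\<bar> * int n" "0 + (- \<bar>x\<bar>) * int n \<le> x" by auto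
    then have "g x \<le> g (0 + \<bar>x\<bar> * int n)" "g (0 + (- \<bar>x\<bar>) * int n) \<le> g x" by (auto intro!: g_mono)
    then show "g x \<le> g 0" "g 0 \<le> g x" unfolding g_per .
  qed
  have "(\<Sum>i = 1..int n. g i) = 0" using affine_perms_sum[OF assms(2)] by (simp add: g_def)
  moreover have "(\<Sum>i = 1..int n. g i) = (\<Sum>i = 1..int n. g 0)" by (intro sum.cong refl const)
  ultimately have "g 0 = 0" using assms(1) by simp
  then have "g x = 0" for x using const[of x] by simp
  then show ?thesis by (intro ext) (simp add: g_def)
qed

text \<open>\<open>v \<circ> inv w\<close> is increasing, hence the identity. Affine permutations
  can thus be compared through relative order alone.\<close>

lemma affine_perm_eqI:
  assumes "n > 0" "v \<in> affine_perms n" "w \<in> affine_perms n"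
    and "\<And>i j. w i < w j \<Longrightarrow> v i < v j"
  shows "v = w"
proof -
  have w: "w (inv w x) = x" for x
    using affine_permsD(1)[OF assms(3)] by (simp add: bij_is_surj surj_f_inv_f)
  have "v \<circ> inv w = id"
  proof (rule mono_affine_perm_id[OF assms(1)])
    show "v \<circ> inv w \<in> affine_perms n" using assms by (intro affine_perms_comp affine_perms_inv)
    show "(v \<circ> inv w) x < (v \<circ> inv w) (x + 1)" for x by (simp add: assms(4) w)
  qed
  then have "v (inv w (w x)) = w x" for x by (metis comp_apply id_apply)
  then show ?thesis using affine_permsD(2)[OF assms(3)] by (intro ext) simp
qed

text \<open>\<open>n f(x) - N x\<close> is periodic, hence bounded by some \<open>M\<close>, and
  linear growth wins beyond distance \<open>2 M\<close>. The increment \<open>N\<close> is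
  \<open>n\<close> for affine permutations and \<open>2 n\<close> for the auxiliary values built
  from a tiling.\<close>

lemma eventually_less:
  fixes f :: "int \<Rightarrow> int"
  assumes "n > 0" "N > 0" "\<And>x. f (x + int n) = f x + N"
  obtains B where "B > 0" "\<And>i j. i + B \<le> j \<Longrightarrow> f i < f j"
proof -
  define g where "g x = int n * f x - N * x" for x
  define M where "M = Max ((\<lambda>x. \<bar>g x\<bar>) ` {1..int n})"
  have "g (x + int n) = g x" for x by (simp add: g_def assms algebra_simps)
  then have "g (residue n x) = g x" for x by (rule periodic_residue)
  then have M: "\<bar>g x\<bar> \<le> M" for x
    unfolding M_def using residue_bounds[OF assms(1), of x]
    by (intro Max_ge) (auto intro!: image_eqI[of _ _ "residue n x"])
  have "f i < f j" if "i + (2 * M + 1) \<le> j" for i j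
  proof -
    have "1 * (j - i) \<le> N * (j - i)"
      using assms(2) that M[of 0] by (intro mult_right_mono) linarith+
    then have "int n * (f j - f i) > 0"
      using M[of i] M[of j] that by (simp add: g_def algebra_simps)
    then show ?thesis using assms(1) by (simp add: zero_less_mult_iff)
  qed
  moreover have "2 * M + 1 > 0" using M[of 0] by linarith
  ultimately show ?thesis using that by blast
qed

text \<open>The value at \<open>j\<close> counts the predecessors of \<open>j\<close>; the cutoff \<open>a\<close> below
  makes that number finite, and the result does not depend on it.\<close>

lemma affine_perm_of_order:
  assumes n: "n > 0" and irr: "\<And>i. \<not> R i i" and tot: "\<And>i j. i \<noteq> j \<Longrightarrow> R i j \<or> R j i"
    and trans: "\<And>i j k. R i j \<Longrightarrow> R j k \<Longrightarrow> R i k"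
    and per: "\<And>i j. R (i + int n) (j + int n) \<longleftrightarrow> R i j"
    and B: "B > 0" "\<And>i j. i + B \<le> j \<Longrightarrow> R i j"
  obtains p where "p \<in> affine_perms n" "\<And>i j. p i < p j \<longleftrightarrow> R i j"
proof -
  define S where "S a j = {i. a \<le> i \<and> R i j}" for a j
  have fin: "finite (S a j)" for a j
  proof (rule finite_subset)
    show "S a j \<subseteq> {a..j + B}"
    proof
      fix i assume "i \<in> S a j"
      then have "\<not> j + B \<le> i" using B(2)[of j i] irr trans by (auto simp: S_def)
      then show "i \<in> {a..j + B}" using \<open>i \<in> S a j\<close> by (simp add: S_def)
    qed
  qed simp
  define p0 where "p0 j = j - B + int (card (S (j - B) j))" for j
  have p0: "p0 j = a + int (card (S a j))" if "a \<le> j - B" for a j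
  proof -
    have "S a j = {a..<j - B} \<union> S (j - B) j" using that B(2) by (auto simp: S_def)
    moreover have "{a..<j - B} \<inter> S (j - B) j = {}" by (auto simp: S_def)
    ultimately have "card (S a j) = card {a..<j - B} + card (S (j - B) j)"
      using fin by (simp add: card_Un_disjoint)
    then show ?thesis using that by (simp add: p0_def)
  qed
  have mono: "p0 i < p0 j" if "R i j" for i j
  proof -
    define a where "a = min (i - B) (j - B)"
    have "S a i \<subseteq> S a j" "i \<in> S a j" "i \<notin> S a i"
      using that trans irr B(1) by (auto simp: S_def a_def)
    then have "S a i \<subset> S a j" by blast
    then have "card (S a i) < card (S a j)" by (intro psubset_card_mono fin)
    then show ?thesis by (simp add: p0[of a] a_def)
  qed
  have iff: "p0 i < p0 j \<longleftrightarrow> R i j" for i j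
    using mono tot by (metis less_asym less_irrefl)
  have "inj p0" by (rule injI) (metis iff irr tot)
  moreover have "periodic n p0"
    unfolding periodic_def
  proof
    fix j
    have "S (j + int n - B) (j + int n) = (\<lambda>x. x + int n) ` S (j - B) j"
    proof -
      have "(\<lambda>x. x + int n) ` X = {y. y - int n \<in> X}" for X by (force simp: image_iff)
      then show ?thesis using per[of "y - int n" j for y] by (auto simp: S_def)
    qed
    then have "card (S (j + int n - B) (j + int n)) = card (S (j - B) j)"
      by (simp add: card_image)
    then show "p0 (j + int n) = p0 j + int n" by (simp add: p0_def)
  qed
  ultimately obtain c where "(\<lambda>x. p0 x - c) \<in> affine_perms n"
    using affine_perms_normalise n by blast
  then show ?thesis using that iff by simp
qed

text \<open>Inversions up to simultaneous translation by \<open>n\<close>: the left position is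
  confined to one period.\<close>

definition inversions :: "nat \<Rightarrow> (int \<Rightarrow> int) \<Rightarrow> (int \<times> int) set" where
  "inversions n w = {(i, j). i \<in> {1..int n} \<and> i < j \<and> w j < w i}"

lemma affine_perm_bound:
  assumes "n > 0" "w \<in> affine_perms n"
  obtains B where "B > 0" "\<And>i j. i + B \<le> j \<Longrightarrow> w i < w j"
proof (rule eventually_less[of n "int n" w])
  show "w (x + int n) = w x + int n" for x
    using affine_permsD(3)[OF assms(2)] by (simp add: periodic_def)
qed (use assms(1) that in simp_all)

lemma finite_inversions:
  assumes "n > 0" "w \<in> affine_perms n"
  shows "finite (inversions n w)"
proof -
  obtain B where B: "B > 0" "\<And>i j. i + B \<le> j \<Longrightarrow> w i < w j"
    using affine_perm_bound[OF assms] by blast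
  have "inversions n w \<subseteq> {1..int n} \<times> {1..int n + B}"
  proof (clarsimp simp: inversions_def)
    fix i j assume "1 \<le> i" "i \<le> int n" "i < j" "w j < w i"
    then have "\<not> i + B \<le> j" using B(2)[of i j] by auto
    then show "j \<le> int n + B" using \<open>i \<le> int n\<close> by linarith
  qed
  then show ?thesis by (rule finite_subset) simp
qed

lemma no_inversions_id:
  assumes "n > 0" "w \<in> affine_perms n" "inversions n w = {}"
  shows "w = id"
proof (rule mono_affine_perm_id[OF assms(1,2)])
  fix x
  obtain m where m: "x = residue n x + m * int n" using residue_eq by blast
  have "(residue n x, residue n x + 1) \<notin> inversions n w" using assms(3) by simp
  then have "\<not> w (residue n x + 1) < w (residue n x)"
    using residue_bounds[OF assms(1), of x] by (simp add: inversions_def)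
  then have "w (residue n x) < w (residue n x + 1)"
    using affine_permsD(2)[OF assms(2)] by (metis injD linorder_neqE less_add_one less_irrefl)
  then have "w (residue n x + m * int n) < w (residue n x + 1 + m * int n)"
    by (simp only: periodic_shift[OF affine_permsD(3)[OF assms(2)]])
  then show "w x < w (x + 1)" using m by (metis add.commute add.left_commute)
qed

lemma affine_perms_1: "affine_perms 1 = {id}"
proof -
  have "w = id" if "w \<in> affine_perms 1" for w
    using that mono_affine_perm_id[of 1 w] affine_permsD(3)[OF that] by (simp add: periodic_def)
  then show ?thesis using id_affine_perm[of 1] by auto
qed

lemma residue_cases:
  fixes k :: int and i n :: nat
  obtains m where "k = int i + m * int n" | m where "k = int i + m * int n + 1"
    | "\<And>m. k \<noteq> int i + m * int n" "\<And>m. k \<noteq> int i + m * int n + 1"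
  by blast

lemma residues_disjoint:
  assumes "n \<ge> 2"
  shows "i + m * int n + 1 \<noteq> i + l * int n"
proof
  assume "i + m * int n + 1 = i + l * int n"
  then have "(l - m) * int n = 1" by (simp add: algebra_simps)
  then have "int n dvd 1" by (metis dvd_triv_right)
  then show False using assms by simp
qed

lemma simple_gen_eq:
  assumes "n \<ge> 2"
  shows "simple_gen n i (int i + m * int n) = int i + m * int n + 1"
    "simple_gen n i (int i + m * int n + 1) = int i + m * int n"
    "\<lbrakk>\<And>m. k \<noteq> int i + m * int n; \<And>m. k \<noteq> int i + m * int n + 1\<rbrakk> \<Longrightarrow> simple_gen n i k = k"
proof -
  show "simple_gen n i (int i + m * int n) = int i + m * int n + 1" by (auto simp: simple_gen_def)
  have "\<nexists>l. int i + m * int n + 1 = int i + l * int n" using residues_disjoint[OF assms] by blast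
  then show "simple_gen n i (int i + m * int n + 1) = int i + m * int n"
    by (auto simp: simple_gen_def)
  show "simple_gen n i k = k" if "\<And>m. k \<noteq> int i + m * int n" "\<And>m. k \<noteq> int i + m * int n + 1"
    using that by (simp add: simple_gen_def)
qed

lemma simple_gen_invol:
  assumes "n \<ge> 2"
  shows "simple_gen n i (simple_gen n i k) = k"
  by (cases k rule: residue_cases[of _ i n]) (simp_all only: simple_gen_eq[OF assms] not_False_eq_True simp_thms)

text \<open>A generator moves every integer by at most 1, so it can reverse only neighbours, and of
  these only the pairs that it swaps.\<close>

lemma simple_gen_mono:
  assumes "n \<ge> 2" "x < y" "\<not> (\<exists>m. x = int i + m * int n \<and> y = x + 1)"
  shows "simple_gen n i x < simple_gen n i y"
proof -
  have x: "simple_gen n i x \<le> x \<or> (simple_gen n i x = x + 1 \<and> (\<exists>m. x = int i + m * int n))"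
    using simple_gen_eq[OF assms(1), where i = i] by (cases x rule: residue_cases[of _ i n]) auto
  have y: "simple_gen n i y \<ge> y \<or> (simple_gen n i y = y - 1 \<and> (\<exists>m. y - 1 = int i + m * int n))"
    using simple_gen_eq[OF assms(1), where i = i] by (cases y rule: residue_cases[of _ i n]) auto
  have neq: "simple_gen n i x \<noteq> simple_gen n i y"
    using simple_gen_invol[OF assms(1), of i x] simple_gen_invol[OF assms(1), of i y] assms(2) by auto
  have "\<not> simple_gen n i x > simple_gen n i y"
  proof
    assume gt: "simple_gen n i x > simple_gen n i y"
    have x1: "simple_gen n i x \<le> x + 1" and y1: "simple_gen n i y \<ge> y - 1" using x y by auto
    show False
    proof (cases "y - 1 = x")
      case True
      then have "\<nexists>m. x = int i + m * int n" using assms(3) by auto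
      then have "simple_gen n i x \<le> x" "simple_gen n i y \<ge> y" using x y True by auto
      then show False using gt assms(2) by linarith
    next
      case False
      then show False using x1 y1 gt assms(2) by linarith
    qed
  qed
  then show ?thesis using neq by simp
qed

lemma simple_gen_affine_perm:
  assumes "n \<ge> 2"
  shows "simple_gen n i \<in> affine_perms n"
proof (rule affine_permsI)
  show "n > 0" using assms by simp
  show "inj (simple_gen n i)" using simple_gen_invol[OF assms, of i] by (rule inj_on_inverseI)
  \<comment> \<open>The indicator of the class of \<open>i\<close> modulo \<open>n\<close>. The
    generator adds \<open>e k - e (k - 1)\<close> to \<open>k\<close>, which sums to 0 over a
    period.\<close>
  define e where "e k = (if \<exists>m. k = int i + m * int n then 1 else 0 :: int)" for k
  have e_per: "e (k + int n) = e k" for k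
  proof -
    have "(\<exists>m. z = int i + m * int n) \<longleftrightarrow> int n dvd z - int i" for z
      by (auto simp: dvd_def diff_eq_eq mult.commute add.commute)
    moreover have "k + int n - int i = (k - int i) + int n" by simp
    ultimately show ?thesis by (simp only: e_def dvd_add_triv_right_iff)
  qed
  have s: "simple_gen n i k = k + e k - e (k - 1)" for k
  proof -
    have e1: "e (k - 1) = (if \<exists>m. k = int i + m * int n + 1 then 1 else 0)"
      by (simp add: e_def diff_eq_eq)
    show ?thesis
    proof (cases k rule: residue_cases[of _ i n])
      case 1
      then have "\<nexists>m. k = int i + m * int n + 1" using residues_disjoint[OF assms] by metis
      then show ?thesis unfolding e1 using 1 simple_gen_eq(1,2)[OF assms, of i] by (auto simp: e_def)
    next
      case 2
      then have "\<nexists>m. k = int i + m * int n" using residues_disjoint[OF assms] by metis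
      then show ?thesis unfolding e1 using 2 simple_gen_eq(1,2)[OF assms, of i] by (auto simp: e_def)
    next
      case 3
      then show ?thesis unfolding e1 using simple_gen_eq(3)[OF assms] by (simp add: e_def)
    qed
  qed
  show "periodic n (simple_gen n i)"
    unfolding periodic_def s using e_per[of "_ - 1"] by (simp add: e_per algebra_simps)
  have "(\<Sum>k = 1..int n. e (k - 1)) = (\<Sum>k = 1..int n. e k)"
    using assms by (intro sum_periodic_reindex e_per) (auto simp: periodic_def inj_def)
  then show "(\<Sum>k = 1..int n. simple_gen n i k - k) = 0"
    by (simp add: s sum_subtractf sum.distrib)
qed

text \<open>The generator exchanges the neighbouring values \<open>i\<close> and
  \<open>i + 1\<close> and their translates, so the pair \<open>(a, b)\<close> and its translates
  cease to be inversions while every other comparison is kept. Modulo translation exactly one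
  inversion disappears.\<close>

lemma inversions_simple_gen:
  assumes n: "n \<ge> 2" and w: "w \<in> affine_perms n" and ab: "w a = int i + 1" "w b = int i" "a < b"
  shows "card (inversions n w) = card (inversions n (simple_gen n i \<circ> w)) + 1"
    and "x < y \<Longrightarrow> simple_gen n i (w y) < simple_gen n i (w x) \<longleftrightarrow>
           w y < w x \<and> (\<nexists>m. x = a + m * int n \<and> y = b + m * int n)"
proof -
  have n0: "n > 0" using n by simp
  note per = periodic_shift[OF affine_permsD(3)[OF w]]
  have inj: "w x = w y \<longleftrightarrow> x = y" for x y using affine_permsD(2)[OF w] by (auto dest: injD)
  have iff: "simple_gen n i (w y) < simple_gen n i (w x) \<longleftrightarrow>
     w y < w x \<and> (\<nexists>m. x = a + m * int n \<and> y = b + m * int n)" if xy: "x < y" for x y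
  proof (cases "\<exists>m. x = a + m * int n \<and> y = b + m * int n")
    case True
    then obtain m where m: "x = a + m * int n" "y = b + m * int n" by blast
    then have "w x = int i + m * int n + 1" "w y = int i + m * int n" using ab per by simp_all
    then have "\<not> simple_gen n i (w y) < simple_gen n i (w x)" using simple_gen_eq[OF n] by simp
    then show ?thesis using True by blast
  next
    case False
    consider "w x < w y" | "w y < w x" using inj[of x y] xy by linarith
    then show ?thesis
    proof cases
      case 1
      have "\<not> (\<exists>m. w x = int i + m * int n \<and> w y = w x + 1)"
      proof
        assume "\<exists>m. w x = int i + m * int n \<and> w y = w x + 1"
        then obtain m where "w x = int i + m * int n" "w y = w x + 1" by blast
        then have "w x = w (b + m * int n)" "w y = w (a + m * int n)" using ab per by simp_all
        then show False using inj xy ab(3) by simp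
      qed
      then show ?thesis using simple_gen_mono[OF n 1, of i] 1 by simp
    next
      case 2
      have "\<not> (\<exists>m. w y = int i + m * int n \<and> w x = w y + 1)"
      proof
        assume "\<exists>m. w y = int i + m * int n \<and> w x = w y + 1"
        then obtain m where "w y = int i + m * int n" "w x = w y + 1" by blast
        then have "w y = w (b + m * int n)" "w x = w (a + m * int n)" using ab per by simp_all
        then show False using inj False by blast
      qed
      then show ?thesis using simple_gen_mono[OF n 2, of i] 2 False by simp
    qed
  qed
  then show "x < y \<Longrightarrow> simple_gen n i (w y) < simple_gen n i (w x) \<longleftrightarrow>
     w y < w x \<and> (\<nexists>m. x = a + m * int n \<and> y = b + m * int n)" .
  obtain m where m: "a = residue n a + m * int n" using residue_eq by blast
  define a' b' where "a' = residue n a" and "b' = b - m * int n"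
  have a': "a' = a + (- m) * int n" "b' = b + (- m) * int n"
    using m by (simp_all add: a'_def b'_def algebra_simps)
  have bounds: "a' \<in> {1..int n}" unfolding a'_def by (rule residue_bounds[OF n0])
  have "inversions n w = insert (a', b') (inversions n (simple_gen n i \<circ> w))"
  proof (intro equalityI subsetI)
    fix z assume z: "z \<in> inversions n w"
    obtain x y where xy: "z = (x, y)" by (cases z)
    with z have x: "x \<in> {1..int n}" "x < y" "w y < w x" by (auto simp: inversions_def)
    show "z \<in> insert (a', b') (inversions n (simple_gen n i \<circ> w))"
    proof (cases "\<exists>m. x = a + m * int n \<and> y = b + m * int n")
      case True
      then obtain l where l: "x = a + l * int n" "y = b + l * int n" by blast
      then have "residue n x = residue n a" by (simp add: residue_shift)
      then have "x = a'" using x(1) by (simp add: residue_id a'_def)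
      then have "y = b'" using l a' by simp
      then show ?thesis using \<open>x = a'\<close> xy by simp
    next
      case False
      then show ?thesis using iff[OF x(2)] x xy by (simp add: inversions_def)
    qed
  next
    fix z assume z: "z \<in> insert (a', b') (inversions n (simple_gen n i \<circ> w))"
    show "z \<in> inversions n w"
    proof (cases "z = (a', b')")
      case True
      have "w b' < w a'" unfolding a' per ab by simp
      moreover have "a' < b'" using ab(3) by (simp add: a')
      ultimately show ?thesis using True bounds by (simp add: inversions_def)
    next
      case False
      then show ?thesis using z iff by (auto simp: inversions_def)
    qed
  qed
  moreover have "(a', b') \<notin> inversions n (simple_gen n i \<circ> w)"
  proof -
    have "\<exists>m. a' = a + m * int n \<and> b' = b + m * int n" using a' by blast
    then show ?thesis using iff[of a' b'] by (auto simp: inversions_def)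
  qed
  moreover have "finite (inversions n (simple_gen n i \<circ> w))"
    by (intro finite_inversions n0 affine_perms_comp simple_gen_affine_perm n w)
  ultimately show "card (inversions n w) = card (inversions n (simple_gen n i \<circ> w)) + 1" by simp
qed

section \<open>Words in the generators, and length as the number of inversions\<close>

lemma word_prod_Nil: "word_prod n [] = id"
  by (simp add: word_prod_def)

lemma word_prod_Cons: "word_prod n (i # is) = simple_gen n i \<circ> word_prod n is"
  by (simp add: word_prod_def)

lemma word_prod_affine_perm:
  assumes "n \<ge> 2"
  shows "word_prod n is \<in> affine_perms n"
proof (induction "is")
  case Nil
  show ?case unfolding word_prod_Nil using assms by (intro id_affine_perm) simp
next
  case (Cons i "is")
  then show ?case unfolding word_prod_Cons using assms
    by (intro affine_perms_comp simple_gen_affine_perm) simp_all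
qed

lemma inversions_id: "inversions n id = {}"
  by (auto simp: inversions_def)

lemma inversions_word_prod:
  assumes "n \<ge> 2"
  shows "card (inversions n (word_prod n is)) \<le> length is"
proof (induction "is")
  case Nil
  show ?case unfolding word_prod_Nil inversions_id by simp
next
  case (Cons i "is")
  define w where "w = word_prod n is"
  have w: "w \<in> affine_perms n" using word_prod_affine_perm[OF assms] by (simp add: w_def)
  have sw: "simple_gen n i \<circ> w \<in> affine_perms n"
    using affine_perms_comp[OF _ simple_gen_affine_perm[OF assms] w] assms by simp
  have ssw: "simple_gen n i \<circ> (simple_gen n i \<circ> w) = w"
    by (rule ext) (simp add: simple_gen_invol[OF assms])
  have si: "simple_gen n i (int i) = int i + 1" "simple_gen n i (int i + 1) = int i"
    using simple_gen_eq(1,2)[OF assms, of i 0] by simp_all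
  obtain a b where ab: "w a = int i + 1" "w b = int i"
    using affine_permsD(1)[OF w] by (metis bij_pointE)
  then consider "a < b" | "b < a" by (metis linorder_neqE less_add_one less_irrefl)
  then have "card (inversions n (simple_gen n i \<circ> w)) \<le> card (inversions n w) + 1"
  proof cases
    case 1
    then show ?thesis using inversions_simple_gen(1)[OF assms w ab] by simp
  next
    \<comment> \<open>In this case \<open>simple_gen n i \<circ> w\<close> has the inversion, and
      applying the generator again returns to \<open>w\<close>.\<close>
    case 2
    then show ?thesis using inversions_simple_gen(1)[OF assms sw, of b i a] ab si by (simp add: ssw)
  qed
  then show ?case using Cons unfolding word_prod_Cons w_def[symmetric] list.size by linarith
qed

text \<open>Otherwise \<open>p \<circ> inv u\<close> would be increasing and hence the identity.
  With \<open>p = id\<close> this drives the construction of reduced words; with the postorder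
  permutation as \<open>p\<close> it gives a step down inside a sylvester class.\<close>

lemma exists_descent:
  assumes "n > 0" "u \<in> affine_perms n" "p \<in> affine_perms n" "u \<noteq> p"
  obtains i where "i \<in> {1..n}" "p (inv u (int i + 1)) < p (inv u (int i))"
proof -
  define f where "f = p \<circ> inv u"
  have f: "f \<in> affine_perms n" unfolding f_def using assms by (intro affine_perms_comp affine_perms_inv)
  have "f \<noteq> id"
  proof
    assume "f = id"
    then have "p (inv u (u x)) = u x" for x by (metis comp_apply f_def id_apply)
    then show False using assms(4) affine_permsD(2)[OF assms(2)] by (simp add: fun_eq_iff)
  qed
  then have "\<exists>i\<in>{1..n}. f (int i + 1) < f (int i)"
  proof (rule contrapos_np)
    assume no: "\<not> (\<exists>i\<in>{1..n}. f (int i + 1) < f (int i))"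
    show "f = id"
    proof (rule mono_affine_perm_id[OF assms(1) f])
      fix x
      define i where "i = nat (residue n x)"
      have i: "i \<in> {1..n}" "int i = residue n x"
        using residue_bounds[OF assms(1), of x] by (auto simp: i_def)
      obtain m where m: "x = int i + m * int n" using residue_eq i(2) by metis
      have "f (int i) < f (int i + 1)"
        using no i(1) affine_permsD(2)[OF f] by (metis injD linorder_neqE less_add_one less_irrefl)
      then have "f (int i + m * int n) < f (int i + 1 + m * int n)"
        by (simp only: periodic_shift[OF affine_permsD(3)[OF f]])
      then show "f x < f (x + 1)" unfolding m by (simp add: ac_simps)
    qed
  qed
  then show ?thesis using that by (auto simp: f_def)
qed

lemma exists_reduced_word:
  assumes "n \<ge> 2" "w \<in> affine_perms n"
  shows "\<exists>is. set is \<subseteq> {1..n} \<and> length is = card (inversions n w) \<and> word_prod n is = w"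
  using assms(2)
proof (induction "card (inversions n w)" arbitrary: w)
  case 0
  have n: "n > 0" using assms(1) by simp
  have "inversions n w = {}" using finite_inversions[OF n 0(2)] 0(1) by simp
  then have "w = id" by (rule no_inversions_id[OF n 0(2)])
  then have "word_prod n [] = w" by (simp only: word_prod_Nil)
  moreover have "length [] = card (inversions n w)" using 0(1) by simp
  ultimately show ?case by (metis empty_set empty_subsetI list.size(3))
next
  case (Suc c)
  have n: "n > 0" using assms(1) by simp
  have "w \<noteq> id" using Suc(2) inversions_id[of n] by (metis card.empty nat.distinct(1))
  then obtain i where i: "i \<in> {1..n}" "id (inv w (int i + 1)) < id (inv w (int i))"
    by (rule exists_descent[OF n Suc(3) id_affine_perm[OF n]])
  define v where "v = simple_gen n i \<circ> w"
  have v: "v \<in> affine_perms n"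
    unfolding v_def by (intro affine_perms_comp n simple_gen_affine_perm assms(1) Suc(3))
  have w: "w (inv w x) = x" for x
    using affine_permsD(1)[OF Suc(3)] by (simp add: bij_is_surj surj_f_inv_f)
  have "card (inversions n w) = card (inversions n v) + 1"
    unfolding v_def by (rule inversions_simple_gen(1)[OF assms(1) Suc(3) w w i(2)[unfolded id_apply]])
  then have "c = card (inversions n v)" using Suc(2) by linarith
  then obtain "is" where "is": "set is \<subseteq> {1..n}" "length is = card (inversions n v)" "word_prod n is = v"
    using Suc(1) v by blast
  have "word_prod n (i # is) = w"
    unfolding word_prod_Cons "is"(3) v_def by (rule ext) (simp add: simple_gen_invol[OF assms(1)])
  moreover have "length (i # is) = card (inversions n w)"
    using "is"(2) \<open>card (inversions n w) = _\<close> by simp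
  moreover have "set (i # is) \<subseteq> {1..n}" using "is"(1) i(1) by simp
  ultimately show ?case by blast
qed

lemma cox_length_eq_inversions:
  assumes "n \<ge> 2" "w \<in> affine_perms n"
  shows "cox_length n w = card (inversions n w)"
  unfolding cox_length_def
proof (rule Least_equality)
  show "\<exists>is. set is \<subseteq> gen_indices n \<and> length is = card (inversions n w) \<and> word_prod n is = w"
    using exists_reduced_word[OF assms] assms(1) by (simp add: gen_indices_def)
qed (use inversions_word_prod[OF assms(1)] in auto)

section \<open>Postorder and the affine stack-sorting map\<close>

text \<open>Position \<open>j\<close> lies in the right subtree of position
  \<open>i\<close>.\<close>

definition after :: "(int \<Rightarrow> int) \<Rightarrow> int \<Rightarrow> int \<Rightarrow> bool" where
  "after w i j \<longleftrightarrow> i < j \<and> (\<forall>k. i < k \<and> k \<le> j \<longrightarrow> w k < w i)"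

text \<open>The postorder of the decreasing tree of \<open>w\<close>.\<close>

definition before :: "(int \<Rightarrow> int) \<Rightarrow> int \<Rightarrow> int \<Rightarrow> bool" where
  "before w i j \<longleftrightarrow> (i < j \<and> \<not> after w i j) \<or> (j < i \<and> after w j i)"

text \<open>Right subtrees alone determine the descendant order. If \<open>i < j\<close> and
  \<open>i\<close> is not below \<open>j\<close>, take the last position from \<open>i\<close> on
  and before \<open>j\<close> whose value exceeds that of \<open>j\<close>: its right subtree
  contains \<open>j\<close>.\<close>

lemma desc_le_after:
  assumes "inj w"
  shows "desc_le w i j \<longleftrightarrow>
    (if i < j then \<forall>k. i \<le> k \<and> k < j \<longrightarrow> \<not> after w k j else if j < i then after w j i else True)"
proof -
  have neq: "w x \<noteq> w y" if "x \<noteq> y" for x y using assms that by (auto dest: injD)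
  have desc: "desc_le w i j \<longleftrightarrow> (\<forall>k\<in>{min i j..max i j} - {j}. w k < w j)" if "i \<noteq> j"
  proof
    assume d: "desc_le w i j"
    show "\<forall>k\<in>{min i j..max i j} - {j}. w k < w j"
    proof
      fix k assume k: "k \<in> {min i j..max i j} - {j}"
      have "w i \<le> w j" using d by (simp add: desc_le_def)
      have "w k \<le> w j"
      proof (cases "k = i")
        case False
        then have "min i j < k" "k < max i j" using k by (auto simp: min_def max_def split: if_splits)
        then have "\<not> w k > max (w i) (w j)" using d unfolding desc_le_def by blast
        then show ?thesis using \<open>w i \<le> w j\<close> by simp
      qed (use \<open>w i \<le> w j\<close> in simp)
      then show "w k < w j" using neq[of k j] k by auto
    qed
  next
    assume *: "\<forall>k\<in>{min i j..max i j} - {j}. w k < w j"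
    then have "w i < w j" using that by auto
    moreover have "\<not> w k > max (w i) (w j)" if "min i j < k" "k < max i j" for k
    proof -
      have "k \<in> {min i j..max i j} - {j}" using that by auto
      then have "w k < w j" using * by blast
      then show ?thesis by simp
    qed
    ultimately show "desc_le w i j" unfolding desc_le_def by auto
  qed
  consider "i < j" | "j < i" | "i = j" by linarith
  then show ?thesis
  proof cases
    case 1
    then have "desc_le w i j \<longleftrightarrow> (\<forall>k. i \<le> k \<and> k < j \<longrightarrow> w k < w j)"
      unfolding desc[OF less_imp_neq[OF 1]] by auto
    also have "\<dots> \<longleftrightarrow> (\<forall>k. i \<le> k \<and> k < j \<longrightarrow> \<not> after w k j)"
    proof
      assume "\<forall>k. i \<le> k \<and> k < j \<longrightarrow> w k < w j"
      then show "\<forall>k. i \<le> k \<and> k < j \<longrightarrow> \<not> after w k j" by (force simp: after_def)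
    next
      assume *: "\<forall>k. i \<le> k \<and> k < j \<longrightarrow> \<not> after w k j"
      show "\<forall>k. i \<le> k \<and> k < j \<longrightarrow> w k < w j"
      proof (rule ccontr)
        assume "\<not> (\<forall>k. i \<le> k \<and> k < j \<longrightarrow> w k < w j)"
        then obtain k where k: "i \<le> k" "k \<le> j - 1" "\<not> w k < w j" by auto
        obtain s where s: "\<not> w s < w j" "s \<le> j - 1" "\<And>z. \<not> w z < w j \<Longrightarrow> z \<le> j - 1 \<Longrightarrow> z \<le> s"
          using greatest_int[of "\<lambda>k. \<not> w k < w j" k "j - 1"] k by blast
        have "i \<le> s" using s(3)[of k] k by simp
        have "w j < w s" using s(1,2) neq[of s j] by auto
        moreover have "w l < w j" if "s < l" "l < j" for l using s(3)[of l] that by force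
        ultimately have "after w s j" using s(2) unfolding after_def by (metis le_less less_trans zle_diff1_eq)
        then show False using * \<open>i \<le> s\<close> s(2) by auto
      qed
    qed
    finally show ?thesis using 1 by simp
  next
    case 2
    then have "{min i j..max i j} - {j} = {j<..i}" by auto
    then have "desc_le w i j \<longleftrightarrow> after w j i"
      using 2 unfolding desc[OF 2[THEN less_imp_neq, symmetric]] after_def by auto
    then show ?thesis using 2 by simp
  next
    case 3
    then show ?thesis by (simp add: desc_le_def)
  qed
qed

lemma desc_le_eq_iff:
  assumes "inj v" "inj w"
  shows "desc_le v = desc_le w \<longleftrightarrow> after v = after w"
proof
  assume eq: "desc_le v = desc_le w"
  have "after u i j \<longleftrightarrow> i < j \<and> desc_le u j i" if "inj u" for u i j
    unfolding desc_le_after[OF that] by (auto simp: after_def)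
  then show "after v = after w" using assms eq by (intro ext) simp
next
  assume "after v = after w"
  then show "desc_le v = desc_le w"
    by (intro ext) (simp only: desc_le_after[OF assms(1)] desc_le_after[OF assms(2)])
qed

lemma after_trans: "after w i j \<Longrightarrow> after w j k \<Longrightarrow> after w i k"
  unfolding after_def by (metis less_trans not_le order_refl)

lemma after_mid: "after w i k \<Longrightarrow> i < j \<Longrightarrow> j \<le> k \<Longrightarrow> after w i j"
  unfolding after_def by auto

lemma after_less: "after w i j \<Longrightarrow> i < j"
  by (simp add: after_def)

lemma before_trans:
  assumes "before w x y" "before w y z"
  shows "before w x z"
proof -
  have "x \<noteq> y" "y \<noteq> z" using assms by (auto simp: before_def)
  have "x \<noteq> z" using assms by (auto simp: before_def)
  then consider "x < y" "y < z" | "x < z" "z < y" | "y < x" "x < z" | "y < z" "z < x"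
    | "z < x" "x < y" | "z < y" "y < x"
    using \<open>x \<noteq> y\<close> \<open>y \<noteq> z\<close> by linarith
  then show ?thesis
    using assms after_trans[of w] after_mid[of w] unfolding before_def
    by cases (metis less_imp_le less_asym less_trans)+
qed

lemma before_total: "x \<noteq> y \<Longrightarrow> before w x y \<or> before w y x"
  by (auto simp: before_def)

lemma before_irrefl: "\<not> before w x x"
  by (simp add: before_def)

lemma before_asym: "before w x y \<Longrightarrow> \<not> before w y x"
  using before_trans before_irrefl by blast

text \<open>The larger value at \<open>m\<close> keeps \<open>r\<close> out of the right subtree of
  \<open>x\<close>.\<close>

lemma before_across: "x < m \<Longrightarrow> m \<le> r \<Longrightarrow> w x < w m \<Longrightarrow> before w x r"
  unfolding before_def after_def by (meson less_asym less_le_trans)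

lemma before_last: "m < x \<Longrightarrow> (\<And>k. m < k \<Longrightarrow> k \<le> x \<Longrightarrow> w k < w m) \<Longrightarrow> before w x m"
  by (simp add: before_def after_def)

lemma after_periodic:
  assumes "periodic n w"
  shows "after w (i + int n) (j + int n) \<longleftrightarrow> after w i j"
proof -
  have w: "w (x + int n) = w x + int n" for x using assms by (simp add: periodic_def)
  have shift: "(\<forall>k. Q k) \<longleftrightarrow> (\<forall>k. Q (k + int n))" for Q :: "int \<Rightarrow> bool"
    by (metis diff_add_cancel)
  show ?thesis unfolding after_def by (subst shift) (simp add: w)
qed

text \<open>Postorder is a periodic linear order. At large distance values increase with position,
  so there it agrees with the order of positions.\<close>

lemma postorder_perm:
  assumes n: "n > 0" and w: "w \<in> affine_perms n"
  obtains p where "p \<in> affine_perms n" "\<And>i j. p i < p j \<longleftrightarrow> before w i j"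
proof -
  obtain B where B: "B > 0" "\<And>i j. i + B \<le> j \<Longrightarrow> w i < w j"
    using affine_perm_bound[OF n w] by blast
  have far: "before w i j" if "i + B \<le> j" for i j
  proof -
    have "w i < w j" by (rule B(2)[OF that])
    moreover have "i < j" using that B(1) by simp
    ultimately show ?thesis by (auto simp: before_def after_def)
  qed
  show ?thesis
  proof (rule affine_perm_of_order[OF n, of "before w" B])
    show "before w (i + int n) (j + int n) \<longleftrightarrow> before w i j" for i j
      using after_periodic[OF affine_permsD(3)[OF w]] by (simp add: before_def)
    show "before w i k" if "before w i j" "before w j k" for i j k
      using that by (rule before_trans)
  qed (use that B(1) before_irrefl before_total far in blast)+
qed

section \<open>Minimal elements of the sylvester classes\<close>

lemma syl_class_iff:
  assumes "w \<in> affine_perms n"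
  shows "v \<in> syl_class n w \<longleftrightarrow> v \<in> affine_perms n \<and> after v = after w"
  using desc_le_eq_iff affine_permsD(2) assms by (auto simp: syl_class_def)

text \<open>The length of \<open>p \<circ> inv v\<close> is a difference of inversion numbers that
  the inclusion makes nonpositive, so this product is the identity. The case \<open>n = 1\<close> is
  separate because lengths are counted by inversions for \<open>n \<ge> 2\<close> only.\<close>

lemma left_weak_le_inversions:
  assumes "n > 0" "v \<in> affine_perms n" "p \<in> affine_perms n" "left_weak_le n v p"
    "inversions n p \<subseteq> inversions n v"
  shows "v = p"
proof (cases "n = 1")
  case True
  then show ?thesis using assms(2,3) affine_perms_1 by auto
next
  case False
  then have n2: "n \<ge> 2" using assms(1) by simp
  have pv: "p \<circ> inv v \<in> affine_perms n" using assms by (intro affine_perms_comp affine_perms_inv)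
  have "card (inversions n p) \<le> card (inversions n v)"
    using assms finite_inversions by (intro card_mono)
  then have "card (inversions n (p \<circ> inv v)) = 0"
    using assms(4) unfolding left_weak_le_def by (simp only: cox_length_eq_inversions[OF n2] pv assms)
  then have "inversions n (p \<circ> inv v) = {}" using finite_inversions[OF assms(1) pv] by simp
  then have "p \<circ> inv v = id" by (rule no_inversions_id[OF assms(1) pv])
  then have "p (inv v (v x)) = v x" for x by (metis comp_apply id_apply)
  then show ?thesis using affine_permsD(2)[OF assms(2)] by (intro ext) simp
qed

text \<open>The only comparison that changes is that of \<open>a\<close> and \<open>b\<close>, up to
  translation. No relation \<open>after u x y\<close> relies on it, since such a relation would
  imply \<open>after u a b\<close>.\<close>

lemma after_simple_gen:
  assumes n: "n \<ge> 2" and u: "u \<in> affine_perms n" and ab: "u a = int i + 1" "u b = int i" "a < b"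
    and not_after: "\<not> after u a b"
  shows "after (simple_gen n i \<circ> u) = after u"
proof (intro ext)
  fix x y
  note iff = inversions_simple_gen(2)[OF n u ab]
  show "after (simple_gen n i \<circ> u) x y \<longleftrightarrow> after u x y"
  proof
    assume "after (simple_gen n i \<circ> u) x y"
    then show "after u x y" using iff by (auto simp: after_def)
  next
    assume xy: "after u x y"
    have "simple_gen n i (u k) < simple_gen n i (u x)" if k: "x < k" "k \<le> y" for k
    proof -
      have "\<nexists>m. x = a + m * int n \<and> k = b + m * int n"
      proof
        assume "\<exists>m. x = a + m * int n \<and> k = b + m * int n"
        then obtain m where m: "x = a + m * int n" "k = b + m * int n" by blast
        have "after u x k" using after_mid[OF xy] k by simp
        then have "after u a b"
        proof -
          have *: "u (z + m * int n) = u z + m * int n" for z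
            by (rule periodic_shift[OF affine_permsD(3)[OF u]])
          show ?thesis unfolding after_def
          proof (intro conjI allI impI)
            fix l assume "a < l \<and> l \<le> b"
            then have "u (l + m * int n) < u (a + m * int n)"
              using \<open>after u x k\<close> unfolding m after_def by simp
            then show "u l < u a" by (simp add: *)
          qed (rule ab(3))
        qed
        then show False using not_after by blast
      qed
      then show ?thesis using iff[OF k(1)] xy k by (simp add: after_def)
    qed
    then show "after (simple_gen n i \<circ> u) x y" using xy by (simp add: after_def)
  qed
qed

text \<open>The inversions of \<open>p\<close> are the pairs \<open>i < j\<close> with
  \<open>after w i j\<close>, and every member of the class has these inversions; hence
  \<open>p\<close> is minimal. Any other member \<open>u\<close> has neighbouring values in inverted
  order that \<open>p\<close> does not invert. Exchanging them stays in the class and goes down, so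
  \<open>u\<close> is not minimal.\<close>

lemma pi_down_eq:
  assumes n: "n > 0" and w: "w \<in> affine_perms n" and p: "p \<in> affine_perms n"
    and post: "\<And>i j. p i < p j \<longleftrightarrow> before w i j"
  shows "pi_down n w = p"
  unfolding pi_down_def
proof (rule the_equality)
  have inv_p: "p j < p i \<longleftrightarrow> after w i j" if "i < j" for i j
    using that post[of j i] by (auto simp: before_def)
  have "after p = after w"
  proof (intro ext)
    fix i j
    have "after p i j \<longleftrightarrow> i < j \<and> (\<forall>k. i < k \<and> k \<le> j \<longrightarrow> after w i k)"
      using inv_p by (auto simp: after_def)
    then show "after p i j \<longleftrightarrow> after w i j" using after_mid after_less by blast
  qed
  then have pc: "p \<in> syl_class n w" using syl_class_iff[OF w] p by simp
  have min: "v = p" if v: "v \<in> syl_class n w" "left_weak_le n v p" for v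
  proof (rule left_weak_le_inversions[OF n _ p v(2)])
    show "v \<in> affine_perms n" using v syl_class_iff[OF w] by simp
    have "after v = after w" using v syl_class_iff[OF w] by simp
    then have "v j < v i" if "i < j" "p j < p i" for i j
      using inv_p[OF that(1)] that(2) after_less by (metis after_def order_refl)
    then show "inversions n p \<subseteq> inversions n v" by (auto simp: inversions_def)
  qed
  show "p \<in> syl_class n w \<and> (\<forall>v\<in>syl_class n w. left_weak_le n v p \<longrightarrow> v = p)"
    using pc min by blast
  fix u assume u: "u \<in> syl_class n w \<and> (\<forall>v\<in>syl_class n w. left_weak_le n v u \<longrightarrow> v = u)"
  then have uA: "u \<in> affine_perms n" and ua: "after u = after w" using syl_class_iff[OF w] by auto
  show "u = p"
  proof (rule ccontr)
    assume "u \<noteq> p"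
    have "n \<noteq> 1"
    proof
      assume "n = 1"
      then show False using \<open>u \<noteq> p\<close> uA p affine_perms_1 by auto
    qed
    then have n2: "n \<ge> 2" using n by simp
    obtain i where i: "i \<in> {1..n}" "p (inv u (int i + 1)) < p (inv u (int i))"
      by (rule exists_descent[OF n uA p \<open>u \<noteq> p\<close>])
    define a b where "a = inv u (int i + 1)" and "b = inv u (int i)"
    have uab: "u a = int i + 1" "u b = int i"
      using affine_permsD(1)[OF uA] by (simp_all add: a_def b_def bij_is_surj surj_f_inv_f)
    then have "a \<noteq> b" by auto
    have pab: "p a < p b" using i(2) by (simp add: a_def b_def)
    have "a < b"
    proof (rule ccontr)
      assume "\<not> a < b"
      then have "after w b a" using inv_p[of b a] pab \<open>a \<noteq> b\<close> by simp
      then have "u a < u b" unfolding ua[symmetric] by (simp add: after_def)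
      then show False using uab by simp
    qed
    then have na: "\<not> after u a b" using inv_p[of a b] pab ua by simp
    define v where "v = simple_gen n i \<circ> u"
    have vA: "v \<in> affine_perms n"
      unfolding v_def by (intro affine_perms_comp n simple_gen_affine_perm n2 uA)
    have "after v = after w"
      unfolding v_def using after_simple_gen[OF n2 uA uab \<open>a < b\<close> na] ua by simp
    then have vc: "v \<in> syl_class n w" using syl_class_iff[OF w] vA by simp
    have s: "simple_gen n i \<in> affine_perms n" by (rule simple_gen_affine_perm[OF n2])
    have "u \<circ> inv v = simple_gen n i"
    proof
      fix x
      have "v (inv v x) = x" using affine_permsD(1)[OF vA] by (simp add: bij_is_surj surj_f_inv_f)
      moreover have "v y = simple_gen n i (u y)" for y by (simp add: v_def)
      ultimately have "simple_gen n i (u (inv v x)) = x" by simp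
      then show "(u \<circ> inv v) x = simple_gen n i x" using simple_gen_invol[OF n2] by (metis comp_apply)
    qed
    moreover have "card (inversions n (simple_gen n i)) = 1"
    proof -
      have "simple_gen n i \<circ> simple_gen n i = id" using simple_gen_invol[OF n2] by (auto simp: fun_eq_iff)
      then show ?thesis
        using inversions_simple_gen(1)[OF n2 s, of "int i" i "int i + 1"] simple_gen_eq(1,2)[OF n2, of i 0]
        by (simp add: inversions_id)
    qed
    moreover have "card (inversions n u) = card (inversions n v) + 1"
      unfolding v_def by (rule inversions_simple_gen(1)[OF n2 uA uab \<open>a < b\<close>])
    ultimately have "left_weak_le n v u"
      unfolding left_weak_le_def using cox_length_eq_inversions[OF n2] s uA vA by simp
    then have "v = u" using u vc by blast
    then have "simple_gen n i (u a) = u a" by (metis comp_apply v_def)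
    then show False using uab simple_gen_eq(2)[OF n2, of i 0] by simp
  qed
qed

text \<open>A pattern 231 in the values of \<open>w\<close> read in postorder.\<close>

definition bad :: "(int \<Rightarrow> int) \<Rightarrow> int \<Rightarrow> int \<Rightarrow> int \<Rightarrow> bool" where
  "bad w x y z \<longleftrightarrow> before w x y \<and> before w y z \<and> w z < w x \<and> w x < w y"

definition good :: "(int \<Rightarrow> int) \<Rightarrow> int set \<Rightarrow> bool" where
  "good w S \<longleftrightarrow> (\<forall>x\<in>S. \<forall>y\<in>S. \<forall>z\<in>S. \<not> bad w x y z)"

text \<open>The image is the identity iff \<open>v\<close> is its own postorder permutation, that
  is, iff every inversion \<open>i < j\<close> puts \<open>j\<close> into the right subtree of
  \<open>i\<close>. What prevents this is a larger value in between, which completes a pattern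
  231.\<close>

lemma stack_sort_eq_id_iff:
  assumes n: "n > 0" and v: "v \<in> affine_perms n"
  shows "stack_sort n v = id \<longleftrightarrow> (\<forall>x y z. x < y \<and> y < z \<longrightarrow> \<not> (v z < v x \<and> v x < v y))"
proof -
  obtain p where p: "p \<in> affine_perms n" "\<And>i j. p i < p j \<longleftrightarrow> before v i j"
    using postorder_perm[OF n v] by blast
  have pinv: "inv p (p x) = x" "p (inv p x) = x" for x
    using affine_permsD[OF p(1)] by (simp_all add: bij_is_surj surj_f_inv_f)
  have neq: "v x \<noteq> v y" if "x \<noteq> y" for x y using affine_permsD(2)[OF v] that by (auto dest: injD)
  have "stack_sort n v = v \<circ> inv p" unfolding stack_sort_def pi_down_eq[OF n v p] ..
  then have "stack_sort n v = id \<longleftrightarrow> v = p" using pinv by (metis comp_apply ext id_apply)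
  also have "v = p \<longleftrightarrow> (\<forall>x y z. x < y \<and> y < z \<longrightarrow> \<not> (v z < v x \<and> v x < v y))"
  proof
    assume eq: "v = p"
    show "\<forall>x y z. x < y \<and> y < z \<longrightarrow> \<not> (v z < v x \<and> v x < v y)"
    proof (intro allI impI notI)
      fix x y z assume xyz: "x < y \<and> y < z" "v z < v x \<and> v x < v y"
      then have "before v z x" using p(2) eq by simp
      then have "after v x z" using xyz(1) by (auto simp: before_def)
      then show False using xyz by (auto simp: after_def dest!: spec[of _ y])
    qed
  next
    assume no: "\<forall>x y z. x < y \<and> y < z \<longrightarrow> \<not> (v z < v x \<and> v x < v y)"
    have after: "after v i j" if "i < j" "v j < v i" for i j
      unfolding after_def
    proof (intro conjI allI impI)
      fix k assume k: "i < k \<and> k \<le> j"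
      show "v k < v i"
      proof (cases "k = j")
        case False
        then have "\<not> v i < v k" using no[rule_format, of i k j] k that by simp
        then show ?thesis using neq[of k i] k by simp
      qed (use that in simp)
    qed (rule that)
    show "v = p"
    proof (rule affine_perm_eqI[OF n v p(1)])
      fix i j assume "p i < p j"
      then consider "i < j" "\<not> after v i j" | "j < i" "after v j i" using p(2) by (auto simp: before_def)
      then show "v i < v j"
      proof cases
        case 1
        then show ?thesis using after[of i j] neq[of i j] by force
      next
        case 2
        then show ?thesis by (simp add: after_def)
      qed
    qed
  qed
  finally show ?thesis .
qed

theorem two_stack_sortable_iff_good:
  assumes n: "n > 0"
  shows "two_stack_sortable n = {w \<in> affine_perms n. good w UNIV}"
proof -
  have "(stack_sort n ^^ 2) w = id \<longleftrightarrow> good w UNIV" if w: "w \<in> affine_perms n" for w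
  proof -
    obtain p where p: "p \<in> affine_perms n" "\<And>i j. p i < p j \<longleftrightarrow> before w i j"
      using postorder_perm[OF n w] by blast
    have pinv: "inv p (p x) = x" "p (inv p x) = x" for x
      using affine_permsD[OF p(1)] by (simp_all add: bij_is_surj surj_f_inv_f)
    have s: "stack_sort n w = w \<circ> inv p" unfolding stack_sort_def pi_down_eq[OF n w p] ..
    have sA: "w \<circ> inv p \<in> affine_perms n" by (intro affine_perms_comp affine_perms_inv n w p)
    have "(stack_sort n ^^ 2) w = stack_sort n (w \<circ> inv p)" by (simp add: numeral_2_eq_2 s[symmetric])
    then have "(stack_sort n ^^ 2) w = id \<longleftrightarrow>
       (\<forall>x y z. x < y \<and> y < z \<longrightarrow> \<not> (w (inv p z) < w (inv p x) \<and> w (inv p x) < w (inv p y)))"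
      using stack_sort_eq_id_iff[OF n sA] by (simp add: comp_def)
    also have "\<dots> \<longleftrightarrow> (\<forall>a b c. p a < p b \<and> p b < p c \<longrightarrow> \<not> (w c < w a \<and> w a < w b))"
      by (metis pinv)
    also have "\<dots> \<longleftrightarrow> good w UNIV" by (auto simp: good_def bad_def p(2))
    finally show ?thesis .
  qed
  then show ?thesis by (auto simp: two_stack_sortable_def)
qed

section \<open>Tree permutations\<close>

text \<open>The maximum of the left part is lifted above the \<open>k\<close> smallest values of the
  right part. If the left part is empty, validity gives \<open>k = 0\<close>, so the branches with
  the truncated \<open>nodes L - 1\<close> are not reached.\<close>

fun tree_perm :: "tree \<Rightarrow> nat \<Rightarrow> nat" where
  "tree_perm Leaf x = 0"
| "tree_perm (Node L k R) x =
     (if x < nodes L then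
        (if tree_perm L x = nodes L - 1 then nodes L - 1 + k else tree_perm L x)
      else if x = nodes L then nodes L + nodes R
      else if tree_perm R (x - nodes L - 1) < k then nodes L - 1 + tree_perm R (x - nodes L - 1)
      else nodes L + tree_perm R (x - nodes L - 1))"

lemma valid_NodeD:
  assumes "valid (Node L k R)"
  shows "valid L" "valid R" "k \<in> cuts R" "k \<le> nodes R" "nodes L = 0 \<Longrightarrow> k = 0"
  using assms cuts_le by auto

lemma tree_perm_less: "valid T \<Longrightarrow> x < nodes T \<Longrightarrow> tree_perm T x < nodes T"
proof (induction T arbitrary: x)
  case (Node L k R)
  note v = valid_NodeD[OF Node.prems(1)]
  consider "x < nodes L" | "x = nodes L" | "x > nodes L" by linarith
  then show ?case
  proof cases
    case 1
    then show ?thesis using Node.IH(1)[OF v(1) 1] v(4) by auto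
  next
    case 3
    then have "x - nodes L - 1 < nodes R" using Node.prems(2) by simp
    from Node.IH(2)[OF v(2) this] show ?thesis using 3 by auto
  qed simp
qed simp

lemma tree_perm_inj: "valid T \<Longrightarrow> inj_on (tree_perm T) {..<nodes T}"
proof (induction T)
  case (Node L k R)
  note v = valid_NodeD[OF Node.prems]
  have iL: "x = y" if "tree_perm L x = tree_perm L y" "x < nodes L" "y < nodes L" for x y
    using Node.IH(1)[OF v(1)] that by (auto dest: inj_onD)
  have iR: "x = y" if "tree_perm R x = tree_perm R y" "x < nodes R" "y < nodes R" for x y
    using Node.IH(2)[OF v(2)] that by (auto dest: inj_onD)
  have wlog: "x = y" if le: "x \<le> y" and y: "y < nodes (Node L k R)"
    and eq: "tree_perm (Node L k R) x = tree_perm (Node L k R) y" for x y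
  proof -
    consider "y < nodes L" | "x < nodes L" "y = nodes L" | "x < nodes L" "y > nodes L"
      | "x = nodes L" "y = nodes L" | "x = nodes L" "y > nodes L" | "x > nodes L"
      using le by linarith
    then show ?thesis
    proof cases
      case 1
      then have "x < nodes L" using le by simp
      moreover have "tree_perm L x < nodes L" "tree_perm L y < nodes L"
        using tree_perm_less[OF v(1)] 1 calculation by auto
      ultimately have "tree_perm L x = tree_perm L y" using eq 1 by (simp split: if_splits)
      then show ?thesis using iL 1 \<open>x < nodes L\<close> by blast
    next
      case 2
      then show ?thesis using eq tree_perm_less[OF v(1), of x] v(4) by (simp split: if_splits)
    next
      case 3
      then show ?thesis using eq tree_perm_less[OF v(1), of x] by (simp split: if_splits)
    next
      case 5
      then have "y - nodes L - 1 < nodes R" using y by simp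
      then show ?thesis using eq 5 tree_perm_less[OF v(2), of "y - nodes L - 1"] by (simp split: if_splits)
    next
      case 6
      then have xy: "x - nodes L - 1 < nodes R" "y - nodes L - 1 < nodes R" "y > nodes L" using y le by auto
      have "nodes L > 0 \<or> k = 0" using v(5) by blast
      then have "tree_perm R (x - nodes L - 1) = tree_perm R (y - nodes L - 1)"
        using eq 6 xy(3) by (auto split: if_splits)
      then have "x - nodes L - 1 = y - nodes L - 1" using iR xy by blast
      then show ?thesis using 6 xy(3) by linarith
    qed simp
  qed
  show ?case
  proof (rule inj_onI)
    fix x y assume "x \<in> {..<nodes (Node L k R)}" "y \<in> {..<nodes (Node L k R)}"
      "tree_perm (Node L k R) x = tree_perm (Node L k R) y"
    then show "x = y" using wlog[of x y] wlog[of y x] by (cases "x \<le> y") (auto simp del: tree_perm.simps)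
  qed
qed simp

lemma tree_perm_bij: "valid T \<Longrightarrow> bij_betw (tree_perm T) {..<nodes T} {..<nodes T}"
  using tree_perm_inj[of T] tree_perm_less[of T]
  by (simp add: bij_betw_def) (intro endo_inj_surj, auto)

section \<open>Order patterns on segments\<close>

definition seg :: "int \<Rightarrow> tree \<Rightarrow> int set" where
  "seg a T = {a..<a + int (nodes T)}"

lemma card_tree_perm_less:
  assumes "valid R" "k \<le> nodes R"
  shows "card {y \<in> seg a R. tree_perm R (nat (y - a)) < k} = k"
proof -
  have "bij_betw (\<lambda>i. a + int i) {i. i < nodes R \<and> tree_perm R i < k}
     {y \<in> seg a R. tree_perm R (nat (y - a)) < k}"
    by (rule bij_betw_byWitness[where f' = "\<lambda>y. nat (y - a)"]) (auto simp: seg_def)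
  then have "card {y \<in> seg a R. tree_perm R (nat (y - a)) < k} = card {i. i < nodes R \<and> tree_perm R i < k}"
    by (rule bij_betw_same_card[symmetric])
  moreover have "bij_betw (tree_perm R) {i. i < nodes R \<and> tree_perm R i < k} {..<k}"
  proof (rule bij_betw_subset[OF tree_perm_bij[OF assms(1)]])
    show "tree_perm R ` {i. i < nodes R \<and> tree_perm R i < k} = {..<k}"
    proof (intro equalityI subsetI)
      fix j assume "j \<in> {..<k}"
      then have "j \<in> tree_perm R ` {..<nodes R}"
        using tree_perm_bij[OF assms(1)] assms(2) by (simp add: bij_betw_def)
      then show "j \<in> tree_perm R ` {i. i < nodes R \<and> tree_perm R i < k}" using \<open>j \<in> {..<k}\<close> by auto
    qed auto
  qed auto
  ultimately show ?thesis using bij_betw_same_card by fastforce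
qed

text \<open>Two value types, because integer values are compared with the natural numbers of
  \<open>tree_perm\<close>.\<close>

definition same_order :: "(int \<Rightarrow> 'a :: linorder) \<Rightarrow> (int \<Rightarrow> 'b :: linorder) \<Rightarrow> int set \<Rightarrow> bool" where
  "same_order w q S \<longleftrightarrow> (\<forall>x\<in>S. \<forall>y\<in>S. w x < w y \<longleftrightarrow> q x < q y)"

lemma same_order_sym: "same_order w q S \<Longrightarrow> same_order q w S"
  by (simp add: same_order_def)

lemma same_order_trans: "same_order w q S \<Longrightarrow> same_order q r S \<Longrightarrow> same_order w r S"
  by (simp add: same_order_def)

lemma same_order_subset: "same_order w q S \<Longrightarrow> T \<subseteq> S \<Longrightarrow> same_order w q T"
  by (auto simp: same_order_def)

text \<open>Only the maximum of \<open>A\<close>, the values to the left of a node, may exceed some of the values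
  on \<open>B\<close>, to the right of the node, and it exceeds \<open>k\<close> of them.\<close>

definition interlaced :: "(int \<Rightarrow> 'a :: linorder) \<Rightarrow> int set \<Rightarrow> int set \<Rightarrow> nat \<Rightarrow> bool" where
  "interlaced w A B k \<longleftrightarrow> (\<forall>x\<in>A. \<forall>y\<in>B. w y < w x \<longrightarrow> (\<forall>z\<in>A. w z \<le> w x)) \<and>
     card {y\<in>B. \<exists>x\<in>A. w y < w x} = k"

lemma interlaced_same_order:
  assumes "same_order w q (A \<union> B)" "interlaced q A B k"
  shows "interlaced w A B k"
proof -
  have lt: "w x < w y \<longleftrightarrow> q x < q y" if "x \<in> A \<union> B" "y \<in> A \<union> B" for x y
    using assms(1) that unfolding same_order_def by blast
  then have le: "w x \<le> w y \<longleftrightarrow> q x \<le> q y" if "x \<in> A \<union> B" "y \<in> A \<union> B" for x y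
    using that by (meson not_le)
  have "{y\<in>B. \<exists>x\<in>A. w y < w x} = {y\<in>B. \<exists>x\<in>A. q y < q x}" using lt by auto
  then show ?thesis using assms(2) unfolding interlaced_def
    by (auto simp: lt le)
qed

text \<open>Down-sets of a finite chain are comparable by inclusion, so their size determines
  them.\<close>

lemma downsets_eq:
  fixes w :: "int \<Rightarrow> 'a :: linorder" and q :: "int \<Rightarrow> 'b :: linorder"
  assumes "finite B" "same_order w q B" "D \<subseteq> B" "D' \<subseteq> B" "card D = card D'"
    and "\<And>x y. x \<in> D \<Longrightarrow> y \<in> B \<Longrightarrow> w y \<le> w x \<Longrightarrow> y \<in> D"
    and "\<And>x y. x \<in> D' \<Longrightarrow> y \<in> B \<Longrightarrow> q y \<le> q x \<Longrightarrow> y \<in> D'"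
  shows "D = D'"
proof -
  have fin: "finite D" "finite D'" using assms(1,3,4) finite_subset by blast+
  have le: "w x \<le> w y \<longleftrightarrow> q x \<le> q y" if "x \<in> B" "y \<in> B" for x y
    using assms(2) that unfolding same_order_def by (meson not_le)
  have "D \<subseteq> D' \<or> D' \<subseteq> D"
  proof (rule ccontr)
    assume "\<not> (D \<subseteq> D' \<or> D' \<subseteq> D)"
    then obtain x y where xy: "x \<in> D" "x \<notin> D'" "y \<in> D'" "y \<notin> D" by blast
    then have "x \<in> B" "y \<in> B" using assms(3,4) by auto
    then have "\<not> w y \<le> w x" "\<not> q x \<le> q y" using assms(6,7) xy by blast+
    then show False using le[OF \<open>y \<in> B\<close> \<open>x \<in> B\<close>] by (meson linear)
  qed
  then show ?thesis using fin assms(5) by (metis card_subset_eq)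
qed

text \<open>The label fixes every comparison between \<open>A\<close> and \<open>B\<close>:
  \<open>y\<close> is below \<open>x\<close> iff \<open>x\<close> is the maximum of \<open>A\<close>
  and \<open>y\<close> is among the \<open>k\<close> smallest of \<open>B\<close>. \<open>A\<close>
  may be infinite, as the half-line before an affine block requires.\<close>

lemma interlaced_cross:
  fixes w :: "int \<Rightarrow> 'a :: linorder" and q :: "int \<Rightarrow> 'b :: linorder"
  assumes "finite B" "same_order w q B" "interlaced w A B k" "interlaced q A B k"
    and "\<And>x. x \<in> A \<Longrightarrow> (\<forall>z\<in>A. w z \<le> w x) \<longleftrightarrow> (\<forall>z\<in>A. q z \<le> q x)"
    and "x \<in> A" "y \<in> B"
  shows "w y < w x \<longleftrightarrow> q y < q x"
proof -
  define D where "D = {y\<in>B. \<exists>x\<in>A. w y < w x}"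
  define D' where "D' = {y\<in>B. \<exists>x\<in>A. q y < q x}"
  have "D = D'"
    using assms(3,4) unfolding interlaced_def
    by (intro downsets_eq[OF assms(1,2)]) (auto simp: D_def D'_def intro: le_less_trans)
  have "w y < w x \<longleftrightarrow> (\<forall>z\<in>A. w z \<le> w x) \<and> y \<in> D"
    using assms(3,6,7) unfolding interlaced_def D_def by (auto intro: less_le_trans)
  also have "\<dots> \<longleftrightarrow> (\<forall>z\<in>A. q z \<le> q x) \<and> y \<in> D'" using assms(5,6) \<open>D = D'\<close> by simp
  also have "\<dots> \<longleftrightarrow> q y < q x"
    using assms(4,6,7) unfolding interlaced_def D'_def by (auto intro: less_le_trans)
  finally show ?thesis .
qed

lemma same_order_glue:
  fixes w :: "int \<Rightarrow> 'a :: linorder" and q :: "int \<Rightarrow> 'b :: linorder"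
  assumes "finite B" "same_order w q A" "same_order w q B" "interlaced w A B k" "interlaced q A B k"
    and "\<And>x. x \<in> A \<union> B \<Longrightarrow> w x < w m" "\<And>x. x \<in> A \<union> B \<Longrightarrow> q x < q m"
    and "inj_on w (A \<union> B)" "inj_on q (A \<union> B)" "A \<inter> B = {}"
  shows "same_order w q (A \<union> {m} \<union> B)"
proof -
  have le: "w x \<le> w y \<longleftrightarrow> q x \<le> q y" if "x \<in> A" "y \<in> A" for x y
    using assms(2) that unfolding same_order_def by (meson not_le)
  have "(\<forall>z\<in>A. w z \<le> w x) \<longleftrightarrow> (\<forall>z\<in>A. q z \<le> q x)" if "x \<in> A" for x
    using le that by blast
  then have cross: "w y < w x \<longleftrightarrow> q y < q x" if "x \<in> A" "y \<in> B" for x y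
    using interlaced_cross[OF assms(1,3,4,5)] that by blast
  have cross': "w x < w y \<longleftrightarrow> q x < q y" if "x \<in> A" "y \<in> B" for x y
  proof -
    have "x \<noteq> y" using that assms(10) by auto
    then have "w x \<noteq> w y" "q x \<noteq> q y" using assms(8,9) that by (auto dest: inj_onD)
    then show ?thesis using cross[OF that] by (meson less_asym linorder_neqE)
  qed
  have m: "\<not> w m < w x" "\<not> q m < q x" "w x < w m \<longleftrightarrow> x \<noteq> m" "q x < q m \<longleftrightarrow> x \<noteq> m"
    if "x \<in> A \<union> {m} \<union> B" for x
    using that assms(6,7) by (auto dest: less_asym)
  show ?thesis
    unfolding same_order_def
  proof (intro ballI)
    fix x y assume x: "x \<in> A \<union> {m} \<union> B" and y: "y \<in> A \<union> {m} \<union> B"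
    show "w x < w y \<longleftrightarrow> q x < q y"
    proof (cases "x = m \<or> y = m")
      case True
      then show ?thesis using m x y by metis
    next
      case False
      then consider "x \<in> A" "y \<in> A" | "x \<in> A" "y \<in> B" | "x \<in> B" "y \<in> A" | "x \<in> B" "y \<in> B"
        using x y by blast
      then show ?thesis using assms(2,3) cross cross' unfolding same_order_def by cases blast+
    qed
  qed
qed

definition realizes :: "(int \<Rightarrow> int) \<Rightarrow> int \<Rightarrow> tree \<Rightarrow> bool" where
  "realizes w a T \<longleftrightarrow> same_order w (\<lambda>x. tree_perm T (nat (x - a))) (seg a T)"

lemma finite_seg [simp]: "finite (seg a T)"
  by (simp add: seg_def)

lemma seg_Node:
  "seg a (Node L k R) = seg a L \<union> {a + int (nodes L)} \<union> seg (a + int (nodes L) + 1) R"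
  by (auto simp: seg_def)

lemma shift_last:
  fixes i j k l :: nat
  assumes "i < l"
  shows "j < l \<Longrightarrow> (if i = l - 1 then l - 1 + k else i) < (if j = l - 1 then l - 1 + k else j) \<longleftrightarrow> i < j"
    and "(if i = l - 1 then l - 1 + k else i) \<le> l - 1 + k"
  using assms by (cases l; auto)+

lemma tree_perm_Node_order:
  fixes a :: int and L R :: tree
  assumes v: "valid (Node L k R)"
  defines "q \<equiv> \<lambda>x. tree_perm (Node L k R) (nat (x - a))"
    and "m \<equiv> a + int (nodes L)"
  shows "same_order q (\<lambda>x. tree_perm L (nat (x - a))) (seg a L)"
    and "same_order q (\<lambda>x. tree_perm R (nat (x - (m + 1)))) (seg (m + 1) R)"
    and "\<And>x. x \<in> seg a L \<union> seg (m + 1) R \<Longrightarrow> q x < q m"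
    and "interlaced q (seg a L) (seg (m + 1) R) k"
    and "inj_on q (seg a (Node L k R))"
proof -
  note v = valid_NodeD[OF v]
  define l where "l = nodes L"
  have qL: "q x = (if tree_perm L (nat (x - a)) = l - 1 then l - 1 + k else tree_perm L (nat (x - a)))"
    "tree_perm L (nat (x - a)) < l"
    if "x \<in> seg a L" for x
  proof -
    have "nat (x - a) < nodes L" using that by (auto simp: seg_def)
    then show "q x = (if tree_perm L (nat (x - a)) = l - 1 then l - 1 + k else tree_perm L (nat (x - a)))"
      "tree_perm L (nat (x - a)) < l"
      using tree_perm_less[OF v(1), of "nat (x - a)"] by (simp_all add: q_def l_def)
  qed
  have qR: "q x = (if tree_perm R (nat (x - (m + 1))) < k then l - 1 + tree_perm R (nat (x - (m + 1)))
       else l + tree_perm R (nat (x - (m + 1))))" "tree_perm R (nat (x - (m + 1))) < nodes R"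
    if "x \<in> seg (m + 1) R" for x
  proof -
    have "nat (x - (m + 1)) < nodes R" using that by (auto simp: seg_def)
    then show "tree_perm R (nat (x - (m + 1))) < nodes R" by (rule tree_perm_less[OF v(2)])
    have "\<not> nat (x - a) < nodes L" "nat (x - a) \<noteq> nodes L" "nat (x - a) - nodes L - 1 = nat (x - (m + 1))"
      using that by (auto simp: seg_def m_def)
    then show "q x = (if tree_perm R (nat (x - (m + 1))) < k then l - 1 + tree_perm R (nat (x - (m + 1)))
       else l + tree_perm R (nat (x - (m + 1))))"
      by (simp add: q_def l_def)
  qed
  have qm: "q m = l + nodes R" by (simp add: q_def m_def l_def)
  show "same_order q (\<lambda>x. tree_perm L (nat (x - a))) (seg a L)"
    unfolding same_order_def
  proof (intro ballI)
    fix x y assume s: "x \<in> seg a L" "y \<in> seg a L"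
    have xy: "q x = (if tree_perm L (nat (x - a)) = l - 1 then l - 1 + k else tree_perm L (nat (x - a)))"
      "q y = (if tree_perm L (nat (y - a)) = l - 1 then l - 1 + k else tree_perm L (nat (y - a)))"
      and less: "tree_perm L (nat (x - a)) < l" "tree_perm L (nat (y - a)) < l"
      by (rule qL[OF s(1)] qL[OF s(2)])+
    show "q x < q y \<longleftrightarrow> tree_perm L (nat (x - a)) < tree_perm L (nat (y - a))"
      unfolding xy by (rule shift_last(1)[OF less])
  qed
  have lk: "l > 0 \<or> k = 0" unfolding l_def using v(5) by blast
  show "same_order q (\<lambda>x. tree_perm R (nat (x - (m + 1)))) (seg (m + 1) R)"
    unfolding same_order_def
  proof (intro ballI)
    fix x y assume "x \<in> seg (m + 1) R" "y \<in> seg (m + 1) R"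
    then show "q x < q y \<longleftrightarrow> tree_perm R (nat (x - (m + 1))) < tree_perm R (nat (y - (m + 1)))"
      using qR[of x] qR[of y] lk by auto
  qed
  show "q x < q m" if "x \<in> seg a L \<union> seg (m + 1) R" for x
    using that
  proof
    assume "x \<in> seg a L"
    then show ?thesis using qL[of x] qm v(4) by (auto split: if_splits)
  next
    assume "x \<in> seg (m + 1) R"
    then show ?thesis using qR[of x] qm by (auto split: if_splits)
  qed
  have max: "tree_perm L (nat (x - a)) = l - 1" if "x \<in> seg a L" "y \<in> seg (m + 1) R" "q y < q x" for x y
    using that(3) qL[OF that(1)] qR[OF that(2)] by (simp split: if_splits)
  show "interlaced q (seg a L) (seg (m + 1) R) k"
    unfolding interlaced_def
  proof (intro conjI ballI impI)
    fix x y z assume xy: "x \<in> seg a L" "y \<in> seg (m + 1) R" "q y < q x" "z \<in> seg a L"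
    then have "q x = l - 1 + k" using max[OF xy(1-3)] qL(1)[OF xy(1)] by simp
    then show "q z \<le> q x" unfolding qL(1)[OF xy(4)] using shift_last(2)[OF qL(2)[OF xy(4)]] by simp
  next
    have eq: "{y \<in> seg (m + 1) R. \<exists>x\<in>seg a L. q y < q x} = {y \<in> seg (m + 1) R. tree_perm R (nat (y - (m + 1))) < k}"
    proof (intro equalityI subsetI)
      fix y assume "y \<in> {y \<in> seg (m + 1) R. \<exists>x\<in>seg a L. q y < q x}"
      then obtain x where xy: "y \<in> seg (m + 1) R" "x \<in> seg a L" "q y < q x" by blast
      then have "q x = l - 1 + k" "l > 0" using max[OF xy(2,1,3)] qL[OF xy(2)] by auto
      then have "tree_perm R (nat (y - (m + 1))) < k" using xy qR[OF xy(1)] by (auto split: if_splits)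
      then show "y \<in> {y \<in> seg (m + 1) R. tree_perm R (nat (y - (m + 1))) < k}" using xy by blast
    next
      fix y assume "y \<in> {y \<in> seg (m + 1) R. tree_perm R (nat (y - (m + 1))) < k}"
      then have y: "y \<in> seg (m + 1) R" "tree_perm R (nat (y - (m + 1))) < k" by auto
      then have "l > 0" using lk by auto
      then have "l - 1 \<in> tree_perm L ` {..<nodes L}"
        using tree_perm_bij[OF v(1)] by (auto simp: bij_betw_def l_def)
      then obtain i where i: "i < nodes L" "tree_perm L i = l - 1" by auto
      then have ia: "a + int i \<in> seg a L" by (simp add: seg_def)
      then have "q (a + int i) = l - 1 + k" using qL(1)[OF ia] i(2) by simp
      then have "q y < q (a + int i)" using qR[OF y(1)] y(2) by simp
      then show "y \<in> {y \<in> seg (m + 1) R. \<exists>x\<in>seg a L. q y < q x}" using y(1) ia by blast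
    qed
    show "card {y \<in> seg (m + 1) R. \<exists>x\<in>seg a L. q y < q x} = k"
      unfolding eq by (rule card_tree_perm_less[OF v(2,4)])
  qed
  show "inj_on q (seg a (Node L k R))"
  proof (rule inj_onI)
    fix x y assume xy: "x \<in> seg a (Node L k R)" "y \<in> seg a (Node L k R)" "q x = q y"
    have "nat (z - a) \<in> {..<nodes (Node L k R)}" if "z \<in> seg a (Node L k R)" for z
      using that unfolding seg_def lessThan_iff atLeastLessThan_iff by linarith
    moreover have "tree_perm (Node L k R) (nat (x - a)) = tree_perm (Node L k R) (nat (y - a))"
      using xy(3) by (simp only: q_def)
    ultimately have "nat (x - a) = nat (y - a)"
      using xy(1,2) inj_onD[OF tree_perm_inj[OF assms(1)]] by blast
    then show "x = y" using xy by (auto simp: seg_def)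
  qed
qed

lemma realizes_Leaf [simp]: "realizes w a Leaf"
  by (simp add: realizes_def same_order_def seg_def)

text \<open>The model pattern has these properties by \<open>tree_perm_Node_order\<close>, and by
  \<open>same_order_glue\<close> they determine the order on the whole segment.\<close>

lemma realizes_Node:
  fixes w :: "int \<Rightarrow> int" and a :: int
  assumes v: "valid (Node L k R)" and w: "inj w"
  defines "m \<equiv> a + int (nodes L)"
  shows "realizes w a (Node L k R) \<longleftrightarrow> realizes w a L \<and> realizes w (m + 1) R \<and>
    (\<forall>x\<in>seg a L \<union> seg (m + 1) R. w x < w m) \<and> interlaced w (seg a L) (seg (m + 1) R) k"
proof -
  define q where "q = (\<lambda>x. tree_perm (Node L k R) (nat (x - a)))"
  note q = tree_perm_Node_order[OF v, where a = a, folded q_def m_def]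
  have q3: "q x < q m" if "x \<in> seg a L \<union> seg (m + 1) R" for x
    using q(3)[OF that] by (simp only: q_def)
  have S: "seg a (Node L k R) = seg a L \<union> {m} \<union> seg (m + 1) R" by (simp add: seg_Node m_def)
  have disj: "seg a L \<inter> seg (m + 1) R = {}" by (auto simp: seg_def m_def)
  show ?thesis
  proof
    assume "realizes w a (Node L k R)"
    then have o: "same_order w q (seg a L \<union> {m} \<union> seg (m + 1) R)"
      by (simp only: realizes_def q_def S)
    have "realizes w a L"
      unfolding realizes_def by (rule same_order_trans[OF same_order_subset[OF o] q(1)]) auto
    moreover have "realizes w (m + 1) R"
      unfolding realizes_def by (rule same_order_trans[OF same_order_subset[OF o] q(2)]) auto
    moreover have "\<forall>x\<in>seg a L \<union> seg (m + 1) R. w x < w m"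
    proof
      fix x assume x: "x \<in> seg a L \<union> seg (m + 1) R"
      then have "w x < w m \<longleftrightarrow> q x < q m" using o unfolding same_order_def by blast
      then show "w x < w m" using q3[OF x] by simp
    qed
    moreover have "interlaced w (seg a L) (seg (m + 1) R) k"
      by (rule interlaced_same_order[OF same_order_subset[OF o] q(4)]) blast
    ultimately show "realizes w a L \<and> realizes w (m + 1) R \<and>
      (\<forall>x\<in>seg a L \<union> seg (m + 1) R. w x < w m) \<and> interlaced w (seg a L) (seg (m + 1) R) k" by blast
  next
    assume r: "realizes w a L \<and> realizes w (m + 1) R \<and>
      (\<forall>x\<in>seg a L \<union> seg (m + 1) R. w x < w m) \<and> interlaced w (seg a L) (seg (m + 1) R) k"
    have "same_order w q (seg a L \<union> {m} \<union> seg (m + 1) R)"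
    proof (rule same_order_glue[OF finite_seg _ _ _ q(4) _ q3 _ _ disj])
      show "same_order w q (seg a L)"
        using r unfolding realizes_def by (intro same_order_trans[OF _ same_order_sym[OF q(1)]]) simp
      show "same_order w q (seg (m + 1) R)"
        using r unfolding realizes_def by (intro same_order_trans[OF _ same_order_sym[OF q(2)]]) simp
      show "inj_on w (seg a L \<union> seg (m + 1) R)" by (rule inj_on_subset[OF w]) simp
      show "inj_on q (seg a L \<union> seg (m + 1) R)" by (rule inj_on_subset[OF q(5)]) (auto simp: S)
    qed (use r in blast)+
    then show "realizes w a (Node L k R)" by (simp only: realizes_def q_def S)
  qed
qed

section \<open>Avoidance of 231 in the postorder reading\<close>

lemma finite_has_max:
  fixes w :: "int \<Rightarrow> int"
  assumes "finite S" "S \<noteq> {}"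
  shows "\<exists>M\<in>S. \<forall>z\<in>S. w z \<le> w M"
proof -
  have "Max (w ` S) \<in> w ` S" using assms by (intro Max_in) auto
  then obtain M where "M \<in> S" "w M = Max (w ` S)" by auto
  moreover have "w z \<le> Max (w ` S)" if "z \<in> S" for z using assms that by (intro Max_ge) auto
  ultimately show ?thesis by metis
qed

text \<open>Postorder reads \<open>A\<close>, then \<open>B\<close>, then \<open>m\<close>; being
  last and largest, \<open>m\<close> occurs in no bad triple. A mixed triple begins in
  \<open>A\<close> and ends in \<open>B\<close>: \<open>c1\<close> excludes a middle element in
  \<open>A\<close>, and \<open>c2\<close> excludes one in \<open>B\<close>.\<close>

lemma split_bad:
  assumes AB: "A \<subseteq> {..<m}" "B \<subseteq> {m<..}"
    and max: "\<And>x. x \<in> A \<union> B \<Longrightarrow> w x < w m"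
    and conv: "\<And>r k. r \<in> B \<Longrightarrow> m < k \<Longrightarrow> k \<le> r \<Longrightarrow> k \<in> B"
    and c1: "\<And>x y z. x \<in> A \<Longrightarrow> y \<in> B \<Longrightarrow> w y < w x \<Longrightarrow> z \<in> A \<Longrightarrow> w z \<le> w x"
    and c2: "\<And>x c d. x \<in> A \<Longrightarrow> c \<in> B \<Longrightarrow> d \<in> B \<Longrightarrow> before w c d \<Longrightarrow> w d < w x \<Longrightarrow> w x < w c \<Longrightarrow> False"
    and bad: "bad w x y z" "x \<in> A \<union> {m} \<union> B" "y \<in> A \<union> {m} \<union> B" "z \<in> A \<union> {m} \<union> B"
  shows "(x \<in> A \<and> y \<in> A \<and> z \<in> A) \<or> (x \<in> B \<and> y \<in> B \<and> z \<in> B)"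
proof -
  have lr: "before w x r" if "x \<in> A" "r \<in> B" for x r
    using AB that max[of x] by (intro before_across[of x m]) auto
  have last: "before w x m" if "x \<in> A \<union> B" for x
  proof (cases "x \<in> A")
    case True
    then show ?thesis using AB max[OF that] by (intro before_across[of x m]) auto
  next
    case False
    then show ?thesis using AB that max conv by (intro before_last) auto
  qed
  note b = bad(1)[unfolded bad_def]
  have "x \<noteq> m" "z \<noteq> m" using b max bad(2-4) by (auto dest: less_asym)
  moreover have "y \<noteq> m"
  proof
    assume "y = m"
    then have "before w z y" using last[of z] bad(4) \<open>z \<noteq> m\<close> by blast
    then show False using b before_asym by blast
  qed
  ultimately have mem: "x \<in> A \<union> B" "y \<in> A \<union> B" "z \<in> A \<union> B" using bad by auto
  have no: "\<not> (u \<in> B \<and> v \<in> A)" if "before w u v" for u v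
    using that lr before_asym by blast
  have yz: "before w y z" "before w x y" using b by auto
  consider "x \<in> B" | "x \<in> A" "y \<in> B" | "x \<in> A" "y \<in> A" "z \<in> B" | "x \<in> A" "y \<in> A" "z \<in> A"
    using mem by blast
  then show ?thesis
  proof cases
    case 1
    then show ?thesis using no[OF yz(2)] no[OF yz(1)] mem by blast
  next
    case 2
    then have "z \<in> B" using no[OF yz(1)] mem by blast
    then show ?thesis using c2[OF 2 _ yz(1)] b by blast
  next
    case 3
    then show ?thesis using c1[OF 3(1,3) _ 3(2)] b by auto
  qed blast
qed

text \<open>\<open>M\<close> is the last element of \<open>A\<close> in postorder, so an element
  \<open>y\<close> of \<open>B\<close> below some \<open>x \<noteq> M\<close> completes the bad
  triple \<open>x\<close>, \<open>M\<close>, \<open>y\<close>. The second claim is the bad triple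
  \<open>x\<close>, \<open>c\<close>, \<open>d\<close>. The maximum is supplied as a hypothesis
  because \<open>A\<close> may be a half-line.\<close>

lemma good_cross:
  assumes good: "good w S" and m: "m \<in> S" and sub: "A \<subseteq> S" "B \<subseteq> S"
    and AB: "A \<subseteq> {..<m}" "B \<subseteq> {m<..}"
    and max: "\<And>x. x \<in> A \<union> B \<Longrightarrow> w x < w m"
    and conv: "\<And>x y k. x \<in> A \<Longrightarrow> y \<in> A \<Longrightarrow> x < k \<Longrightarrow> k < y \<Longrightarrow> k \<in> A"
    and M: "M \<in> A" "\<And>z. z \<in> A \<Longrightarrow> w z \<le> w M" and inj: "inj w"
  shows "\<And>x y z. x \<in> A \<Longrightarrow> y \<in> B \<Longrightarrow> w y < w x \<Longrightarrow> z \<in> A \<Longrightarrow> w z \<le> w x"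
    and "\<And>x c d. x \<in> A \<Longrightarrow> c \<in> B \<Longrightarrow> d \<in> B \<Longrightarrow> before w c d \<Longrightarrow> w d < w x \<Longrightarrow> w x < w c \<Longrightarrow> False"
proof -
  have nobad: "\<not> bad w x y z" if "x \<in> S" "y \<in> S" "z \<in> S" for x y z
    using good that unfolding good_def by blast
  have lr: "before w x r" if "x \<in> A" "r \<in> B" for x r
    using AB that max[of x] by (intro before_across[of x m]) auto
  have xM: "x = M" if x: "x \<in> A" and y: "y \<in> B" "w y < w x" for x y
  proof (rule ccontr)
    assume "x \<noteq> M"
    have lt: "w z < w M" if "z \<in> A" "z \<noteq> M" for z
      using M(2)[OF that(1)] that(2) inj by (metis injD le_less)
    have "before w x M"
    proof (cases "x < M")
      case True
      then show ?thesis using lt[OF x \<open>x \<noteq> M\<close>] by (intro before_across[of x M]) auto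
    next
      case False
      then have "M < x" using \<open>x \<noteq> M\<close> by simp
      then show ?thesis
      proof (rule before_last)
        fix k assume k: "M < k" "k \<le> x"
        then have "k \<in> A" using conv[OF M(1) x, of k] x by (cases "k = x") auto
        then show "w k < w M" using lt k by simp
      qed
    qed
    then have "bad w x M y" using lr[OF M(1) y(1)] y lt[OF x \<open>x \<noteq> M\<close>] by (simp add: bad_def)
    then show False using nobad x y M(1) sub by blast
  qed
  show "w z \<le> w x" if "x \<in> A" "y \<in> B" "w y < w x" "z \<in> A" for x y z
    using xM[OF that(1-3)] M(2)[OF that(4)] by simp
  show False if "x \<in> A" "c \<in> B" "d \<in> B" "before w c d" "w d < w x" "w x < w c" for x c d
  proof -
    have "bad w x c d" using lr[OF that(1,2)] that by (simp add: bad_def)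
    then show False using nobad that sub by blast
  qed
qed

text \<open>The meaning of \<open>cuts\<close>: exactly at these ranks does postorder read all
  values below a threshold before all others. The induction step compares \<open>\<theta>\<close>
  with the value at the root and with the maximum of the left part.\<close>

lemma cuts_threshold:
  assumes "valid T" "inj w" "realizes w a T"
  shows "(\<forall>c\<in>seg a T. \<forall>d\<in>seg a T. \<not> (before w c d \<and> w d < \<theta> \<and> \<theta> \<le> w c)) \<longleftrightarrow>
    card {y\<in>seg a T. w y < \<theta>} \<in> cuts T"
  using assms
proof (induction T arbitrary: a)
  case Leaf
  then show ?case by (simp add: seg_def)
next
  case (Node L k R)
  note v = valid_NodeD[OF Node.prems(1)]
  define m where "m = a + int (nodes L)"
  define A where "A = seg a L"
  define B where "B = seg (m + 1) R"
  have r: "realizes w a L" "realizes w (m + 1) R" "\<And>x. x \<in> A \<union> B \<Longrightarrow> w x < w m" "interlaced w A B k"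
    using Node.prems(3) unfolding realizes_Node[OF Node.prems(1,2)] m_def[symmetric] A_def B_def by auto
  have S: "seg a (Node L k R) = A \<union> {m} \<union> B" by (simp add: seg_Node m_def A_def B_def)
  define P where "P X Y \<longleftrightarrow> (\<forall>c\<in>X. \<forall>d\<in>Y. \<not> (before w c d \<and> w d < \<theta> \<and> \<theta> \<le> w c))" for X Y
  define K where "K X = card {y\<in>X. w y < \<theta>}" for X
  have IH: "P A A \<longleftrightarrow> K A \<in> cuts L" "P B B \<longleftrightarrow> K B \<in> cuts R"
    using Node.IH(1)[OF v(1) Node.prems(2) r(1)] Node.IH(2)[OF v(2) Node.prems(2) r(2)]
    by (simp_all add: P_def K_def A_def B_def)
  have fin: "finite A" "finite B" by (simp_all add: A_def B_def)
  have A: "x < m" if "x \<in> A" for x using that by (auto simp: A_def seg_def m_def)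
  have B: "m < x" if "x \<in> B" for x using that by (auto simp: B_def seg_def m_def)
  have card: "card A = nodes L" "card B = nodes R" by (simp_all add: A_def B_def seg_def)
  have disj: "A \<inter> B = {}" "m \<notin> A" "m \<notin> B" using A B by force+
  have Kle: "K A \<le> nodes L" "K B \<le> nodes R"
    unfolding K_def card[symmetric] by (auto intro!: card_mono fin)
  have Kset: "K (A \<union> {m} \<union> B) = K A + K B + (if w m < \<theta> then 1 else 0)"
  proof -
    have "{y \<in> A \<union> {m} \<union> B. w y < \<theta>} =
       ({y\<in>A. w y < \<theta>} \<union> {y\<in>B. w y < \<theta>}) \<union> (if w m < \<theta> then {m} else {})" by auto
    moreover have "card (({y\<in>A. w y < \<theta>} \<union> {y\<in>B. w y < \<theta>}) \<union> (if w m < \<theta> then {m} else {}))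
      = card ({y\<in>A. w y < \<theta>} \<union> {y\<in>B. w y < \<theta>}) + card (if w m < \<theta> then {m} else {})"
      by (rule card_Un_disjoint) (use fin disj in auto)
    moreover have "card ({y\<in>A. w y < \<theta>} \<union> {y\<in>B. w y < \<theta>}) = K A + K B"
      unfolding K_def by (rule card_Un_disjoint) (use fin disj in auto)
    ultimately show ?thesis by (simp add: K_def)
  qed
  have cuts: "j \<in> cuts (Node L k R) \<longleftrightarrow> (j \<in> cuts L \<and> j < nodes L) \<or>
     (\<exists>x\<in>cuts R. k \<le> x \<and> j = nodes L + x) \<or> j = nodes L + nodes R + 1" for j
    using cuts_le[of j L] by auto
  have lr: "before w x y" if "x \<in> A" "y \<in> B" for x y
    using A[OF that(1)] B[OF that(2)] r(3)[of x] that(1) by (intro before_across[of x m]) auto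
  have last: "before w x m" if "x \<in> A \<union> B" for x
  proof (cases "x \<in> A")
    case True
    then show ?thesis using A[OF True] r(3)[OF that] by (intro before_across[of x m]) auto
  next
    case False
    then have "x \<in> B" using that by blast
    show ?thesis
    proof (rule before_last[OF B[OF \<open>x \<in> B\<close>]])
      fix k assume "m < k" "k \<le> x"
      then have "k \<in> B" using \<open>x \<in> B\<close> by (auto simp: B_def seg_def)
      then show "w k < w m" using r(3) by blast
    qed
  qed
  have "P (A \<union> {m} \<union> B) (A \<union> {m} \<union> B) \<longleftrightarrow> K (A \<union> {m} \<union> B) \<in> cuts (Node L k R)"
  proof (cases "w m < \<theta>")
    case True
    then have "w x < \<theta>" if "x \<in> A \<union> {m} \<union> B" for x using r(3)[of x] that by force
    then have "P (A \<union> {m} \<union> B) (A \<union> {m} \<union> B)" by (force simp: P_def)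
    moreover have "{y\<in>A. w y < \<theta>} = A" "{y\<in>B. w y < \<theta>} = B"
      using \<open>\<And>x. x \<in> A \<union> {m} \<union> B \<Longrightarrow> w x < \<theta>\<close> by auto
    then have "K (A \<union> {m} \<union> B) = nodes L + nodes R + 1" using True card Kset by (simp add: K_def)
    ultimately show ?thesis using cuts by blast
  next
    case False
    have "P (A \<union> {m} \<union> B) (A \<union> {m} \<union> B) \<longleftrightarrow> P A A \<and> P B B \<and> \<not> (\<exists>c\<in>A. \<exists>d\<in>B. w d < \<theta> \<and> \<theta> \<le> w c)"
    proof
      assume "P (A \<union> {m} \<union> B) (A \<union> {m} \<union> B)"
      then show "P A A \<and> P B B \<and> \<not> (\<exists>c\<in>A. \<exists>d\<in>B. w d < \<theta> \<and> \<theta> \<le> w c)"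
        using lr unfolding P_def by blast
    next
      assume R: "P A A \<and> P B B \<and> \<not> (\<exists>c\<in>A. \<exists>d\<in>B. w d < \<theta> \<and> \<theta> \<le> w c)"
      show "P (A \<union> {m} \<union> B) (A \<union> {m} \<union> B)"
        unfolding P_def
      proof (intro ballI notI)
        fix c d assume cd: "c \<in> A \<union> {m} \<union> B" "d \<in> A \<union> {m} \<union> B" "before w c d \<and> w d < \<theta> \<and> \<theta> \<le> w c"
        then have "d \<noteq> m" using False by auto
        then have "c \<noteq> m" using cd last before_asym by blast
        then consider "c \<in> A" "d \<in> A" | "c \<in> A" "d \<in> B" | "c \<in> B" "d \<in> A" | "c \<in> B" "d \<in> B"
          using cd \<open>d \<noteq> m\<close> by blast
        then show False using R cd(3) lr before_asym unfolding P_def by cases blast+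
      qed
    qed
    also have "\<dots> \<longleftrightarrow> K A + K B \<in> cuts (Node L k R)"
    proof (cases "L = Leaf")
      case True
      then have "A = {}" "k = 0" using Node.prems(1) by (auto simp: A_def seg_def)
      then have "K A = 0" "P A A" by (simp_all add: K_def P_def)
      then show ?thesis using IH(2) cuts[of "K B"] Kle \<open>A = {}\<close> \<open>k = 0\<close> True by (auto simp del: cuts.simps(2))
    next
      case L: False
      then have "A \<noteq> {}" using card by (metis card.empty nodes_eq_0_iff)
      obtain M where M: "M \<in> A" "\<And>z. z \<in> A \<Longrightarrow> w z \<le> w M"
        using finite_has_max[OF fin(1) \<open>A \<noteq> {}\<close>] by blast
      have kB: "card {y\<in>B. w y < w M} = k"
      proof -
        have "{y\<in>B. w y < w M} = {y\<in>B. \<exists>x\<in>A. w y < w x}" using M by (auto intro: less_le_trans)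
        then show ?thesis using r(4) by (simp add: interlaced_def)
      qed
      have rest: "w x < w y" if "x \<in> A" "x \<noteq> M" "y \<in> B" for x y
      proof (rule ccontr)
        assume "\<not> w x < w y"
        moreover have "w x \<noteq> w y" using Node.prems(2) disj(1) that by (auto dest: injD)
        ultimately have "w M \<le> w x" using r(4) that M(1) unfolding interlaced_def by force
        then have "w M = w x" using M(2)[OF that(1)] by simp
        then show False using Node.prems(2) that(2) by (auto dest: injD)
      qed
      have less_M: "w x < w M" if "x \<in> A" "x \<noteq> M" for x
        using M(2)[OF that(1)] that(2) Node.prems(2) by (metis injD le_less)
      show ?thesis
      proof (cases "\<theta> \<le> w M")
        case True
        then have KA: "K A < nodes L"
        proof -
          have "M \<notin> {y\<in>A. w y < \<theta>}" using True by simp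
          then have "{y\<in>A. w y < \<theta>} \<subset> A" using M(1) by blast
          then show ?thesis using fin(1) card(1) unfolding K_def by (metis psubset_card_mono)
        qed
        show ?thesis
        proof (cases "\<exists>d\<in>B. w d < \<theta>")
          case False
          then have "{y\<in>B. w y < \<theta>} = {}" "P B B" by (auto simp: P_def)
          then have "K B = 0" unfolding K_def by (simp only: card.empty)
          have "K A + K B \<in> cuts (Node L k R) \<longleftrightarrow> K A \<in> cuts L"
            unfolding cuts using KA \<open>K B = 0\<close> by auto
          then show ?thesis using IH(1) \<open>P B B\<close> False by blast
        next
          \<comment> \<open>The threshold falls among the \<open>k\<close> values of
            \<open>B\<close> below \<open>w M\<close>. Then \<open>M\<close> precedes the smaller
            \<open>d\<close>, and the rank lies in the gap from \<open>nodes L\<close> to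
            \<open>nodes L + k - 1\<close>, which contains no cut.\<close>
          case True': True
          then obtain d where d: "d \<in> B" "w d < \<theta>" by blast
          have "{y\<in>A. w y < \<theta>} = A - {M}"
            using True rest[OF _ _ d(1)] d(2) by (auto intro: less_trans)
          then have "K A = nodes L - 1" using card(1) M(1) by (simp add: K_def)
          moreover have "K B > 0" using d fin(2) by (auto simp: K_def card_gt_0_iff)
          moreover have "K B \<le> k"
            unfolding K_def kB[symmetric] using True fin(2) by (intro card_mono) auto
          ultimately have "K A + K B \<ge> nodes L" "K A + K B < nodes L + k" "K A + K B \<le> nodes L + nodes R"
            using KA Kle(2) by auto
          then have "K A + K B \<notin> cuts (Node L k R)" unfolding cuts by auto
          then show ?thesis using d M(1) True by blast
        qed
      next
        \<comment> \<open>All of \<open>A\<close> and at least \<open>k\<close> values of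
          \<open>B\<close> are below the threshold, so only the cuts of \<open>R\<close> from
          \<open>k\<close> on matter.\<close>
        case False
        then have all: "w x < \<theta>" if "x \<in> A" for x using M(2)[OF that] by simp
        then have "{y\<in>A. w y < \<theta>} = A" by auto
        then have "K A = nodes L" unfolding K_def by (simp only: card(1))
        moreover have "P A A" using all by (auto simp: P_def not_le)
        moreover have "K B \<ge> k"
          unfolding K_def kB[symmetric] using False fin(2) by (intro card_mono) auto
        ultimately have "K A + K B \<in> cuts (Node L k R) \<longleftrightarrow> K B \<in> cuts R"
          unfolding cuts using Kle(2) by auto
        moreover have "P A A" using all by (auto simp: P_def not_le)
        ultimately show ?thesis using IH(2) all by (force simp: not_le)
      qed
    qed
    finally show ?thesis using False Kset by simp
  qed
  then show ?case unfolding S P_def K_def .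
qed

text \<open>By \<open>c1\<close> only the maximum of \<open>A\<close> exceeds elements of
  \<open>B\<close>, so the condition concerns the single threshold \<open>w M\<close>, to which
  \<open>cuts_threshold\<close> applies. This is why labels are taken from
  \<open>cuts R\<close>.\<close>

lemma cross_cut:
  assumes "valid R" "inj w" "realizes w b R"
    and M: "A \<noteq> {} \<Longrightarrow> \<exists>M\<in>A. \<forall>z\<in>A. w z \<le> w M"
    and c1: "\<And>x y z. x \<in> A \<Longrightarrow> y \<in> seg b R \<Longrightarrow> w y < w x \<Longrightarrow> z \<in> A \<Longrightarrow> w z \<le> w x"
    and disj: "A \<inter> seg b R = {}"
  shows "(\<forall>x\<in>A. \<forall>c\<in>seg b R. \<forall>d\<in>seg b R. \<not> (before w c d \<and> w d < w x \<and> w x < w c)) \<longleftrightarrow>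
    card {y\<in>seg b R. \<exists>x\<in>A. w y < w x} \<in> cuts R"
proof (cases "A = {}")
  case True
  then show ?thesis using zero_in_cuts[OF assms(1)] by simp
next
  case False
  then obtain M where M: "M \<in> A" "\<And>z. z \<in> A \<Longrightarrow> w z \<le> w M" using M by blast
  have neq: "w c \<noteq> w M" if "c \<in> seg b R" for c using assms(2) disj M(1) that by (auto dest: injD)
  have "{y\<in>seg b R. \<exists>x\<in>A. w y < w x} = {y\<in>seg b R. w y < w M}"
    using M by (auto intro: less_le_trans)
  moreover have "(\<forall>x\<in>A. \<forall>c\<in>seg b R. \<forall>d\<in>seg b R. \<not> (before w c d \<and> w d < w x \<and> w x < w c)) \<longleftrightarrow>
     (\<forall>c\<in>seg b R. \<forall>d\<in>seg b R. \<not> (before w c d \<and> w d < w M \<and> w M \<le> w c))"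
  proof
    assume L: "\<forall>x\<in>A. \<forall>c\<in>seg b R. \<forall>d\<in>seg b R. \<not> (before w c d \<and> w d < w x \<and> w x < w c)"
    show "\<forall>c\<in>seg b R. \<forall>d\<in>seg b R. \<not> (before w c d \<and> w d < w M \<and> w M \<le> w c)"
      using L M(1) neq by (metis le_less)
  next
    assume R: "\<forall>c\<in>seg b R. \<forall>d\<in>seg b R. \<not> (before w c d \<and> w d < w M \<and> w M \<le> w c)"
    show "\<forall>x\<in>A. \<forall>c\<in>seg b R. \<forall>d\<in>seg b R. \<not> (before w c d \<and> w d < w x \<and> w x < w c)"
    proof (intro ballI notI)
      fix x c d assume *: "x \<in> A" "c \<in> seg b R" "d \<in> seg b R" "before w c d \<and> w d < w x \<and> w x < w c"
      then have "w M \<le> w x" using c1[of x d M] M(1) by blast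
      then have "w x = w M" using M(2)[OF *(1)] by simp
      then show False using R * by auto
    qed
  qed
  ultimately show ?thesis using cuts_threshold[OF assms(1-3), of "w M"] by simp
qed

lemma realizes_good:
  assumes "valid T" "inj w" "realizes w a T"
  shows "good w (seg a T)"
  using assms
proof (induction T arbitrary: a)
  case Leaf
  then show ?case by (simp add: good_def seg_def)
next
  case (Node L k R)
  note v = valid_NodeD[OF Node.prems(1)]
  define m where "m = a + int (nodes L)"
  have r: "realizes w a L" "realizes w (m + 1) R"
    "\<And>x. x \<in> seg a L \<union> seg (m + 1) R \<Longrightarrow> w x < w m" "interlaced w (seg a L) (seg (m + 1) R) k"
    using Node.prems(3) unfolding realizes_Node[OF Node.prems(1,2)] m_def[symmetric] by auto
  have S: "seg a (Node L k R) = seg a L \<union> {m} \<union> seg (m + 1) R" by (simp add: seg_Node m_def)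
  have c1: "w z \<le> w x" if "x \<in> seg a L" "y \<in> seg (m + 1) R" "w y < w x" "z \<in> seg a L" for x y z
    using r(4) that unfolding interlaced_def by blast
  have "card {y\<in>seg (m + 1) R. \<exists>x\<in>seg a L. w y < w x} \<in> cuts R"
    using r(4) v(3) unfolding interlaced_def by simp
  moreover have "\<exists>M\<in>seg a L. \<forall>z\<in>seg a L. w z \<le> w M" if "seg a L \<noteq> {}"
    by (rule finite_has_max[OF finite_seg that])
  moreover have "seg a L \<inter> seg (m + 1) R = {}" by (auto simp: seg_def m_def)
  ultimately have c2: "\<forall>x\<in>seg a L. \<forall>c\<in>seg (m + 1) R. \<forall>d\<in>seg (m + 1) R.
     \<not> (before w c d \<and> w d < w x \<and> w x < w c)"
    using cross_cut[OF v(2) Node.prems(2) r(2), of "seg a L"] c1 by blast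
  have g: "good w (seg a L)" "good w (seg (m + 1) R)"
    using Node.IH v Node.prems(2) r by blast+
  show ?case
    unfolding good_def S
  proof (intro ballI notI)
    fix x y z assume xyz: "x \<in> seg a L \<union> {m} \<union> seg (m + 1) R" "y \<in> seg a L \<union> {m} \<union> seg (m + 1) R"
      "z \<in> seg a L \<union> {m} \<union> seg (m + 1) R" "bad w x y z"
    have "(x \<in> seg a L \<and> y \<in> seg a L \<and> z \<in> seg a L) \<or>
       (x \<in> seg (m + 1) R \<and> y \<in> seg (m + 1) R \<and> z \<in> seg (m + 1) R)"
    proof (rule split_bad[OF _ _ r(3) _ c1 _ xyz(4,1-3)])
      show "seg a L \<subseteq> {..<m}" "seg (m + 1) R \<subseteq> {m<..}" by (auto simp: seg_def m_def)
      show "k \<in> seg (m + 1) R" if "i \<in> seg (m + 1) R" "m < k" "k \<le> i" for i k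
        using that by (simp add: seg_def)
      show False if "x \<in> seg a L" "c \<in> seg (m + 1) R" "d \<in> seg (m + 1) R" "before w c d"
        "w d < w x" "w x < w c" for x c d
        using c2 that by blast
    qed
    then show False using g xyz(4) unfolding good_def by blast
  qed
qed

lemma good_subset: "good w S \<Longrightarrow> T \<subseteq> S \<Longrightarrow> good w T"
  by (auto simp: good_def)

lemma good_realizes:
  assumes "inj w" "good w {a..<a + int n}"
  shows "\<exists>T. valid T \<and> nodes T = n \<and> realizes w a T"
  using assms(2)
proof (induction n arbitrary: a rule: less_induct)
  case (less n)
  show ?case
  proof (cases "n = 0")
    case True
    then show ?thesis by (intro exI[of _ Leaf]) simp
  next
    case False
    define S where "S = {a..<a + int n}"
    have "finite S" "S \<noteq> {}" using False by (auto simp: S_def)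
    then obtain m where m: "m \<in> S" "\<And>z. z \<in> S \<Longrightarrow> w z \<le> w m"
      using finite_has_max[OF \<open>finite S\<close> \<open>S \<noteq> {}\<close>] by blast
    have lt: "w z < w m" if "z \<in> S" "z \<noteq> m" for z
      using m(2)[OF that(1)] that(2) assms(1) by (metis injD le_less)
    define l where "l = nat (m - a)"
    define r where "r = n - l - 1"
    have l: "l < n" "m = a + int l" "l + r + 1 = n" using m(1) by (auto simp: S_def l_def r_def)
    have SL: "{a..<a + int l} \<subseteq> S" and SR: "{m + 1..<m + 1 + int r} \<subseteq> S"
      using l by (auto simp: S_def)
    obtain L where L: "valid L" "nodes L = l" "realizes w a L"
      using less.IH[of l a] l(1) good_subset[OF less.prems] SL unfolding S_def by blast
    have "r < n" using l by simp
    then obtain R where R: "valid R" "nodes R = r" "realizes w (m + 1) R"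
      using less.IH[of r "m + 1"] good_subset[OF less.prems] SR unfolding S_def by blast
    have segs: "seg a L = {a..<a + int l}" "seg (m + 1) R = {m + 1..<m + 1 + int r}"
      by (simp_all add: seg_def L R)
    define k where "k = card {y\<in>seg (m + 1) R. \<exists>x\<in>seg a L. w y < w x}"
    have ex: "\<exists>M\<in>seg a L. \<forall>z\<in>seg a L. w z \<le> w M" if "seg a L \<noteq> {}"
      using finite_has_max[OF finite_seg that] .
    have cross: "(\<forall>x\<in>seg a L. \<forall>y\<in>seg (m + 1) R. w y < w x \<longrightarrow> (\<forall>z\<in>seg a L. w z \<le> w x)) \<and>
        (\<forall>x\<in>seg a L. \<forall>c\<in>seg (m + 1) R. \<forall>d\<in>seg (m + 1) R. \<not> (before w c d \<and> w d < w x \<and> w x < w c))"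
    proof (cases "seg a L = {}")
      case False
      then obtain M where M: "M \<in> seg a L" "\<And>z. z \<in> seg a L \<Longrightarrow> w z \<le> w M" using ex by blast
      have *: "seg a L \<subseteq> S" "seg (m + 1) R \<subseteq> S" using SL SR segs by auto
      have **: "seg a L \<subseteq> {..<m}" "seg (m + 1) R \<subseteq> {m<..}" using segs l by auto
      have max: "w x < w m" if "x \<in> seg a L \<union> seg (m + 1) R" for x
        using that * ** by (intro lt) auto
      have conv: "k \<in> seg a L" if "x \<in> seg a L" "y \<in> seg a L" "x < k" "k < y" for x y k
        using that by (auto simp: seg_def)
      note cross = good_cross[OF less.prems[folded S_def] m(1) * ** _ _ M(1) _ assms(1)]
      have "w z \<le> w x" if "x \<in> seg a L" "y \<in> seg (m + 1) R" "w y < w x" "z \<in> seg a L" for x y z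
        by (rule cross(1)[OF _ _ _ that]) (erule max | erule (3) conv | erule M(2))+
      moreover have False if "x \<in> seg a L" "c \<in> seg (m + 1) R" "d \<in> seg (m + 1) R"
        "before w c d" "w d < w x" "w x < w c" for x c d
        by (rule cross(2)[OF _ _ _ that]) (erule max | erule (3) conv | erule M(2))+
      ultimately show ?thesis by blast
    qed simp
    have "seg a L \<inter> seg (m + 1) R = {}" using segs l by auto
    then have "k \<in> cuts R"
      unfolding k_def using cross cross_cut[OF R(1) assms(1) R(3) ex] by blast
    moreover have "k = 0" if "L = Leaf" using that L(2) segs by (simp add: k_def)
    ultimately have v: "valid (Node L k R)" using L R by simp
    moreover have "realizes w a (Node L k R)"
    proof -
      have m': "a + int (nodes L) = m" using l L by simp
      have "\<forall>x\<in>seg a L \<union> seg (m + 1) R. w x < w m"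
      proof
        fix x assume "x \<in> seg a L \<union> seg (m + 1) R"
        then have "x \<in> S" "x \<noteq> m" using SL SR segs l(2) by auto
        then show "w x < w m" by (rule lt)
      qed
      moreover have "interlaced w (seg a L) (seg (m + 1) R) k"
        using cross by (auto simp: interlaced_def k_def)
      ultimately show ?thesis
        unfolding realizes_Node[OF v assms(1)] m' using L(3) R(3) by blast
    qed
    moreover have "nodes (Node L k R) = n" using l L R by simp
    ultimately show ?thesis by blast
  qed
qed

text \<open>The position of the maximum fixes the sizes of both subtrees, and the label is a count
  that depends only on \<open>w\<close> and the two segments.\<close>

lemma realizes_unique:
  assumes "inj w" "valid T" "valid T'" "nodes T = nodes T'" "realizes w a T" "realizes w a T'"
  shows "T = T'"
  using assms(2-)
proof (induction T arbitrary: a T')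
  case Leaf
  then show ?case by (metis nodes_eq_0_iff nodes.simps(1))
next
  case (Node L k R)
  obtain L' k' R' where T': "T' = Node L' k' R'" using Node.prems(3) by (cases T') simp_all
  note v = Node.prems(1) Node.prems(2)[unfolded T']
  define m where "m = a + int (nodes L)"
  define m' where "m' = a + int (nodes L')"
  have r: "realizes w a L" "realizes w (m + 1) R" "\<And>x. x \<in> seg a L \<union> seg (m + 1) R \<Longrightarrow> w x < w m"
    "interlaced w (seg a L) (seg (m + 1) R) k"
    using Node.prems(4) unfolding realizes_Node[OF v(1) assms(1)] m_def[symmetric] by auto
  have r': "realizes w a L'" "realizes w (m' + 1) R'" "\<And>x. x \<in> seg a L' \<union> seg (m' + 1) R' \<Longrightarrow> w x < w m'"
    "interlaced w (seg a L') (seg (m' + 1) R') k'"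
    using Node.prems(5) unfolding T' realizes_Node[OF v(2) assms(1)] m'_def[symmetric] by auto
  have n: "nodes L + nodes R = nodes L' + nodes R'" using Node.prems(3) by (simp add: T')
  have "m = m'"
  proof (rule ccontr)
    assume "m \<noteq> m'"
    then have "m' \<in> seg a L \<union> seg (m + 1) R" "m \<in> seg a L' \<union> seg (m' + 1) R'"
      using n by (auto simp: seg_def m_def m'_def)
    then show False using r(3) r'(3) less_asym by blast
  qed
  then have l: "nodes L = nodes L'" by (simp add: m_def m'_def)
  have "L = L'"
    by (rule Node.IH(1)[OF valid_NodeD(1)[OF v(1)] valid_NodeD(1)[OF v(2)] l r(1) r'(1)])
  moreover have "R = R'"
  proof (rule Node.IH(2)[OF valid_NodeD(2)[OF v(1)] valid_NodeD(2)[OF v(2)] _ r(2)])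
    show "nodes R = nodes R'" using n l by simp
    show "realizes w (m + 1) R'" using r'(2) \<open>m = m'\<close> by simp
  qed
  moreover have "k = k'" using r(4) r'(4) calculation \<open>m = m'\<close> by (simp add: interlaced_def)
  ultimately show ?case by (simp add: T')
qed

section \<open>Left-to-right maxima and tilings\<close>

definition is_record :: "(int \<Rightarrow> int) \<Rightarrow> int \<Rightarrow> bool" where
  "is_record w s \<longleftrightarrow> (\<forall>z<s. w z < w s)"

text \<open>\<open>B\<close> describes the values of \<open>w\<close> strictly between the left-to-right maximum at \<open>s\<close> and the
  next one, together with their position relative to the values before \<open>s\<close>.\<close>

definition fits :: "(int \<Rightarrow> int) \<Rightarrow> int \<Rightarrow> block \<Rightarrow> bool" where
  "fits w s B \<longleftrightarrow> is_record w s \<and> (\<forall>y\<in>seg (s + 1) (fst B). w y < w s) \<and> realizes w (s + 1) (fst B)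
     \<and> interlaced w {..<s} (seg (s + 1) (fst B)) (snd B)"

definition encodes :: "(int \<Rightarrow> int) \<Rightarrow> (int \<Rightarrow> block option) \<Rightarrow> bool" where
  "encodes w \<delta> \<longleftrightarrow> (\<forall>s B. \<delta> s = Some B \<longrightarrow> fits w s B)"

lemma seg_bsize: "seg (s + 1) (fst B) = {s + 1..<s + int (bsize B)}"
  by (simp add: seg_def bsize_def add_ac)

lemma record_iff:
  assumes "\<delta> \<in> tilings n" "n > 0" "encodes w \<delta>"
  shows "is_record w x \<longleftrightarrow> \<delta> x \<noteq> None"
proof
  assume rec: "is_record w x"
  obtain s B where s: "\<delta> s = Some B" "s \<le> x" "x < s + int (bsize B)"
    by (rule tiling_cover[OF assms(1,2)])
  have "s = x"
  proof (rule ccontr)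
    assume "s \<noteq> x"
    then have "x \<in> seg (s + 1) (fst B)" using s by (simp add: seg_bsize)
    then have "w x < w s" using assms(3) s(1) unfolding encodes_def fits_def by blast
    moreover have "w s < w x" using rec s(2) \<open>s \<noteq> x\<close> by (simp add: is_record_def)
    ultimately show False by simp
  qed
  then show "\<delta> x \<noteq> None" using s(1) by simp
next
  assume "\<delta> x \<noteq> None"
  then show "is_record w x" using assms(3) unfolding encodes_def fits_def by blast
qed

lemma previous_block:
  assumes "\<delta> \<in> tilings n" "n > 0" "\<delta> s \<noteq> None"
  obtains p B where "\<delta> p = Some B" "p + int (bsize B) = s"
proof -
  obtain p B where p: "\<delta> p = Some B" "p \<le> s - 1" "s - 1 < p + int (bsize B)"
    by (rule tiling_cover[OF assms(1,2)])
  have "p + int (bsize B) = s"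
  proof (rule ccontr)
    assume "p + int (bsize B) \<noteq> s"
    then have "p < s" "s < p + int (bsize B)" using p by auto
    then have "\<delta> s = None" by (rule tilingsD(4)[OF assms(1) p(1)])
    then show False using assms(3) by simp
  qed
  then show ?thesis using that p(1) by blast
qed

text \<open>Locates the maximum of the half-line before the next block, where interlacing has to be
  compared.\<close>

lemma previous_block_max:
  assumes "fits w p B" "z < p + int (bsize B)"
  shows "w z \<le> w p"
proof -
  consider "z < p" | "z = p" | "z \<in> seg (p + 1) (fst B)" using assms(2) by (force simp: seg_bsize)
  then show ?thesis using assms(1) unfolding fits_def is_record_def by cases auto
qed

section \<open>Injectivity of the encoding by tilings\<close>

lemma fits_unique:
  assumes "inj w" "is_block B" "is_block B'" "bsize B = bsize B'" "fits w s B" "fits w s B'"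
  shows "B = B'"
proof -
  have "fst B = fst B'"
    using assms by (intro realizes_unique[of w _ _ "s + 1"]) (auto simp: is_block_def bsize_def fits_def)
  moreover have "snd B = snd B'" using assms(5,6) \<open>fst B = fst B'\<close> by (simp add: fits_def interlaced_def)
  ultimately show ?thesis by (simp add: prod_eq_iff)
qed

text \<open>In both tilings the starts are the left-to-right maxima of \<open>w\<close>, so the
  block sizes agree; trees and labels are then determined by \<open>w\<close>.\<close>

lemma encodes_unique_tiling:
  assumes n: "n > 0" and w: "inj w" and \<delta>: "\<delta> \<in> tilings n" "encodes w \<delta>"
    and \<delta>': "\<delta>' \<in> tilings n" "encodes w \<delta>'"
  shows "\<delta> = \<delta>'"
proof
  fix x
  have iff: "\<delta> y = None \<longleftrightarrow> \<delta>' y = None" for y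
    using record_iff[OF \<delta>(1) n \<delta>(2)] record_iff[OF \<delta>'(1) n \<delta>'(2)] by blast
  show "\<delta> x = \<delta>' x"
  proof (cases "\<delta> x")
    case None
    then show ?thesis using iff by simp
  next
    case (Some B)
    then obtain B' where B': "\<delta>' x = Some B'" using iff[of x] by auto
    have "\<not> bsize B < bsize B'"
      using tilingsD(3)[OF \<delta>(1) Some] tilingsD(4)[OF \<delta>'(1) B', of "x + int (bsize B)"] iff by auto
    moreover have "\<not> bsize B' < bsize B"
      using tilingsD(3)[OF \<delta>'(1) B'] tilingsD(4)[OF \<delta>(1) Some, of "x + int (bsize B')"] iff by auto
    ultimately have "bsize B = bsize B'" by simp
    then have "B = B'"
      using fits_unique[OF w tilingsD(2)[OF \<delta>(1) Some] tilingsD(2)[OF \<delta>'(1) B']] \<delta>(2) \<delta>'(2) Some B'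
      unfolding encodes_def by blast
    then show ?thesis using Some B' by simp
  qed
qed

lemma fits_cross:
  assumes w: "inj w" and v: "inj v" and wB: "fits w s B" "fits w p C" and vB: "fits v s B" "fits v p C"
    and p: "p + int (bsize C) = s" and x: "x < s" and y: "s \<le> y" "y < s + int (bsize B)"
  shows "w y < w x \<longleftrightarrow> v y < v x"
proof (cases "y = s")
  case True
  then show ?thesis using wB(1) vB(1) x unfolding fits_def is_record_def by (meson less_asym)
next
  case False
  have ps: "p < s" using p bsize_pos[of C] by linarith
  have max: "(\<forall>z\<in>{..<s}. u z \<le> u x) \<longleftrightarrow> x = p" if "inj u" "fits u p C" "x \<in> {..<s}" for u x
  proof
    assume "\<forall>z\<in>{..<s}. u z \<le> u x"
    then have "u p \<le> u x" using ps by simp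
    moreover have "u x \<le> u p" using previous_block_max[OF that(2), of x] that(3) p by simp
    ultimately show "x = p" using that(1) by (auto dest: injD)
  next
    assume "x = p"
    then show "\<forall>z\<in>{..<s}. u z \<le> u x" using previous_block_max[OF that(2)] p by simp
  qed
  have "same_order w v (seg (s + 1) (fst B))"
    using wB(1) vB(1) unfolding fits_def realizes_def by (meson same_order_sym same_order_trans)
  moreover have "y \<in> seg (s + 1) (fst B)" using False y by (simp add: seg_bsize)
  ultimately show ?thesis
    using interlaced_cross[of "seg (s + 1) (fst B)" w v "{..<s}" "snd B" x y] wB(1) vB(1) x
      max[OF w wB(2)] max[OF v vB(2)]
    unfolding fits_def by simp
qed

text \<open>Two positions are compared inside the block of the later one: directly if both lie in
  it, and otherwise by interlacing with the half-line before it, whose maximum is at the previous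
  start.\<close>

lemma encodes_unique_perm:
  assumes n: "n > 0" and \<delta>: "\<delta> \<in> tilings n"
    and w: "w \<in> affine_perms n" "encodes w \<delta>" and v: "v \<in> affine_perms n" "encodes v \<delta>"
  shows "w = v"
proof (rule affine_perm_eqI[OF n w(1) v(1)])
  note iw = affine_permsD(2)[OF w(1)] and iv = affine_permsD(2)[OF v(1)]
  have iff: "w y < w x \<longleftrightarrow> v y < v x" if xy: "x < y" for x y
  proof -
    obtain s B where s: "\<delta> s = Some B" "s \<le> y" "y < s + int (bsize B)"
      by (rule tiling_cover[OF \<delta> n])
    have fB: "fits w s B" "fits v s B" using w(2) v(2) s(1) unfolding encodes_def by blast+
    show ?thesis
    proof (cases "x < s")
      case True
      obtain p C where p: "\<delta> p = Some C" "p + int (bsize C) = s"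
        using previous_block[OF \<delta> n, of s] s(1) by blast
      have "fits w p C" "fits v p C" using w(2) v(2) p(1) unfolding encodes_def by blast+
      then show ?thesis using fits_cross[OF iw iv] fB p(2) True s(2,3) by blast
    next
      case False
      then have y: "y \<in> seg (s + 1) (fst B)" using s xy by (simp add: seg_bsize)
      show ?thesis
      proof (cases "x = s")
        case True
        then show ?thesis using fB y unfolding fits_def by blast
      next
        case False
        then have x: "x \<in> seg (s + 1) (fst B)" using s xy \<open>\<not> x < s\<close> by (simp add: seg_bsize)
        have "same_order w v (seg (s + 1) (fst B))"
          using fB unfolding fits_def realizes_def by (meson same_order_sym same_order_trans)
        then show ?thesis using x y unfolding same_order_def by blast
      qed
    qed
  qed
  fix i j assume ij: "v i < v j"
  consider "i < j" | "j < i" using ij by (metis less_irrefl linorder_neqE)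
  then show "w i < w j"
  proof cases
    case 1
    then have "\<not> w j < w i" using iff[of i j] ij by simp
    moreover have "w i \<noteq> w j" using iw 1 by (auto dest: injD)
    ultimately show ?thesis by simp
  next
    case 2
    then show ?thesis using iff[of j i] ij by simp
  qed
qed

text \<open>Only the block containing the rightmost of the three positions matters. By
  \<open>split_bad\<close> the triple lies entirely before that block, against its choice, or inside
  it, against \<open>realizes_good\<close>. No induction over the infinitely many earlier blocks is
  needed.\<close>

lemma encodes_good:
  assumes n: "n > 0" and \<delta>: "\<delta> \<in> tilings n" and w: "inj w" "encodes w \<delta>"
  shows "good w UNIV"
  unfolding good_def
proof (intro ballI notI)
  fix x y z assume bad: "bad w x y z"
  define M where "M = max x (max y z)"
  obtain s B where s: "\<delta> s = Some B" "s \<le> M" "M < s + int (bsize B)"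
    by (rule tiling_cover[OF \<delta> n])
  have f: "fits w s B" using w(2) s(1) unfolding encodes_def by blast
  have blk: "valid (fst B)" "snd B \<in> cuts (fst B)"
    using tilingsD(2)[OF \<delta> s(1)] by (auto simp: is_block_def)
  obtain p C where p: "\<delta> p = Some C" "p + int (bsize C) = s"
    using previous_block[OF \<delta> n, of s] s(1) by blast
  have fp: "fits w p C" using w(2) p(1) unfolding encodes_def by blast
  define S where "S = seg (s + 1) (fst B)"
  have i: "interlaced w {..<s} S (snd B)" and r: "realizes w (s + 1) (fst B)"
    using f by (auto simp: fits_def S_def)
  have c1: "w z \<le> w x" if "x \<in> {..<s}" "y \<in> S" "w y < w x" "z \<in> {..<s}" for x y z
    using i that unfolding interlaced_def by blast
  have ex: "\<exists>M\<in>{..<s}. \<forall>z\<in>{..<s}. w z \<le> w M"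
    using previous_block_max[OF fp] p(2) bsize_pos[of C] by (intro bexI[of _ p]) auto
  have disj: "{..<s} \<inter> S = {}" by (auto simp: S_def seg_def)
  have "card {y\<in>S. \<exists>x\<in>{..<s}. w y < w x} \<in> cuts (fst B)"
    using i blk(2) unfolding interlaced_def by simp
  moreover have "(\<forall>x\<in>{..<s}. \<forall>c\<in>S. \<forall>d\<in>S. \<not> (before w c d \<and> w d < w x \<and> w x < w c)) \<longleftrightarrow>
      card {y\<in>S. \<exists>x\<in>{..<s}. w y < w x} \<in> cuts (fst B)"
    unfolding S_def
  proof (rule cross_cut[OF blk(1) w(1) r ex])
    show "w z \<le> w x" if "x \<in> {..<s}" "y \<in> seg (s + 1) (fst B)" "w y < w x" "z \<in> {..<s}" for x y z
      by (rule c1[unfolded S_def, OF that])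
    show "{..<s} \<inter> seg (s + 1) (fst B) = {}" using disj by (simp only: S_def)
  qed
  ultimately have c2: "\<forall>x\<in>{..<s}. \<forall>c\<in>S. \<forall>d\<in>S. \<not> (before w c d \<and> w d < w x \<and> w x < w c)"
    by blast
  have "u \<in> {..<s} \<union> {s} \<union> S" if "u \<le> M" for u
    using that s(3) by (auto simp: S_def seg_bsize)
  then have mem: "x \<in> {..<s} \<union> {s} \<union> S" "y \<in> {..<s} \<union> {s} \<union> S" "z \<in> {..<s} \<union> {s} \<union> S"
    by (simp_all add: M_def)
  have "(x \<in> {..<s} \<and> y \<in> {..<s} \<and> z \<in> {..<s}) \<or> (x \<in> S \<and> y \<in> S \<and> z \<in> S)"
  proof (rule split_bad[OF _ _ _ _ c1 _ bad mem])
    show "S \<subseteq> {s<..}" by (auto simp: S_def seg_def)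
    show "w u < w s" if "u \<in> {..<s} \<union> S" for u
      using f that unfolding fits_def is_record_def S_def by blast
    show "k \<in> S" if "u \<in> S" "s < k" "k \<le> u" for u k
      using that by (simp add: S_def seg_def)
    show False if "x \<in> {..<s}" "c \<in> S" "d \<in> S" "before w c d" "w d < w x" "w x < w c" for x c d
      using c2 that by blast
  qed simp
  moreover have "\<not> (x < s \<and> y < s \<and> z < s)" using s(2) by (auto simp: M_def)
  ultimately have "x \<in> S \<and> y \<in> S \<and> z \<in> S" by auto
  then show False using realizes_good[OF blk(1) w(1) r] bad unfolding good_def S_def by blast
qed

text \<open>The values of \<open>u\<close> below are spread out by a factor of two: the odd values lie on the positions
  inside the blocks, and the even ones leave room for the record preceding a block to exceed
  exactly the prescribed number of its values.\<close>

lemma encodes_exists: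
  assumes n: "n > 0" and \<delta>: "\<delta> \<in> tilings n"
  obtains w where "w \<in> affine_perms n" "encodes w \<delta>"
proof -
  note D = tilingsD[OF \<delta>]
  have "\<exists>s. \<exists>B. \<delta> s = Some B \<and> s \<le> x \<and> x < s + int (bsize B)" for x
    using tiling_cover[OF \<delta> n, of x] by blast
  then obtain st where st: "\<exists>B. \<delta> (st x) = Some B \<and> st x \<le> x \<and> x < st x + int (bsize B)" for x
    by metis
  define bl where "bl x = the (\<delta> (st x))" for x
  have st: "\<delta> (st x) = Some (bl x)" "st x \<le> x" "x < st x + int (bsize (bl x))" for x
    using st[of x] by (auto simp: bl_def)
  have uniq: "st x = s" "bl x = B" if "\<delta> s = Some B" "s \<le> x" "x < s + int (bsize B)" for s x B
  proof -
    show "st x = s" by (rule tiling_cover_unique[OF \<delta> st that])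
    then show "bl x = B" using st(1)[of x] that(1) by simp
  qed
  define nx where "nx x = st x + int (bsize (bl x))" for x
  have nx: "\<delta> (nx x) \<noteq> None" for x unfolding nx_def by (rule D(3)[OF st(1)])
  have nx_st: "st (nx x) = nx x" "\<delta> (nx x) = Some (bl (nx x))" for x
  proof -
    obtain B where "\<delta> (nx x) = Some B" using nx by blast
    then show "st (nx x) = nx x" "\<delta> (nx x) = Some (bl (nx x))"
      using uniq[of "nx x" B "nx x"] bsize_pos[of B] by simp_all
  qed
  have start_le: "nx x \<le> s" if "\<delta> s \<noteq> None" "st x < s" for x s
    using D(4)[OF st(1) that(2)] that(1) unfolding nx_def by force
  define kk where "kk s = int (snd (bl s))" for s
  have kk: "0 \<le> kk s" "kk s < int (bsize (bl s))" for s
    using D(2)[OF st(1), of s] cuts_le[of "snd (bl s)" "fst (bl s)"]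
    by (auto simp: kk_def is_block_def bsize_def)
  define tp where "tp x = int (tree_perm (fst (bl x)) (nat (x - (st x + 1))))" for x
  define u where "u x = (if st x = x then 2 * (nx x + kk (nx x)) else 2 * (st x + tp x) + 1)" for x
  have nx_less: "x < nx x" for x using st(3) by (simp add: nx_def)
  \<comment> \<open>A start takes a value in the range of the following block, because the label of
    that block is less than its size.\<close>
  have u_start: "2 * nx x \<le> u x" "u x < 2 * nx (nx x)" if "st x = x" for x
    using that kk[of "nx x"] nx_st(1)[of x] by (auto simp: u_def nx_def)
  have tp: "0 \<le> tp x" "tp x < int (bsize (bl x)) - 1" if "st x \<noteq> x" for x
  proof -
    have "nat (x - (st x + 1)) < nodes (fst (bl x))"
      using that st(2,3)[of x] by (simp add: bsize_def)
    then show "0 \<le> tp x" "tp x < int (bsize (bl x)) - 1"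
      using D(2)[OF st(1), of x] tree_perm_less by (auto simp: tp_def is_block_def bsize_def)
  qed
  have u_inner: "2 * st x < u x" "u x < 2 * nx x" if "st x \<noteq> x" for x
    using tp[OF that] that by (auto simp: u_def nx_def)
  have st_st: "st (st x) = st x" "bl (st x) = bl x" "nx (st x) = nx x" for x
  proof -
    show *: "st (st x) = st x" "bl (st x) = bl x"
      using uniq[OF st(1)[of x], of "st x"] bsize_pos[of "bl x"] by simp_all
    show "nx (st x) = nx x" by (simp add: nx_def *)
  qed
  have step: "nx x \<le> st y" if "st x < st y" for x y
    using start_le[OF _ that] st(1)[of y] by simp
  have u_inner_less: "u x < 2 * st y" if "st x < st y" "st x \<noteq> x" for x y
    using u_inner(2)[OF that(2)] step[OF that(1)] by linarith
  have "inj u"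
  proof -
    have less: "u x \<noteq> u y" if "st x < st y" for x y
    proof (cases "st x = x")
      case False
      have "2 * st y \<le> u y" using u_inner(1)[of y] u_start(1)[of y] nx_less[of y] by (cases "st y = y") auto
      then show ?thesis using u_inner_less[OF that False] by simp
    next
      case x: True
      show ?thesis
      proof (cases "st y = y")
        case True
        have "nx (nx x) \<le> nx y"
        proof (cases "nx x = st y")
          case True
          then show ?thesis by (simp add: st_st)
        next
          case False
          then have "st (nx x) < st y" using step[OF that] nx_st(1) by simp
          then have "nx (nx x) \<le> st y" by (rule step)
          then show ?thesis using nx_less[of y] st(2)[of y] by linarith
        qed
        then show ?thesis using u_start(2)[OF x] u_start(1)[OF True] by linarith
      next
        case False
        then have "odd (u y)" "even (u x)" using x by (simp_all add: u_def)
        then show ?thesis by metis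
      qed
    qed
    show ?thesis
    proof (rule injI)
      fix x y assume eq: "u x = u y"
      then have s: "st x = st y" using less[of x y] less[of y x] by (metis linorder_neqE)
      then have b: "bl x = bl y" using st(1)[of x] st(1)[of y] by simp
      show "x = y"
      proof (cases "st x = x \<or> st y = y")
        case True
        have "odd (u z) \<longleftrightarrow> st z \<noteq> z" for z by (simp add: u_def)
        then show ?thesis using True eq s by metis
      next
        case False
        then have "tp x = tp y" using eq s by (simp add: u_def)
        then have "tree_perm (fst (bl x)) (nat (x - (st x + 1))) = tree_perm (fst (bl x)) (nat (y - (st y + 1)))"
          by (simp add: tp_def b)
        have offset: "nat (z - (st z + 1)) \<in> {..<nodes (fst (bl z))}" if "st z \<noteq> z" for z
          using that st(2,3)[of z] by (simp add: bsize_def)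
        have "nat (x - (st x + 1)) \<in> {..<nodes (fst (bl x))}" using offset[of x] False by blast
        moreover have "nat (y - (st y + 1)) \<in> {..<nodes (fst (bl x))}" using offset[of y] False b by metis
        moreover have "inj_on (tree_perm (fst (bl x))) {..<nodes (fst (bl x))}"
          using D(2)[OF st(1), of x] by (intro tree_perm_inj) (simp add: is_block_def)
        ultimately have "nat (x - (st x + 1)) = nat (y - (st y + 1))"
          using \<open>tree_perm _ _ = tree_perm _ _\<close> by (meson inj_onD)
        then show ?thesis using False s st(2)[of x] st(2)[of y] by linarith
      qed
    qed
  qed
  have per: "u (x + int n) = u x + 2 * int n" for x
  proof -
    have s: "st (y + int n) = st y + int n" "bl (y + int n) = bl y" for y
      using uniq[of "st y + int n" "bl y" "y + int n"] D(1)[of "st y"] st[of y] by simp_all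
    have nx': "nx (y + int n) = nx y + int n" for y by (simp add: nx_def s)
    have kk': "kk (y + int n) = kk y" for y by (simp add: kk_def s)
    have tp': "tp (y + int n) = tp y" for y
    proof -
      have "y + int n - (st y + int n + 1) = y - (st y + 1)" by simp
      then show ?thesis by (simp only: tp_def s)
    qed
    show ?thesis unfolding u_def nx' kk' tp' s by simp
  qed
  obtain B where B: "B > 0" "\<And>i j. i + B \<le> j \<Longrightarrow> u i < u j"
    using eventually_less[of n "2 * int n" u] n per by auto
  \<comment> \<open>\<open>u\<close> grows by \<open>2 n\<close> per period, so only its order is
    kept and turned into an affine permutation.\<close>
  obtain w where w: "w \<in> affine_perms n" "\<And>i j. w i < w j \<longleftrightarrow> u i < u j"
  proof (rule affine_perm_of_order[OF n, of "\<lambda>i j. u i < u j" B])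
    show "u i < u j \<or> u j < u i" if "i \<noteq> j" for i j
      using \<open>inj u\<close> that by (metis injD linorder_neqE)
  qed (use B per that in auto)
  have order: "same_order w u S" for S by (simp add: same_order_def w(2))
  have "fits w s C" if sC: "\<delta> s = Some C" for s C
  proof -
    have s: "st s = s" "bl s = C" using uniq[OF sC, of s] bsize_pos[of C] by simp_all
    have inseg: "st y = s" "bl y = C" "y \<noteq> s" if "y \<in> seg (s + 1) (fst C)" for y
      using uniq[OF sC, of y] that by (auto simp: seg_bsize)
    have nxs: "nx y = nx s" if "y \<in> seg (s + 1) (fst C)" for y using inseg[OF that] s by (simp add: nx_def)
    have before_s: "st z < s" if "z < s" for z using st(2)[of z] that by simp
    have u_le: "u z < 2 * s \<or> (st z = z \<and> nx z = s)" if "z < s" for z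
    proof (cases "st z = z")
      case False
      then show ?thesis using u_inner_less[of z s] before_s[OF that] s(1) by simp
    next
      case True
      show ?thesis
      proof (cases "nx z = s")
        case False
        then have "st (nx z) < st s" using step[of z s] before_s[OF that] s(1) nx_st(1) by simp
        then have "nx (nx z) \<le> s" using step s(1) by metis
        then show ?thesis using u_start(2)[OF True] by linarith
      qed (use True in simp)
    qed
    have u_prev: "u z = 2 * (s + kk s)" if "st z = z" "nx z = s" for z using that by (simp add: u_def)
    have kks: "kk s < int (bsize C)" using kk[of s] s by simp
    have nxs_eq: "nx s = s + int (bsize C)" using s by (simp add: nx_def)
    have u_below: "u z < u s" if "z < s" for z
    proof -
      have "u z < 2 * nx s" using u_le[OF that] u_prev[of z] kks nxs_eq kk(1)[of s] by auto
      then show ?thesis using u_start(1)[OF s(1)] by linarith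
    qed
    have u_seg: "u y = 2 * (s + int (tree_perm (fst C) (nat (y - (s + 1))))) + 1"
      if "y \<in> seg (s + 1) (fst C)" for y
      using inseg[OF that] by (simp add: u_def tp_def)
    have blk: "valid (fst C)" "snd C \<le> nodes (fst C)"
      using D(2)[OF sC] cuts_le by (auto simp: is_block_def)
    have kC: "kk s = int (snd C)" by (simp add: kk_def s)
    have u_gt: "2 * s < u y" if "y \<in> seg (s + 1) (fst C)" for y using u_seg[OF that] by simp
    have prev: "st z = z \<and> nx z = s" if "z < s" "y \<in> seg (s + 1) (fst C)" "u y < u z" for y z
      using u_le[OF that(1)] u_gt[OF that(2)] that(3) by linarith
    \<comment> \<open>The previous start attains the value \<open>2 * (s + kk s)\<close>, the
      maximum of \<open>u\<close> before \<open>s\<close>.\<close>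
    obtain p P where p: "\<delta> p = Some P" "p + int (bsize P) = s"
      using previous_block[OF \<delta> n, of s] sC by blast
    have pp: "st p = p" "nx p = s" "p < s"
      using uniq[OF p(1), of p] bsize_pos[of P] p(2) by (auto simp: nx_def)
    have "interlaced u {..<s} (seg (s + 1) (fst C)) (snd C)"
      unfolding interlaced_def
    proof (intro conjI ballI impI)
      fix x y z assume xyz: "x \<in> {..<s}" "y \<in> seg (s + 1) (fst C)" "u y < u x" "z \<in> {..<s}"
      then have "u x = 2 * (s + kk s)" using prev[of x y] u_prev by simp
      then show "u z \<le> u x" using u_le[of z] u_prev[of z] xyz(4) kk(1)[of s] by auto
    next
      have "{y \<in> seg (s + 1) (fst C). \<exists>x\<in>{..<s}. u y < u x} =
        {y \<in> seg (s + 1) (fst C). tree_perm (fst C) (nat (y - (s + 1))) < snd C}"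
      proof (rule Collect_cong, rule conj_cong[OF refl])
        fix y assume y: "y \<in> seg (s + 1) (fst C)"
        have "(\<exists>x\<in>{..<s}. u y < u x) \<longleftrightarrow> u y < 2 * (s + kk s)"
        proof
          assume "\<exists>x\<in>{..<s}. u y < u x"
          then obtain x where "x < s" "u y < u x" by auto
          then show "u y < 2 * (s + kk s)" using prev[OF _ y] u_prev by metis
        next
          assume "u y < 2 * (s + kk s)"
          then show "\<exists>x\<in>{..<s}. u y < u x" using u_prev[OF pp(1,2)] pp(3) by (intro bexI[of _ p]) auto
        qed
        also have "\<dots> \<longleftrightarrow> tree_perm (fst C) (nat (y - (s + 1))) < snd C"
        proof -
          have "2 * (s + int i) + 1 < 2 * (s + int j) \<longleftrightarrow> i < j" for i j by presburger
          then show ?thesis unfolding u_seg[OF y] kC .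
        qed
        finally show "(\<exists>x\<in>{..<s}. u y < u x) \<longleftrightarrow> tree_perm (fst C) (nat (y - (s + 1))) < snd C" .
      qed
      then show "card {y \<in> seg (s + 1) (fst C). \<exists>x\<in>{..<s}. u y < u x} = snd C"
        using card_tree_perm_less[OF blk] by simp
    qed
    then have "interlaced w {..<s} (seg (s + 1) (fst C)) (snd C)"
      by (rule interlaced_same_order[OF order])
    moreover have "is_record w s" using u_below by (simp add: is_record_def w(2))
    moreover have "\<forall>y\<in>seg (s + 1) (fst C). w y < w s"
    proof
      fix y assume y: "y \<in> seg (s + 1) (fst C)"
      have "u y < 2 * nx s" using u_inner(2)[of y] inseg[OF y] nxs[OF y] by simp
      then show "w y < w s" using u_start(1)[OF s(1)] w(2) by simp
    qed
    moreover have "realizes w (s + 1) (fst C)"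
      using u_seg by (auto simp: realizes_def same_order_def w(2))
    ultimately show ?thesis by (simp add: fits_def)
  qed
  then have "encodes w \<delta>" by (simp add: encodes_def)
  then show ?thesis using that w(1) by blast
qed

section \<open>The tiling of a good permutation\<close>

lemma halfline_max:
  assumes "n > 0" "w \<in> affine_perms n"
  shows "\<exists>M<x. \<forall>z<x. w z \<le> w M"
proof -
  obtain B where B: "B > 0" "\<And>i j. i + B \<le> j \<Longrightarrow> w i < w j"
    using affine_perm_bound[OF assms] by blast
  have "{x - B..<x} \<noteq> {}" using B(1) by simp
  then obtain M where M: "M \<in> {x - B..<x}" "\<forall>z\<in>{x - B..<x}. w z \<le> w M"
    using finite_has_max[of "{x - B..<x}" w] by auto
  have "w z \<le> w M" if "z < x" for z
  proof (cases "x - B \<le> z")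
    case True
    then show ?thesis using M(2) that by simp
  next
    \<comment> \<open>Everything left of \<open>x - B\<close> is below \<open>w (x - 1)\<close>, so
      only a finite window competes for the maximum.\<close>
    case False
    have "x - B \<le> x - 1" using B(1) by simp
    then have "w z < w (x - 1)" using B(2)[of z "x - 1"] False by simp
    also have "w (x - 1) \<le> w M" using M(2) B(1) by simp
    finally show ?thesis by simp
  qed
  then show ?thesis using M(1) by auto
qed

lemma is_record_exists:
  assumes "n > 0" "w \<in> affine_perms n"
  shows "\<exists>s. is_record w s"
proof -
  obtain M where M: "M < 0" "\<forall>z<0. w z \<le> w M" using halfline_max[OF assms] by blast
  have "w z < w M" if "z < M" for z
  proof -
    have "w z \<le> w M" using M that by simp
    moreover have "w z \<noteq> w M" using affine_permsD(2)[OF assms(2)] that by (auto dest: injD)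
    ultimately show ?thesis by simp
  qed
  then show ?thesis unfolding is_record_def by blast
qed

text \<open>The block ends before the first later position whose value exceeds \<open>w s\<close>.
  \<open>good_realizes\<close> supplies its tree; its label counts the interior values exceeded from
  the left, a cut by \<open>good_cross\<close> and \<open>cross_cut\<close>.\<close>

lemma fits_exists:
  assumes n: "n > 0" and w: "w \<in> affine_perms n" and good: "good w UNIV" and s: "is_record w s"
  shows "\<exists>B. is_block B \<and> fits w s B \<and> is_record w (s + int (bsize B))"
proof -
  note inj = affine_permsD(2)[OF w]
  obtain b where b: "b > 0" "\<And>i j. i + b \<le> j \<Longrightarrow> w i < w j"
    using affine_perm_bound[OF n w] by blast
  have "w s < w (s + 1 + int (nat (b - 1)))" using b by simp
  then have ex: "\<exists>d. w s < w (s + 1 + int d)" ..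
  define d where "d = (LEAST d. w s < w (s + 1 + int d))"
  have d: "w s < w (s + 1 + int d)" unfolding d_def by (rule LeastI_ex[OF ex])
  have small: "w (s + 1 + int i) < w s" if "i < d" for i
  proof -
    have "\<not> w s < w (s + 1 + int i)" using not_less_Least that unfolding d_def by blast
    moreover have "w (s + 1 + int i) \<noteq> w s" using injD[OF inj, of "s + 1 + int i" s] by auto
    ultimately show ?thesis by simp
  qed
  have small': "w y < w s" if "y \<in> {s + 1..<s + 1 + int d}" for y
  proof -
    have "nat (y - (s + 1)) < d" "s + 1 + int (nat (y - (s + 1))) = y" using that by auto
    then show ?thesis using small by metis
  qed
  have "good w {s + 1..<s + 1 + int d}" using good good_subset by blast
  then obtain T where T: "valid T" "nodes T = d" "realizes w (s + 1) T"
    using good_realizes[OF inj] by blast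
  define S where "S = seg (s + 1) T"
  have S: "S = {s + 1..<s + 1 + int d}" by (simp add: S_def seg_def T(2))
  have rec: "is_record w (s + 1 + int d)"
    unfolding is_record_def
  proof (intro allI impI)
    fix z assume "z < s + 1 + int d"
    then consider "z < s" | "z = s" | "z \<in> S" using S by force
    then have "w z \<le> w s" using s small' S unfolding is_record_def by cases (auto intro: less_imp_le)
    then show "w z < w (s + 1 + int d)" using d by simp
  qed
  obtain M where M: "M < s" "\<forall>z<s. w z \<le> w M" using halfline_max[OF n w] by blast
  have max: "w x < w s" if "x \<in> {..<s} \<union> S" for x
    using that s small' S unfolding is_record_def by auto
  have sub: "s \<in> UNIV" "{..<s} \<subseteq> UNIV" "S \<subseteq> UNIV" "{..<s} \<subseteq> {..<s}" "S \<subseteq> {s<..}" using S by auto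
  have Ms: "M \<in> {..<s}" using M(1) by simp
  have Mmax: "w z \<le> w M" if "z \<in> {..<s}" for z using M(2) that by simp
  have conv: "k \<in> {..<s}" if "x \<in> {..<s}" "y \<in> {..<s}" "x < k" "k < y" for x y k :: int
    using that by simp
  have cross: "w z \<le> w x" if "x \<in> {..<s}" "y \<in> S" "w y < w x" "z \<in> {..<s}" for x y z
    by (rule good_cross(1)[OF good sub _ _ Ms _ inj that]) (erule max | erule (3) conv | erule Mmax)+
  have cross2: False if "x \<in> {..<s}" "c \<in> S" "d \<in> S" "before w c d" "w d < w x" "w x < w c" for x c d
    by (rule good_cross(2)[OF good sub _ _ Ms _ inj that]) (erule max | erule (3) conv | erule Mmax)+
  define k where "k = card {y\<in>S. \<exists>x\<in>{..<s}. w y < w x}"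
  have "(\<forall>x\<in>{..<s}. \<forall>c\<in>S. \<forall>d\<in>S. \<not> (before w c d \<and> w d < w x \<and> w x < w c)) \<longleftrightarrow> k \<in> cuts T"
    unfolding k_def S_def
  proof (rule cross_cut[OF T(1) inj T(3)])
    show "\<exists>M\<in>{..<s}. \<forall>z\<in>{..<s}. w z \<le> w M" using M by auto
    show "w z \<le> w x" if "x \<in> {..<s}" "y \<in> seg (s + 1) T" "w y < w x" "z \<in> {..<s}" for x y z
      by (rule cross[unfolded S_def, OF that])
    show "{..<s} \<inter> seg (s + 1) T = {}" by (auto simp: seg_def)
  qed
  then have "is_block (T, k)" using cross2 T(1) by (auto simp: is_block_def)
  moreover have "interlaced w {..<s} S k" using cross unfolding interlaced_def k_def by blast
  then have "fits w s (T, k)"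
    using s T(3) small' S by (simp add: fits_def S_def[symmetric])
  moreover have "is_record w (s + int (bsize (T, k)))" using rec by (simp add: bsize_def T(2) add_ac)
  ultimately show ?thesis by blast
qed

lemma fits_periodic:
  assumes per: "periodic n w"
  shows "fits w (s + int n) B \<longleftrightarrow> fits w s B" and "is_record w (s + int n) \<longleftrightarrow> is_record w s"
proof -
  have w: "w (x + int n) = w x + int n" for x using per by (simp add: periodic_def)
  define T where "T = fst B"
  have shift: "(\<lambda>x. x + int n) ` X = {y. y - int n \<in> X}" for X by (force simp: image_iff)
  have half: "{..<s + int n} = (\<lambda>x. x + int n) ` {..<s}" unfolding shift by auto
  have seg: "seg (s + int n + 1) T = (\<lambda>x. x + int n) ` seg (s + 1) T"
    unfolding shift by (auto simp: seg_def)
  have "is_record w (s + int n) \<longleftrightarrow> (\<forall>z\<in>{..<s + int n}. w z < w (s + int n))"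
    by (auto simp: is_record_def)
  also have "\<dots> \<longleftrightarrow> is_record w s" unfolding half by (auto simp: is_record_def w)
  finally show rec: "is_record w (s + int n) \<longleftrightarrow> is_record w s" .
  have "(\<forall>y\<in>seg (s + int n + 1) T. w y < w (s + int n)) \<longleftrightarrow> (\<forall>y\<in>seg (s + 1) T. w y < w s)"
    unfolding seg by (simp add: w)
  moreover have "realizes w (s + int n + 1) T \<longleftrightarrow> realizes w (s + 1) T"
  proof -
    have "x + int n - (s + int n + 1) = x - (s + 1)" for x by simp
    then show ?thesis
      unfolding realizes_def seg by (simp only: same_order_def ball_simps w add_less_cancel_right)
  qed
  moreover have "interlaced w {..<s + int n} (seg (s + int n + 1) T) k \<longleftrightarrow> interlaced w {..<s} (seg (s + 1) T) k" for k
  proof -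
    have "{y \<in> (\<lambda>x. x + int n) ` seg (s + 1) T. \<exists>x\<in>(\<lambda>x. x + int n) ` {..<s}. w y < w x} =
       (\<lambda>x. x + int n) ` {y \<in> seg (s + 1) T. \<exists>x\<in>{..<s}. w y < w x}"
    proof (intro equalityI subsetI)
      fix z assume "z \<in> {y \<in> (\<lambda>x. x + int n) ` seg (s + 1) T. \<exists>x\<in>(\<lambda>x. x + int n) ` {..<s}. w y < w x}"
      then obtain y x where yx: "z = y + int n" "y \<in> seg (s + 1) T" "x \<in> {..<s}" "w z < w (x + int n)" by blast
      then have "w y < w x" by (simp only: w add_less_cancel_right)
      then show "z \<in> (\<lambda>x. x + int n) ` {y \<in> seg (s + 1) T. \<exists>x\<in>{..<s}. w y < w x}" using yx by blast
    next
      fix z assume "z \<in> (\<lambda>x. x + int n) ` {y \<in> seg (s + 1) T. \<exists>x\<in>{..<s}. w y < w x}"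
      then obtain y x where yx: "z = y + int n" "y \<in> seg (s + 1) T" "x \<in> {..<s}" "w y < w x" by blast
      then have "w z < w (x + int n)" by (simp only: w add_less_cancel_right)
      then show "z \<in> {y \<in> (\<lambda>x. x + int n) ` seg (s + 1) T. \<exists>x\<in>(\<lambda>x. x + int n) ` {..<s}. w y < w x}"
        using yx by blast
    qed
    moreover have "card ((\<lambda>x. x + int n) ` {y \<in> seg (s + 1) T. \<exists>x\<in>{..<s}. w y < w x}) =
        card {y \<in> seg (s + 1) T. \<exists>x\<in>{..<s}. w y < w x}"
      by (rule card_image) (simp add: inj_on_def)
    ultimately have "card {y \<in> (\<lambda>x. x + int n) ` seg (s + 1) T. \<exists>x\<in>(\<lambda>x. x + int n) ` {..<s}. w y < w x} =
       card {y \<in> seg (s + 1) T. \<exists>x\<in>{..<s}. w y < w x}"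
      by (simp only:)
    moreover have "(\<forall>x\<in>(\<lambda>x. x + int n) ` {..<s}. \<forall>y\<in>(\<lambda>x. x + int n) ` seg (s + 1) T. w y < w x \<longrightarrow>
        (\<forall>z\<in>(\<lambda>x. x + int n) ` {..<s}. w z \<le> w x)) \<longleftrightarrow>
      (\<forall>x\<in>{..<s}. \<forall>y\<in>seg (s + 1) T. w y < w x \<longrightarrow> (\<forall>z\<in>{..<s}. w z \<le> w x))"
      by (simp add: w)
    ultimately show ?thesis unfolding half seg interlaced_def by (simp only:)
  qed
  ultimately show "fits w (s + int n) B \<longleftrightarrow> fits w s B"
    using rec by (simp add: fits_def T_def)
qed

lemma good_encodes:
  assumes n: "n > 0" and w: "w \<in> affine_perms n" and good: "good w UNIV"
  shows "\<exists>\<delta>\<in>tilings n. encodes w \<delta>"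
proof -
  define P where "P s B \<longleftrightarrow> is_block B \<and> fits w s B \<and> is_record w (s + int (bsize B))" for s B
  define \<delta> where "\<delta> s = (if is_record w s then Some (SOME B. P s B) else None)" for s
  have P: "P s B" if "\<delta> s = Some B" for s B
  proof -
    have "is_record w s" "B = (SOME B. P s B)" using that by (simp_all add: \<delta>_def split: if_splits)
    moreover have "\<exists>B. P s B" using fits_exists[OF n w good] calculation(1) by (simp add: P_def)
    ultimately show ?thesis using someI_ex[of "P s"] by simp
  qed
  note per = fits_periodic[OF affine_permsD(3)[OF w]]
  \<comment> \<open>The choice in \<open>\<delta>\<close> depends on \<open>s\<close> only through
    the predicate \<open>P s\<close>, so equality of the predicates makes the arbitrary choices
    periodic.\<close>
  have "P (s + int n) = P s" for s
  proof
    fix B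
    have "s + int n + int (bsize B) = (s + int (bsize B)) + int n" by simp
    then show "P (s + int n) B = P s B" unfolding P_def by (simp only: per)
  qed
  then have "\<delta> (s + int n) = \<delta> s" for s by (simp add: \<delta>_def per(2))
  moreover have "\<exists>s. \<delta> s \<noteq> None" using is_record_exists[OF n w] by (auto simp: \<delta>_def)
  moreover have "is_block B \<and> \<delta> (s + int (bsize B)) \<noteq> None \<and>
       (\<forall>y. s < y \<and> y < s + int (bsize B) \<longrightarrow> \<delta> y = None)" if "\<delta> s = Some B" for s B
  proof (intro conjI allI impI)
    show "is_block B" "\<delta> (s + int (bsize B)) \<noteq> None" using P[OF that] by (simp_all add: P_def \<delta>_def)
    fix y assume y: "s < y \<and> y < s + int (bsize B)"
    then have "y \<in> seg (s + 1) (fst B)" by (simp add: seg_bsize)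
    then have "w y < w s" using P[OF that] unfolding P_def fits_def by blast
    then have "\<not> is_record w y" using y unfolding is_record_def by (meson less_asym)
    then show "\<delta> y = None" by (simp add: \<delta>_def)
  qed
  ultimately have "\<delta> \<in> tilings n" unfolding tilings_def by blast
  moreover have "encodes w \<delta>" using P unfolding encodes_def P_def by blast
  ultimately show ?thesis by blast
qed

lemma two_stack_sortable_tilings:
  assumes n: "n > 0"
  shows "finite (two_stack_sortable n)" "card (two_stack_sortable n) = card (tilings n)"
proof -
  have "\<exists>f. \<forall>w\<in>two_stack_sortable n. f w \<in> tilings n \<and> encodes w (f w)"
    using good_encodes[OF n] unfolding two_stack_sortable_iff_good[OF n]
    by (intro bchoice) blast
  then obtain f where f: "\<And>w. w \<in> two_stack_sortable n \<Longrightarrow> f w \<in> tilings n"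
    "\<And>w. w \<in> two_stack_sortable n \<Longrightarrow> encodes w (f w)" by blast
  have perm: "w \<in> affine_perms n" if "w \<in> two_stack_sortable n" for w
    using that by (simp add: two_stack_sortable_def)
  have "inj_on f (two_stack_sortable n)"
  proof (rule inj_onI)
    fix w v assume wv: "w \<in> two_stack_sortable n" "v \<in> two_stack_sortable n" "f w = f v"
    show "w = v"
      by (rule encodes_unique_perm[OF n f(1)[OF wv(1)] perm[OF wv(1)] f(2)[OF wv(1)] perm[OF wv(2)]])
         (simp only: wv(3) f(2)[OF wv(2)])
  qed
  moreover have "f ` two_stack_sortable n = tilings n"
  proof (intro equalityI subsetI)
    fix \<delta> assume \<delta>: "\<delta> \<in> tilings n"
    obtain w where w: "w \<in> affine_perms n" "encodes w \<delta>" by (rule encodes_exists[OF n \<delta>])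
    have inj: "inj w" by (rule affine_permsD(2)[OF w(1)])
    have t: "w \<in> two_stack_sortable n"
      using encodes_good[OF n \<delta> inj w(2)] w(1) by (simp add: two_stack_sortable_iff_good[OF n])
    have "f w = \<delta>" by (rule encodes_unique_tiling[OF n inj f(1)[OF t] f(2)[OF t] \<delta> w(2)])
    then show "\<delta> \<in> f ` two_stack_sortable n" using t by blast
  qed (use f in blast)
  ultimately have "bij_betw f (two_stack_sortable n) (tilings n)" by (simp add: bij_betw_def)
  then show "finite (two_stack_sortable n)" "card (two_stack_sortable n) = card (tilings n)"
    using finite_tilings[OF n] bij_betw_finite bij_betw_same_card by blast+
qed

text \<open>Finiteness accompanies the identity because \<open>card\<close> gives 0 on infinite
  sets; it makes the coefficients genuine counts.\<close>

theorem theorem8p24: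
  shows "(\<forall>n\<ge>1. finite (two_stack_sortable n)) \<and>
    fps_affine_I = fps_X * fps_deriv fps_I / (fps_I * (fps_I - 1)) - 1"
proof
  show "\<forall>n\<ge>1. finite (two_stack_sortable n)"
    using two_stack_sortable_tilings(1) by simp
  show "fps_affine_I = fps_X * fps_deriv fps_I / (fps_I * (fps_I - 1)) - 1"
    by (rule fps_affine_I_if_card_tilings) (rule two_stack_sortable_tilings(2))
qed

end
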